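(* Let $(Z_t)_{t\ge0}$ be a piecewise-deterministic Markov process (PDMP) on $\mathbb{R}^d$ with vector field $g\in C^1(\mathbb{R}^d,\mathbb{R}^d)$, flow $(\varphi_t)$, continuous intensity function $\lambda:\mathbb{R}^d\to\mathbb{R}_{\ge0}$ and random jump maps $R^\xi$, $\xi\in S$, and let $P_t$ be its Markov semigroup. Assume: (i) $g$ is Lipschitz continuous, i.e. there is $L>0$ with $\|g(x)-g(y)\|\le L\|x-y\|$ for all $x,y\in\mathbb{R}^d$. (ii) For every $\xi\in S$, $R^\xi\in C^1(\mathbb{R}^d,\mathbb{R}^d)$ and $\|R^\xi(x)-R^\xi(y)\|\le\|x-y\|$ for all $x,y\in\mathbb{R}^d$. (iii) One of the following two conditions holds: (1) $\|\lambda\|_\infty<\infty$, and as $\|z\|\to\infty$ one has $\inf_{0\le s\le t}\|\varphi_s(z)\|\to\infty$ for all $t>0$ and $\|R^\xi(z)\|\to\infty$ for all $\xi\in S$; (2) $\|R^\xi(z)\|=\|z\|$ for all $z\in\mathbb{R}^d$ and $\xi\in S$, and for all $t>0$, as $\|z\|\to\infty$, $$\inf\Big\{\big\|[\varphi_{t_k}\circ R^{\xi_k}\circ\cdots\circ R^{\xi_1}\circ\varphi_{t_0}](z)\big\| \;:\; k\in\mathbb{N},\ t_0,\dots,t_k\ge0,\ t_0+\dots+t_k=t,\ \xi_1,\dots,\xi_k\in S\Big\}\to\infty.$$ Then $C_c^\infty(\mathbb{R}^d)$ is a core of the generator $\mathcal{L}$ of the semigroup $P_t$ considered as a semigroup on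 $C_0(\mathbb{R}^d)$.
   Context: $\|\cdot\|$ is the Euclidean norm, $\|\cdot\|_\infty$ the supremum norm, $\mathbb{N}=\{0,1,2,\dots\}$. $C_0(\mathbb{R}^d)$ is the space of continuous functions $f:\mathbb{R}^d\to\mathbb{R}$ vanishing at infinity; $C_c^\infty(\mathbb{R}^d)$ is the space of infinitely differentiable functions with compact support. PDMP on $\mathbb{R}^d$: the data are a Lipschitz vector field $g\in C^1(\mathbb{R}^d,\mathbb{R}^d)$ with flow $\varphi_t$ ($t\mapsto\varphi_t(z)$ solves $\dot x=g(x)$, $x(0)=z$); a continuous intensity $\lambda:\mathbb{R}^d\to\mathbb{R}_{\ge0}$; a probability space $(S,\mathcal{S},\Xi)$; and a (jointly measurable) function $R:\mathbb{R}^d\times S\to\mathbb{R}^d$, $(z,\xi)\mapsto R^\xi(z)$. For $z\in\mathbb{R}^d$ let $\mu_z$ be the law of the waiting time until the next jump, determined by $\mu_z([t,\infty])=\exp(-\int_0^t\lambda(\varphi_s(z))\,ds)$ for $t\ge0$, and let $W:\mathbb{R}^d\times(0,1)\to[0,\infty]$ be such that $W(z,U)\sim\mu_z$ if $U\sim\mathrm{Unif}_{(0,1)}$. Let $U_1,U_2,\dots\sim\mathrm{Unif}_{(0,1)}$ and $\xi_1,\xi_2,\dots\sim\Xi$ be independent. Starting from $z$, set $T_0=0$, $Z_{T_0}=z$ and recursively $T_k=T_{k-1}+W(Z_{T_{k-1}},U_k)$, $Z_{T_k}=R^{\xi_k}(\varphi_{T_k-T_{k-1}}(Z_{T_{k-1}}))$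 (no further jump occurs once $T_k=\infty$). With $N_t=\max\{k: T_k\le t\}$, set $Z_t=\varphi_{t-T_{N_t}}(Z_{T_{N_t}})$. The Markov semigroup is $P_tf(z)=\mathbb{E}_z[f(Z_t)]$, where $\mathbb{E}_z$ denotes expectation for the process started at $z$. The strong generator of $P_t$, considered as a semigroup on $C_0(\mathbb{R}^d)$, is $\mathcal{L}f=\lim_{t\downarrow0}\frac1t(P_tf-f)$ (limit in $\|\cdot\|_\infty$) with domain $\mathrm{dom}(\mathcal{L})$ the set of $f\in C_0(\mathbb{R}^d)$ for which this limit exists. A core of $\mathcal{L}$ is a subset $E\subset\mathrm{dom}(\mathcal{L})$ such that for every $f\in\mathrm{dom}(\mathcal{L})$ there is a sequence $f_n\in E$ with $\|f_n-f\|_\infty\to0$ and $\|\mathcal{L}f_n-\mathcal{L}f\|_\infty\to0$. *)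

theory Defs
  imports "HOL-Probability.Probability"
begin

section \<open>Function spaces\<close>

primrec C_k :: "nat \<Rightarrow> ('a::euclidean_space \<Rightarrow> 'b::real_normed_vector) \<Rightarrow> bool" where
  "C_k 0 f \<longleftrightarrow> continuous_on UNIV f"
| "C_k (Suc k) f \<longleftrightarrow> (\<forall>x. f differentiable (at x)) \<and>
     (\<forall>v. C_k k (\<lambda>x. frechet_derivative f (at x) v))"

definition C_0 :: "('a::euclidean_space \<Rightarrow> real) set" where
  "C_0 = {f. continuous_on UNIV f \<and> (f \<longlongrightarrow> 0) at_infinity}"

definition C_c_infinity :: "('a::euclidean_space \<Rightarrow> real) set" where
  "C_c_infinity = {f. (\<forall>k. C_k k f) \<and> compact (closure {x. f x \<noteq> 0})}"


section \<open>Strong generator on \<^term>\<open>C_0\<close> and cores\<close>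

text \<open>Convergence in the supremum norm is expressed by \<^const>\<open>uniform_limit\<close> on \<^term>\<open>UNIV\<close>.\<close>

definition generates ::
  "(real \<Rightarrow> ('a::euclidean_space \<Rightarrow> real) \<Rightarrow> 'a \<Rightarrow> real) \<Rightarrow> ('a \<Rightarrow> real) \<Rightarrow> ('a \<Rightarrow> real) \<Rightarrow> bool" where
  "generates P f h \<longleftrightarrow> f \<in> C_0 \<and> h \<in> C_0 \<and>
     uniform_limit UNIV (\<lambda>t z. (P t f z - f z) / t) h (at_right 0)"

definition gen_dom ::
  "(real \<Rightarrow> ('a::euclidean_space \<Rightarrow> real) \<Rightarrow> 'a \<Rightarrow> real) \<Rightarrow> ('a \<Rightarrow> real) set" where
  "gen_dom P = {f. \<exists>h. generates P f h}"

definition gen ::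
  "(real \<Rightarrow> ('a::euclidean_space \<Rightarrow> real) \<Rightarrow> 'a \<Rightarrow> real) \<Rightarrow> ('a \<Rightarrow> real) \<Rightarrow> 'a \<Rightarrow> real" where
  "gen P f = (THE h. generates P f h)"

definition is_core ::
  "(real \<Rightarrow> ('a::euclidean_space \<Rightarrow> real) \<Rightarrow> 'a \<Rightarrow> real) \<Rightarrow> ('a \<Rightarrow> real) set \<Rightarrow> bool" where
  "is_core P E \<longleftrightarrow> E \<subseteq> gen_dom P \<and>
     (\<forall>f\<in>gen_dom P. \<exists>F :: nat \<Rightarrow> 'a \<Rightarrow> real. (\<forall>n. F n \<in> E) \<and>
        uniform_limit UNIV F f sequentially \<and>
        uniform_limit UNIV (\<lambda>n. gen P (F n)) (gen P f) sequentially)"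


section \<open>Piecewise-deterministic Markov processes\<close>

definition is_flow ::
  "('a::euclidean_space \<Rightarrow> 'a) \<Rightarrow> (real \<Rightarrow> 'a \<Rightarrow> 'a) \<Rightarrow> bool" where
  "is_flow g \<phi> \<longleftrightarrow> (\<forall>z. \<phi> 0 z = z \<and>
     (\<forall>t\<ge>0. ((\<lambda>s. \<phi> s z) has_vector_derivative g (\<phi> t z)) (at t within {0..})))"

definition is_waiting_law ::
  "(real \<Rightarrow> 'a::euclidean_space \<Rightarrow> 'a) \<Rightarrow> ('a \<Rightarrow> real) \<Rightarrow> 'a \<Rightarrow> ennreal measure \<Rightarrow> bool" where
  "is_waiting_law \<phi> lam z \<mu> \<longleftrightarrow> prob_space \<mu> \<and> sets \<mu> = sets borel \<and>
     (\<forall>t\<ge>0. measure \<mu> {ennreal t..} = exp (- integral {0..t} (\<lambda>s. lam (\<phi> s z))))"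

definition unif01 :: "real measure" where
  "unif01 = restrict_space lborel {0<..<1}"

text \<open>
  \<open>jump_chain \<phi> R W z u x k\<close> is the pair \<open>(T_k, Z_{T_k})\<close> for the process started at \<open>z\<close>, where
  \<open>u i\<close> and \<open>x i\<close> are the values of \<open>U_{i+1}\<close> and \<open>\<xi>_{i+1}\<close>. Since \<open>T_{k+1} - T_k\<close> is the waiting
  time \<open>w\<close>, the flow is run for time \<open>w\<close>. Once \<open>T_k = \<infinity>\<close>, all later jump times are \<open>\<infinity>\<close> too, so that
  the (meaningless) second component is then never used.
\<close>

primrec jump_chain ::
  "(real \<Rightarrow> 'a \<Rightarrow> 'a) \<Rightarrow> ('s \<Rightarrow> 'a \<Rightarrow> 'a) \<Rightarrow> ('a \<Rightarrow> real \<Rightarrow> ennreal) \<Rightarrow> 'a \<Rightarrow>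
   (nat \<Rightarrow> real) \<Rightarrow> (nat \<Rightarrow> 's) \<Rightarrow> nat \<Rightarrow> ennreal \<times> 'a" where
  "jump_chain \<phi> R W z u x 0 = (0, z)"
| "jump_chain \<phi> R W z u x (Suc k) =
     (let (T, y) = jump_chain \<phi> R W z u x k; w = W y (u k)
      in (T + w, R (x k) (\<phi> (enn2real w) y)))"

text \<open>
  The set of jump indices below is finite unless infinitely many jumps occur up to time \<open>t\<close>; in
  that case \<^const>\<open>Max\<close> is an unspecified constant.
\<close>

definition pdmp_process ::
  "(real \<Rightarrow> 'a \<Rightarrow> 'a) \<Rightarrow> ('s \<Rightarrow> 'a \<Rightarrow> 'a) \<Rightarrow> ('a \<Rightarrow> real \<Rightarrow> ennreal) \<Rightarrow> 'a \<Rightarrow>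
   (nat \<Rightarrow> real) \<Rightarrow> (nat \<Rightarrow> 's) \<Rightarrow> real \<Rightarrow> 'a" where
  "pdmp_process \<phi> R W z u x t =
     (let N = Max {k. fst (jump_chain \<phi> R W z u x k) \<le> ennreal t};
          (T, y) = jump_chain \<phi> R W z u x N
      in \<phi> (t - enn2real T) y)"

definition pdmp_semigroup ::
  "(real \<Rightarrow> 'a \<Rightarrow> 'a) \<Rightarrow> ('s \<Rightarrow> 'a \<Rightarrow> 'a) \<Rightarrow> ('a \<Rightarrow> real \<Rightarrow> ennreal) \<Rightarrow>
   'w measure \<Rightarrow> (nat \<Rightarrow> 'w \<Rightarrow> real) \<Rightarrow> (nat \<Rightarrow> 'w \<Rightarrow> 's) \<Rightarrow>
   real \<Rightarrow> ('a \<Rightarrow> real) \<Rightarrow> 'a \<Rightarrow> real" where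
  "pdmp_semigroup \<phi> R W M U \<xi> t f z =
     (\<integral>\<omega>. f (pdmp_process \<phi> R W z (\<lambda>k. U k \<omega>) (\<lambda>k. \<xi> k \<omega>) t) \<partial>M)"

text \<open>
  The last two assumptions say that \<open>U_1, U_2, \<dots> \<sim> Unif(0,1)\<close> and \<open>\<xi>_1, \<xi>_2, \<dots> \<sim> \<Xi>\<close> are all
  independent: the pairs \<open>(U_k, \<xi>_k)\<close> are independent, each with a product law. They are
  stated for pairs because \<^const>\<open>prob_space.indep_vars\<close> needs variables of one type.
\<close>

locale pdmp =
  \<Xi>: prob_space \<Xi> + prob_space M
  for g :: "'a::euclidean_space \<Rightarrow> 'a"
    and \<phi> :: "real \<Rightarrow> 'a \<Rightarrow> 'a"
    and lam :: "'a \<Rightarrow> real"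
    and \<Xi> :: "'s measure"
    and R :: "'s \<Rightarrow> 'a \<Rightarrow> 'a"
    and W :: "'a \<Rightarrow> real \<Rightarrow> ennreal"
    and M :: "'w measure"
    and U :: "nat \<Rightarrow> 'w \<Rightarrow> real"
    and \<xi> :: "nat \<Rightarrow> 'w \<Rightarrow> 's" +
  assumes g_C1: "C_k 1 g"
    and flow: "is_flow g \<phi>"
    and lam_continuous: "continuous_on UNIV lam"
    and lam_nonneg: "0 \<le> lam z"
    and R_measurable: "(\<lambda>(z, s). R s z) \<in> borel \<Otimes>\<^sub>M \<Xi> \<rightarrow>\<^sub>M borel"
    and W_measurable: "(\<lambda>(z, u). W z u) \<in> borel \<Otimes>\<^sub>M unif01 \<rightarrow>\<^sub>M borel"
    and W_law: "is_waiting_law \<phi> lam z (distr unif01 borel (W z))"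
    and noise_indep: "indep_vars (\<lambda>_. unif01 \<Otimes>\<^sub>M \<Xi>) (\<lambda>k \<omega>. (U k \<omega>, \<xi> k \<omega>)) UNIV"
    and noise_law: "distr M (unif01 \<Otimes>\<^sub>M \<Xi>) (\<lambda>\<omega>. (U k \<omega>, \<xi> k \<omega>)) = unif01 \<Otimes>\<^sub>M \<Xi>"

text \<open>
  \<open>flow_jumps \<phi> R ts xs k z\<close> is
  \<open>(\<phi>_{t_k} \<circ> R^{\<xi>_k} \<circ> \<dots> \<circ> R^{\<xi>_1} \<circ> \<phi>_{t_0})(z)\<close> with \<open>t_i = ts i\<close>, \<open>\<xi>_i = xs i\<close>.
\<close>

primrec flow_jumps ::
  "(real \<Rightarrow> 'a \<Rightarrow> 'a) \<Rightarrow> ('s \<Rightarrow> 'a \<Rightarrow> 'a) \<Rightarrow> (nat \<Rightarrow> real) \<Rightarrow> (nat \<Rightarrow> 's) \<Rightarrow> nat \<Rightarrow> 'a \<Rightarrow> 'a" where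
  "flow_jumps \<phi> R ts xs 0 z = \<phi> (ts 0) z"
| "flow_jumps \<phi> R ts xs (Suc k) z =
     \<phi> (ts (Suc k)) (R (xs (Suc k)) (flow_jumps \<phi> R ts xs k z))"

end

theory Submission
  imports Defs
begin

text \<open>
  Write \<open>A F(z) = DF(z)(g(z))\<close>, \<open>Q F(z) = \<integral> F(R\<^sup>\<xi>(z)) \<Xi>(d\<xi>)\<close> and \<open>L F = A F + lam (Q F - F)\<close>.
  The core property follows from two facts: \<open>(P_t F - F) / t\<close> tends uniformly to \<open>L F\<close> for smooth
  \<open>F\<close> with compact support, and \<open>\<beta> - L\<close> maps these functions onto a dense subset of \<open>C_0\<close> for some
  \<open>\<beta> > 0\<close>. Indeed \<open>P_t\<close> is a contraction in the supremum norm, so looking at a maximum of \<open>\<bar>u\<bar>\<close> gives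
  \<open>\<beta> \<parallel>u\<parallel> \<le> \<parallel>\<beta> u - k\<parallel>\<close> whenever \<open>k\<close> is the generator of the semigroup applied to \<open>u\<close>. If \<open>f\<close> has
  generator \<open>h\<close> and \<open>\<beta> F_n - L F_n\<close> approximates \<open>\<beta> f - h\<close>, this inequality for \<open>u = F_n - f\<close> shows
  that \<open>F_n\<close> tends to \<open>f\<close>, and then \<open>L F_n\<close> tends to \<open>h\<close> (\<open>is_core_of_dense_range\<close>).

  Density of the range is obtained by solving the equation \<open>\<beta> F - L F = h\<close> with an error of at most
  \<open>q \<parallel>h\<parallel>\<close> for a fixed \<open>q < 1\<close>; solving again for the residual and iterating removes the error
  (\<open>dense_range_of_contraction\<close>). This is done for three operators in turn.
  For \<open>\<alpha> - A\<close>, the function \<open>f(z) = \<integral>\<^sub>0\<^sup>1 exp (- \<alpha> s) h(\<phi>_s z) ds\<close> solves the equation up to the error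
  \<open>exp (- \<alpha>) \<parallel>h\<parallel>\<close>; it is Lipschitz with compact support, and mollification turns it into a smooth
  function, because the commutator of \<open>A\<close> with the convolution by a kernel of radius \<open>d\<close> is bounded
  by \<open>d\<close> times the Lipschitz constants of \<open>f\<close> and of \<open>g\<close> (\<open>mollify_along_flow\<close>).
  If \<open>0 \<le> lam \<le> \<Lambda>\<close>, then \<open>\<beta> - L\<close> differs from \<open>(\<beta> + \<Lambda>) - A\<close> by the operator
  \<open>(\<Lambda> - lam) + lam Q\<close> of norm at most \<open>\<Lambda>\<close>, so \<open>q\<close> is essentially \<open>\<Lambda> / (\<beta> + \<Lambda>)\<close>.
  If \<open>lam\<close> is unbounded but jumps preserve the norm, solve with \<open>lam\<close> capped outside a large ball and
  multiply the solution by a smooth radial cutoff \<open>\<chi>\<close> of that ball: \<open>Q\<close> commutes with \<open>\<chi>\<close>, and the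
  only new term \<open>F A\<chi>\<close> is at most \<open>C \<parallel>h\<parallel> / \<beta>\<close> up to small errors, where \<open>C\<close> does not depend on the
  ball since \<open>g\<close> grows linearly; \<open>\<beta> = 2 C + 1\<close> will do.

  The probabilistic half works with \<open>trunc f n z t = E_z[f(Z_t); T_n > t]\<close>. Conditioning on the first
  jump gives a renewal recursion in \<open>n\<close> (\<open>trunc_Suc\<close>), from which continuity in \<open>z\<close> follows by
  dominated convergence. Up to time \<open>t\<close> the process started in a bounded set meets only intensities
  below some constant \<open>C\<close>, hence \<open>P(T_n \<le> t) \<le> (C t)\<^sup>n / n!\<close> (\<open>explosion_bound\<close>), and
  \<open>trunc f n\<close> tends to \<open>P_t f\<close> locally uniformly. The same bound for \<open>n = 2\<close> makes two jumps before
  \<open>t\<close> negligible as \<open>t\<close> tends to 0, and the terms with at most one jump yield the generator.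
  That \<open>P_t f\<close> vanishes at infinity is inherited from \<open>trunc f n\<close> if \<open>lam\<close> is bounded; if jumps
  preserve the norm, it holds because a process started far away is still far away at time \<open>t\<close>.
\<close>

section \<open>Smooth functions with compact support\<close>

text \<open>
  Smoothness of every order by coinduction: it suffices to exhibit a class of functions that is
  closed under directional derivatives.
\<close>

lemma C_k_coinduct:
  assumes "f \<in> S"
    and "\<And>f. f \<in> S \<Longrightarrow> \<exists>D. (\<forall>x. (f has_derivative D x) (at x)) \<and> (\<forall>v. (\<lambda>x. D x v) \<in> S)"
  shows "C_k k f"
  using assms(1)
proof (induction k arbitrary: f)
  case 0
  then obtain D where "\<And>x. (f has_derivative D x) (at x)"
    using assms(2) by blast
  then show ?case
    by (auto intro!: continuous_at_imp_continuous_on has_derivative_continuous)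
next
  case (Suc k)
  then obtain D where D: "\<And>x. (f has_derivative D x) (at x)" "\<And>v. (\<lambda>x. D x v) \<in> S"
    using assms(2) by blast
  have "frechet_derivative f (at x) = D x" for x
    using frechet_derivative_at[OF D(1)] by simp
  with D Suc.IH show ?case
    by (auto simp: differentiable_def)
qed

lemma C_k_Suc_imp_C_k: "C_k (Suc k) f \<Longrightarrow> C_k k f"
proof (induction k arbitrary: f)
  case 0
  then show ?case
    by (auto intro!: continuous_at_imp_continuous_on differentiable_imp_continuous_within)
qed auto

lemma C_k_imp_continuous: "C_k k f \<Longrightarrow> continuous_on UNIV f"
  by (induction k) (auto dest: C_k_Suc_imp_C_k simp del: C_k.simps(2))

lemma C_c_infinity_iff: "f \<in> C_c_infinity \<longleftrightarrow> (\<forall>k. C_k k f) \<and> bounded {x. f x \<noteq> 0}"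
  by (simp add: C_c_infinity_def)

lemma C_c_infinity_continuous: "f \<in> C_c_infinity \<Longrightarrow> continuous_on UNIV f"
  using C_k_imp_continuous by (auto simp: C_c_infinity_def)

lemma C_c_infinity_has_derivative:
  "f \<in> C_c_infinity \<Longrightarrow> (f has_derivative frechet_derivative f (at x)) (at x)"
proof -
  assume "f \<in> C_c_infinity"
  then have "C_k (Suc 0) f" by (auto simp: C_c_infinity_def simp del: C_k.simps)
  then show ?thesis by (simp flip: frechet_derivative_works)
qed

lemma C_c_infinity_derivative:
  assumes f: "f \<in> C_c_infinity"
  shows "(\<lambda>x. frechet_derivative f (at x) v) \<in> C_c_infinity"
proof -
  have "C_k k (\<lambda>x. frechet_derivative f (at x) v)" for k
  proof -
    have "C_k (Suc k) f" using f by (auto simp: C_c_infinity_def simp del: C_k.simps)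
    then show ?thesis by simp
  qed
  moreover have "{x. frechet_derivative f (at x) v \<noteq> 0} \<subseteq> closure {x. f x \<noteq> 0}"
  proof safe
    fix x assume nz: "frechet_derivative f (at x) v \<noteq> 0"
    show "x \<in> closure {x. f x \<noteq> 0}"
    proof (rule ccontr)
      assume x: "x \<notin> closure {x. f x \<noteq> 0}"
      have "(f has_derivative (\<lambda>_. 0)) (at x)"
      proof (rule has_derivative_transform_within_open)
        show "((\<lambda>_. 0) has_derivative (\<lambda>_. 0)) (at x)" by simp
        show "open (- closure {x. f x \<noteq> 0})" by (intro open_Compl closed_closure)
        show "x \<in> - closure {x. f x \<noteq> 0}" using x by simp
        show "0 = f y" if "y \<in> - closure {x. f x \<noteq> 0}" for y
          using that closure_subset[of "{x. f x \<noteq> 0}"] by auto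
      qed
      then have "frechet_derivative f (at x) = (\<lambda>_. 0)"
        using frechet_derivative_at by metis
      with nz show False by simp
    qed
  qed
  ultimately show ?thesis
    using f unfolding C_c_infinity_iff by (auto intro: bounded_subset bounded_closure)
qed

lemma C_c_infinityI:
  assumes "\<And>k. C_k k f" "\<And>x. norm x > r \<Longrightarrow> f x = 0"
  shows "f \<in> C_c_infinity"
  using assms unfolding C_c_infinity_iff
  by (auto simp: bounded_iff intro!: exI[of _ r] leI)

lemma C_c_infinity_support:
  assumes "f \<in> C_c_infinity"
  obtains r where "r > 0" "\<And>x. norm x > r \<Longrightarrow> f x = 0"
proof -
  obtain r where "r > 0" "\<forall>x\<in>{x. f x \<noteq> 0}. norm x \<le> r"
    using assms unfolding C_c_infinity_iff bounded_pos by auto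
  then show thesis using that[of r] by force
qed

lemma C_c_infinity_lincomb:
  assumes "f \<in> C_c_infinity" "h \<in> C_c_infinity"
  shows "(\<lambda>x. a * f x + b * h x) \<in> C_c_infinity"
proof -
  let ?S = "{(\<lambda>x. a * f x + b * h x) | f h. f \<in> C_c_infinity \<and> h \<in> C_c_infinity}"
  obtain r where r: "\<And>x. norm x > r \<Longrightarrow> f x = 0" using C_c_infinity_support assms by metis
  obtain r' where r': "\<And>x. norm x > r' \<Longrightarrow> h x = 0" using C_c_infinity_support assms by metis
  show ?thesis
  proof (rule C_c_infinityI[where r="max r r'"])
    show "C_k k (\<lambda>x. a * f x + b * h x)" for k
    proof (rule C_k_coinduct[of _ ?S])
      show "(\<lambda>x. a * f x + b * h x) \<in> ?S" using assms by blast
    next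
      fix u assume "u \<in> ?S"
      then obtain f h where u: "u = (\<lambda>x. a * f x + b * h x)" "f \<in> C_c_infinity" "h \<in> C_c_infinity"
        by blast
      define D where "D x v = a * frechet_derivative f (at x) v + b * frechet_derivative h (at x) v"
        for x v
      have "(u has_derivative D x) (at x)" for x
        unfolding u D_def
        by (intro derivative_intros C_c_infinity_has_derivative u)
      moreover have "(\<lambda>x. D x v) \<in> ?S" for v
        unfolding D_def mem_Collect_eq
        by (rule exI[of _ "\<lambda>x. frechet_derivative f (at x) v"],
            rule exI[of _ "\<lambda>x. frechet_derivative h (at x) v"])
           (simp add: u C_c_infinity_derivative)
      ultimately show "\<exists>D. (\<forall>x. (u has_derivative D x) (at x)) \<and> (\<forall>v. (\<lambda>x. D x v) \<in> ?S)"
        by (intro exI[of _ D]) simp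
    qed
  qed (simp add: r r')
qed

text \<open>
  By the product rule the derivative of a product is a sum of two products, so products have to be
  closed under addition to form a class to which coinduction applies.
\<close>

inductive_set product_sums :: "('a::euclidean_space \<Rightarrow> real) set" where
  mult: "f \<in> C_c_infinity \<Longrightarrow> h \<in> C_c_infinity \<Longrightarrow> (\<lambda>x. f x * h x) \<in> product_sums"
| add: "f \<in> product_sums \<Longrightarrow> h \<in> product_sums \<Longrightarrow> (\<lambda>x. f x + h x) \<in> product_sums"

lemma C_c_infinity_mult:
  assumes "f \<in> C_c_infinity" "h \<in> C_c_infinity"
  shows "(\<lambda>x. f x * h x) \<in> C_c_infinity"
proof -
  obtain r where r: "\<And>x. norm x > r \<Longrightarrow> f x = 0" using C_c_infinity_support assms by metis
  show ?thesis
  proof (rule C_c_infinityI[where r=r])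
    show "C_k k (\<lambda>x. f x * h x)" for k
    proof (rule C_k_coinduct[of _ product_sums])
      show "(\<lambda>x. f x * h x) \<in> product_sums" using assms by (rule product_sums.mult)
    next
      fix u :: "'a \<Rightarrow> real" assume "u \<in> product_sums"
      then show "\<exists>D. (\<forall>x. (u has_derivative D x) (at x)) \<and> (\<forall>v. (\<lambda>x. D x v) \<in> product_sums)"
      proof induction
        case (mult f h)
        define D where "D x v = f x * frechet_derivative h (at x) v + frechet_derivative f (at x) v * h x"
          for x v
        have "((\<lambda>x. f x * h x) has_derivative D x) (at x)" for x
          unfolding D_def
          by (intro derivative_intros C_c_infinity_has_derivative mult)
        moreover have "(\<lambda>x. D x v) \<in> product_sums" for v
          unfolding D_def
          by (intro product_sums.intros mult C_c_infinity_derivative)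
        ultimately show ?case by blast
      next
        case (add f h)
        then obtain D E where
          D: "\<And>x. (f has_derivative D x) (at x)" "\<And>v. (\<lambda>x. D x v) \<in> product_sums" and
          E: "\<And>x. (h has_derivative E x) (at x)" "\<And>v. (\<lambda>x. E x v) \<in> product_sums"
          by blast
        have "((\<lambda>x. f x + h x) has_derivative (\<lambda>v. D x v + E x v)) (at x)" for x
          by (intro derivative_intros D E)
        moreover have "(\<lambda>x. D x v + E x v) \<in> product_sums" for v
          by (intro product_sums.intros D E)
        ultimately show ?case by (intro exI[of _ "\<lambda>x v. D x v + E x v"]) simp
      qed
    qed
  qed (simp add: r)
qed

subsection \<open>A bump function\<close>

text \<open>
  \<open>flat_exp 0\<close> is the standard function that vanishes to infinite order at 0; the powers in the
  other members make the family closed under differentiation up to linear combinations.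
\<close>

definition flat_exp :: "nat \<Rightarrow> real \<Rightarrow> real" where
  "flat_exp n u = (if u \<le> 0 then 0 else exp (- inverse u) * inverse u ^ n)"

lemma flat_exp_tendsto_0: "(flat_exp n \<longlongrightarrow> 0) (at 0)"
proof -
  have "((\<lambda>u::real. inverse u ^ n / exp (inverse u)) \<longlongrightarrow> 0) (at_right 0)"
    by (rule filterlim_compose[OF tendsto_power_div_exp_0 filterlim_inverse_at_top_right])
  then have "(flat_exp n \<longlongrightarrow> 0) (at_right 0)"
    by (rule tendsto_cong[THEN iffD1, rotated])
       (auto simp: eventually_at_filter flat_exp_def exp_minus field_simps)
  moreover have "(flat_exp n \<longlongrightarrow> 0) (at_left 0)"
    by (rule tendsto_eventually) (auto simp: eventually_at_filter flat_exp_def)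
  ultimately show ?thesis
    by (simp add: filterlim_split_at)
qed

lemma has_derivative_flat_exp:
  "(flat_exp n has_real_derivative flat_exp (n + 2) u - n * flat_exp (n + 1) u) (at u)"
proof -
  consider "u < 0" | "u = 0" | "u > 0" by linarith
  then show ?thesis
  proof cases
    case 1
    have "(flat_exp n has_real_derivative 0) (at u)"
      by (rule has_field_derivative_transform_within_open[of "\<lambda>_. 0" _ _ "{..<0}"])
         (use 1 in \<open>auto simp: flat_exp_def\<close>)
    with 1 show ?thesis by (simp add: flat_exp_def)
  next
    case 2
    have "((\<lambda>h. flat_exp n h / h) \<longlongrightarrow> 0) (at 0)"
      by (rule tendsto_cong[THEN iffD1, OF _ flat_exp_tendsto_0[of "Suc n"]])
         (auto intro!: always_eventually simp: flat_exp_def divide_inverse)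
    then have "(flat_exp n has_real_derivative 0) (at 0)"
      by (simp add: DERIV_def flat_exp_def[of n 0])
    with 2 show ?thesis by (simp add: flat_exp_def)
  next
    case 3
    define w where "w = inverse u"
    have inv: "(inverse has_real_derivative - (w * w)) (at u)"
      using DERIV_inverse[of u] 3 by (simp add: w_def power2_eq_square)
    have "((\<lambda>u. exp (- inverse u) * inverse u ^ n) has_real_derivative
        exp (- w) * (w * w) * w ^ n - exp (- w) * (real n * w ^ (n - 1) * (w * w))) (at u)"
      using DERIV_mult[OF DERIV_fun_exp[OF DERIV_minus[OF inv]] DERIV_power[OF inv, of n]]
      by (simp add: w_def[symmetric] algebra_simps)
    also have "exp (- w) * (w * w) * w ^ n - exp (- w) * (real n * w ^ (n - 1) * (w * w)) =
        flat_exp (n + 2) u - n * flat_exp (n + 1) u"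
      by (cases n) (use 3 in \<open>simp_all add: flat_exp_def w_def[symmetric] algebra_simps\<close>)
    finally have "((\<lambda>u. exp (- inverse u) * inverse u ^ n) has_real_derivative
        flat_exp (n + 2) u - n * flat_exp (n + 1) u) (at u)" .
    then show ?thesis
      by (rule has_field_derivative_transform_within_open[of _ _ _ "{0<..}"])
         (use 3 in \<open>auto simp: flat_exp_def\<close>)
  qed
qed

definition bump :: "real \<Rightarrow> 'a::euclidean_space \<Rightarrow> real" where
  "bump c x = flat_exp 0 (1 - c * (x \<bullet> x))"

text \<open>
  The chain rule produces factors \<open>x \<bullet> v\<close>, so this span with polynomial coefficients is closed
  under directional derivatives.
\<close>

inductive_set bump_derivatives :: "real \<Rightarrow> ('a::euclidean_space \<Rightarrow> real) set" for c where
  base: "(\<lambda>x. flat_exp n (1 - c * (x \<bullet> x))) \<in> bump_derivatives c"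
| inner: "f \<in> bump_derivatives c \<Longrightarrow> (\<lambda>x. (x \<bullet> v) * f x) \<in> bump_derivatives c"
| scale: "f \<in> bump_derivatives c \<Longrightarrow> (\<lambda>x. a * f x) \<in> bump_derivatives c"
| add: "f \<in> bump_derivatives c \<Longrightarrow> h \<in> bump_derivatives c \<Longrightarrow> (\<lambda>x. f x + h x) \<in> bump_derivatives c"

lemma has_derivative_flat_exp_inner:
  fixes x :: "'a::euclidean_space"
  shows "((\<lambda>x. flat_exp n (1 - c * (x \<bullet> x))) has_derivative
    (\<lambda>v. (-2 * c) * ((x \<bullet> v) * (flat_exp (n + 2) (1 - c * (x \<bullet> x)) + (- n) * flat_exp (n + 1) (1 - c * (x \<bullet> x)))))) (at x)"
proof -
  have "((\<lambda>x. 1 - c * (x \<bullet> x)) has_derivative (\<lambda>v. - 2 * c * (x \<bullet> v))) (at x)"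
    by (auto intro!: derivative_eq_intros simp: inner_commute)
  from has_derivative_compose[OF this has_derivative_flat_exp[THEN has_field_derivative_imp_has_derivative, of n]]
  show ?thesis by (simp add: algebra_simps)
qed

lemma bump_smooth:
  assumes c: "c > 0"
  shows "(bump c :: 'a::euclidean_space \<Rightarrow> real) \<in> C_c_infinity"
proof (rule C_c_infinityI[OF C_k_coinduct[of _ "bump_derivatives c"]])
  show "(bump c :: 'a \<Rightarrow> real) \<in> bump_derivatives c"
    unfolding bump_def by (rule bump_derivatives.base)
  show "bump c x = 0" if "1 / sqrt c < norm x" for x :: 'a
  proof -
    have "1 < norm x * sqrt c" using that c by (simp add: field_simps)
    then have "1 < (norm x * sqrt c)^2" using one_less_power[of "norm x * sqrt c" 2] by simp
    then have "1 - c * (x \<bullet> x) \<le> 0"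
      using c by (simp add: power_mult_distrib dot_square_norm algebra_simps)
    then show ?thesis by (simp add: bump_def flat_exp_def)
  qed
  fix u :: "'a \<Rightarrow> real" assume "u \<in> bump_derivatives c"
  then show "\<exists>D. (\<forall>x. (u has_derivative D x) (at x)) \<and> (\<forall>v. (\<lambda>x. D x v) \<in> bump_derivatives c)"
  proof induction
    case (base n)
    show ?case
      by (rule exI, rule conjI, rule allI, rule has_derivative_flat_exp_inner)
         (intro allI bump_derivatives.intros)
  next
    case (inner f w)
    then obtain D where
      D: "\<And>x. (f has_derivative D x) (at x)" "\<And>v. (\<lambda>x. D x v) \<in> bump_derivatives c" by blast
    have "((\<lambda>x. (x \<bullet> w) * f x) has_derivative (\<lambda>v. (x \<bullet> w) * D x v + (v \<bullet> w) * f x)) (at x)" for x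
      by (rule derivative_eq_intros D refl)+ simp
    then show ?case
      by (intro exI[of _ "\<lambda>x v. (x \<bullet> w) * D x v + (v \<bullet> w) * f x"] conjI allI)
         (assumption | intro bump_derivatives.intros D inner.hyps)+
  next
    case (scale f a)
    then obtain D where
      D: "\<And>x. (f has_derivative D x) (at x)" "\<And>v. (\<lambda>x. D x v) \<in> bump_derivatives c" by blast
    have "((\<lambda>x. a * f x) has_derivative (\<lambda>v. a * D x v)) (at x)" for x
      by (intro derivative_intros D)
    then show ?case
      by (intro exI[of _ "\<lambda>x v. a * D x v"] conjI allI)
         (assumption | intro bump_derivatives.intros D)+
  next
    case (add f h)
    then obtain D E where
      D: "\<And>x. (f has_derivative D x) (at x)" "\<And>v. (\<lambda>x. D x v) \<in> bump_derivatives c" and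
      E: "\<And>x. (h has_derivative E x) (at x)" "\<And>v. (\<lambda>x. E x v) \<in> bump_derivatives c" by blast
    have "((\<lambda>x. f x + h x) has_derivative (\<lambda>v. D x v + E x v)) (at x)" for x
      by (intro derivative_intros D E)
    then show ?case
      by (intro exI[of _ "\<lambda>x v. D x v + E x v"] conjI allI)
         (assumption | intro bump_derivatives.intros D E)+
  qed
qed

lemma bump_nonneg: "bump c x \<ge> 0"
  by (simp add: bump_def flat_exp_def)

lemma bump_eq_0:
  assumes "c > 0" "c * (norm x)^2 \<ge> 1"
  shows "bump c x = 0"
  using assms by (simp add: bump_def flat_exp_def dot_square_norm)

lemma bump_pos: "bump c 0 > 0"
  by (simp add: bump_def flat_exp_def)

lemma bump_minus: "bump c (- x) = bump c x"
  by (simp add: bump_def)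

section \<open>Mollification and density\<close>

lemma C_0_iff:
  "f \<in> C_0 \<longleftrightarrow> continuous_on UNIV f \<and> (\<forall>e>0. \<exists>r. \<forall>x. norm x > r \<longrightarrow> \<bar>f x\<bar> \<le> e)"
proof -
  have "(\<forall>e>0. \<exists>r. \<forall>x. r \<le> norm x \<longrightarrow> \<bar>f x\<bar> < e) \<longleftrightarrow>
      (\<forall>e>0. \<exists>r. \<forall>x. norm x > r \<longrightarrow> \<bar>f x\<bar> \<le> e)"
  proof safe
    fix e :: real assume "e > 0" and *: "\<forall>e>0. \<exists>r. \<forall>x. norm x > r \<longrightarrow> \<bar>f x\<bar> \<le> e"
    then obtain r where r: "\<And>x. norm x > r \<Longrightarrow> \<bar>f x\<bar> \<le> e / 2" by (meson half_gt_zero)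
    have "\<bar>f x\<bar> < e" if "r + 1 \<le> norm x" for x
      using r[of x] that \<open>e > 0\<close> by linarith
    then show "\<exists>r. \<forall>x. r \<le> norm x \<longrightarrow> \<bar>f x\<bar> < e" by blast
  qed (meson less_imp_le)
  then show ?thesis
    unfolding C_0_def Lim_at_infinity by (simp add: dist_norm)
qed

lemma C_0_continuous: "f \<in> C_0 \<Longrightarrow> continuous_on UNIV f"
  by (simp add: C_0_iff)

lemma C_0_measurable: "f \<in> C_0 \<Longrightarrow> f \<in> borel_measurable borel"
  by (rule borel_measurable_continuous_onI[OF C_0_continuous])

lemma C_0_small:
  assumes "f \<in> C_0" "e > 0"
  obtains r where "r > 0" "\<And>x. norm x > r \<Longrightarrow> \<bar>f x\<bar> \<le> e"
proof -
  obtain r where r: "\<And>x. norm x > r \<Longrightarrow> \<bar>f x\<bar> \<le> e"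
    using assms by (auto simp: C_0_iff)
  show thesis by (rule that[of "max r 1"]) (auto intro: r)
qed

lemma C_0_bounded:
  assumes "f \<in> C_0"
  obtains B where "B > 0" "\<And>x. \<bar>f x\<bar> \<le> B"
proof -
  obtain r where r: "r > 0" "\<And>x. norm x > r \<Longrightarrow> \<bar>f x\<bar> \<le> 1"
    using C_0_small[OF assms, of 1] by auto
  have "compact (f ` cball 0 r)"
    using C_0_continuous[OF assms] by (intro compact_continuous_image) (auto intro: continuous_on_subset)
  then obtain B where "\<And>x. norm x \<le> r \<Longrightarrow> \<bar>f x\<bar> \<le> B"
    by (force dest!: compact_imp_bounded simp: bounded_iff)
  with r have "\<bar>f x\<bar> \<le> max 1 B" for x
    by (cases "norm x \<le> r") (force simp: le_max_iff_disj)+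
  then show thesis by (intro that[of "max 1 B"]) auto
qed

lemma C_0_uniformly_continuous:
  assumes f: "f \<in> C_0" and e: "e > 0"
  obtains d where "d > 0" "\<And>x y. dist x y < d \<Longrightarrow> \<bar>f x - f y\<bar> \<le> e"
proof -
  obtain r where r: "r > 0" "\<And>x. norm x > r \<Longrightarrow> \<bar>f x\<bar> \<le> e / 2"
    using C_0_small[OF f, of "e/2"] e by auto
  have "uniformly_continuous_on (cball 0 (r + 1)) f"
    using C_0_continuous[OF f] by (intro compact_uniformly_continuous) (auto intro: continuous_on_subset)
  then obtain d where d: "d > 0"
    "\<And>x y. x \<in> cball 0 (r+1) \<Longrightarrow> y \<in> cball 0 (r+1) \<Longrightarrow> dist y x < d \<Longrightarrow> dist (f y) (f x) < e"
    unfolding uniformly_continuous_on_def using e by meson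
  show thesis
  proof (rule that[of "min d 1"])
    fix x y :: 'a assume xy: "dist x y < min d 1"
    show "\<bar>f x - f y\<bar> \<le> e"
    proof (cases "norm x \<le> r + 1 \<and> norm y \<le> r + 1")
      case True
      then show ?thesis using d(2)[of y x] xy by (simp add: dist_real_def dist_commute)
    next
      case False
      moreover have "\<bar>norm x - norm y\<bar> < 1"
        using xy norm_triangle_ineq3[of x y] by (simp add: dist_norm)
      ultimately have "norm x > r" "norm y > r" by auto
      with r(2)[of x] r(2)[of y] show ?thesis by linarith
    qed
  qed (use d in auto)
qed

lemma C_0I_compact_support:
  assumes "continuous_on UNIV f" "\<And>x. norm x > r \<Longrightarrow> f x = 0"
  shows "f \<in> C_0"
  using assms by (auto simp: C_0_iff intro!: exI[of _ r])

lemma C_0_lincomb: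
  assumes f: "f \<in> C_0" and h: "h \<in> C_0"
  shows "(\<lambda>x. a * f x + b * h x) \<in> C_0"
  using assms unfolding C_0_def by (auto intro!: continuous_intros tendsto_eq_intros)

lemma C_0_mult_bounded:
  assumes f: "f \<in> C_0" and h: "continuous_on UNIV h" "\<And>x. \<bar>h x\<bar> \<le> B"
  shows "(\<lambda>x. h x * f x) \<in> C_0"
  unfolding C_0_iff
proof safe
  show "continuous_on UNIV (\<lambda>x. h x * f x)"
    using C_0_continuous[OF f] h by (intro continuous_intros)
  fix e :: real assume "e > 0"
  have "B \<ge> 0" using h(2)[of 0] by linarith
  then obtain r where r: "r > 0" "\<And>x. norm x > r \<Longrightarrow> \<bar>f x\<bar> \<le> e / (B + 1)"
    using C_0_small[OF f, of "e / (B+1)"] \<open>e > 0\<close> by auto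
  have "\<bar>h x * f x\<bar> \<le> e" if "norm x > r" for x
  proof -
    have "\<bar>h x * f x\<bar> \<le> (B + 1) * (e / (B + 1))"
      unfolding abs_mult using h(2)[of x] r(2)[OF that] \<open>B \<ge> 0\<close> by (intro mult_mono) auto
    then show ?thesis using \<open>B \<ge> 0\<close> by simp
  qed
  then show "\<exists>r. \<forall>x. r < norm x \<longrightarrow> \<bar>h x * f x\<bar> \<le> e" by blast
qed

lemma C_c_infinity_C_0: "f \<in> C_c_infinity \<Longrightarrow> f \<in> C_0"
  using C_c_infinity_support C_c_infinity_continuous C_0I_compact_support by metis

lemma frechet_derivative_Basis:
  fixes f :: "'a::euclidean_space \<Rightarrow> real"
  assumes "f \<in> C_c_infinity"
  shows "frechet_derivative f (at x) v = (\<Sum>b\<in>Basis. (v \<bullet> b) * frechet_derivative f (at x) b)"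
proof -
  have "linear (frechet_derivative f (at x))"
    using C_c_infinity_has_derivative[OF assms] by (rule has_derivative_linear)
  then have "frechet_derivative f (at x) (\<Sum>b\<in>Basis. (v \<bullet> b) *\<^sub>R b) =
      (\<Sum>b\<in>Basis. (v \<bullet> b) * frechet_derivative f (at x) b)"
    by (simp add: linear_sum linear_scale)
  then show ?thesis by (simp add: euclidean_representation)
qed

lemma C_c_infinity_derivative_bound:
  fixes f :: "'a::euclidean_space \<Rightarrow> real"
  assumes f: "f \<in> C_c_infinity"
  obtains M where "M > 0" "\<And>x v. \<bar>frechet_derivative f (at x) v\<bar> \<le> M * norm v"
proof -
  have "\<exists>B. \<forall>x. \<bar>frechet_derivative f (at x) b\<bar> \<le> B" for b
    using C_0_bounded[OF C_c_infinity_C_0[OF C_c_infinity_derivative[OF f]]] by metis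
  then obtain B where B: "\<And>b x. \<bar>frechet_derivative f (at x) b\<bar> \<le> B b" by metis
  then have B0: "B b \<ge> 0" for b by (meson abs_ge_zero order_trans)
  have "\<bar>frechet_derivative f (at x) v\<bar> \<le> ((\<Sum>b\<in>Basis. B b) + 1) * norm v" for x v
  proof -
    have "\<bar>frechet_derivative f (at x) v\<bar> \<le> (\<Sum>b\<in>Basis. \<bar>(v \<bullet> b) * frechet_derivative f (at x) b\<bar>)"
      by (subst frechet_derivative_Basis[OF f]) (rule sum_abs)
    also have "\<dots> \<le> (\<Sum>b\<in>Basis. norm v * B b)"
      unfolding abs_mult using B B0 by (intro sum_mono mult_mono Basis_le_norm) auto
    also have "\<dots> = (\<Sum>b\<in>Basis. B b) * norm v"
      by (simp add: sum_distrib_left mult.commute)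
    also have "\<dots> \<le> ((\<Sum>b\<in>Basis. B b) + 1) * norm v"
      by (simp add: algebra_simps)
    finally show ?thesis .
  qed
  moreover have "(\<Sum>b\<in>Basis. B b) + 1 > 0"
    using B0 by (simp add: add_nonneg_pos sum_nonneg)
  ultimately show thesis using that by blast
qed

lemma C_c_infinity_lipschitz:
  fixes f :: "'a::euclidean_space \<Rightarrow> real"
  assumes f: "f \<in> C_c_infinity"
  obtains M where "M-lipschitz_on UNIV f"
proof -
  obtain M where M: "M > 0" "\<And>x v. \<bar>frechet_derivative f (at x) v\<bar> \<le> M * norm v"
    using C_c_infinity_derivative_bound[OF f] by blast
  have "M-lipschitz_on UNIV f"
  proof (rule bounded_derivative_imp_lipschitz)
    show "(f has_derivative frechet_derivative f (at x)) (at x within UNIV)" for x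
      using C_c_infinity_has_derivative[OF f] by simp
    show "onorm (frechet_derivative f (at x)) \<le> M" for x
      using M by (intro onorm_le) auto
  qed (use M in auto)
  then show thesis by (rule that)
qed

definition conv :: "('a::euclidean_space \<Rightarrow> real) \<Rightarrow> ('a \<Rightarrow> real) \<Rightarrow> 'a \<Rightarrow> real" where
  "conv f k x = (\<integral>y. f y * k (x - y) \<partial>lborel)"

lemma integrable_compact_support:
  fixes h :: "'a::euclidean_space \<Rightarrow> real"
  assumes "continuous_on UNIV h" "\<And>x. norm x > r \<Longrightarrow> h x = 0"
  shows "integrable lborel h"
proof -
  have "integrable lborel (\<lambda>x. indicator (cball 0 r) x *\<^sub>R h x)"
    using assms by (intro borel_integrable_compact) (auto intro: continuous_on_subset)
  moreover have "(\<lambda>x. indicator (cball 0 r) x *\<^sub>R h x) = h"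
    using assms(2) by (force simp: indicator_def)
  ultimately show ?thesis by simp
qed

lemma integrable_conv:
  fixes h k :: "'a::euclidean_space \<Rightarrow> real"
  assumes "continuous_on UNIV h" "continuous_on UNIV k" "\<And>y. norm y > r \<Longrightarrow> k y = 0"
  shows "integrable lborel (\<lambda>y. h y * k (x - y))"
proof (rule integrable_compact_support)
  show "continuous_on UNIV (\<lambda>y. h y * k (x - y))"
    using assms by (intro continuous_intros continuous_on_compose2[OF assms(2)]) auto
  show "h y * k (x - y) = 0" if "norm y > norm x + r" for y
    using that assms(3)[of "x - y"] norm_triangle_ineq2[of y x] by (simp add: norm_minus_commute)
qed

lemma lborel_integral_translation:
  fixes h :: "'a::euclidean_space \<Rightarrow> real"
  assumes [measurable]: "h \<in> borel_measurable borel"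
  shows "(\<integral>y. h (a + y) \<partial>lborel) = (\<integral>y. h y \<partial>lborel)"
  by (subst (2) lborel_distr_plus[symmetric, of a]) (simp add: integral_distr)

text \<open>
  Differentiation under the integral is applied to gauge integrals over a box that contains the
  support of \<open>h\<close>.
\<close>

lemma conv_eq_integral:
  fixes h k :: "'a::euclidean_space \<Rightarrow> real"
  assumes h: "continuous_on UNIV h" and k: "continuous_on UNIV k" "\<And>y. norm y > r \<Longrightarrow> k y = 0"
    and supp: "\<And>y. y \<notin> S \<Longrightarrow> h y = 0"
  shows "conv h k x = integral S (\<lambda>y. h y * k (x - y))"
proof -
  have "conv h k x = integral UNIV (\<lambda>y. h y * k (x - y))"
    unfolding conv_def using integral_lborel[OF integrable_conv[OF h k]] by simp
  also have "(\<lambda>y. h y * k (x - y)) = (\<lambda>y. if y \<in> S then h y * k (x - y) else 0)"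
    using supp by auto
  finally show ?thesis by (simp add: Henstock_Kurzweil_Integration.integral_restrict_UNIV)
qed

lemma conv_has_derivative:
  fixes h k :: "'a::euclidean_space \<Rightarrow> real"
  assumes h: "continuous_on UNIV h" "bounded {y. h y \<noteq> 0}" and k: "k \<in> C_c_infinity"
  shows "(conv h k has_derivative (\<lambda>v. conv h (\<lambda>y. frechet_derivative k (at y) v) x)) (at x)"
proof -
  obtain a where a: "{y. h y \<noteq> 0} \<subseteq> cbox (-a) a"
    using bounded_subset_cbox_symmetric[OF h(2)] .
  have supp: "h y = 0" if "y \<notin> cbox (-a) a" for y
    using a that by auto
  have conv_eq: "conv h u x = integral (cbox (-a) a) (\<lambda>y. h y * u (x - y))"
    if u: "u \<in> C_c_infinity" for u x
  proof -
    obtain r where "\<And>y. norm y > r \<Longrightarrow> u y = 0" using C_c_infinity_support[OF u] by metis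
    from conv_eq_integral[OF h(1) C_c_infinity_continuous[OF u] this supp] show ?thesis by simp
  qed
  define B where "B x = Blinfun (frechet_derivative k (at x))" for x
  have B: "blinfun_apply (B x) = frechet_derivative k (at x)" for x
    unfolding B_def
    by (rule bounded_linear_Blinfun_apply[OF has_derivative_bounded_linear[OF C_c_infinity_has_derivative[OF k]]])
  have contB: "continuous_on UNIV B"
    by (rule continuous_on_blinfun_componentwise)
       (simp add: B C_c_infinity_continuous C_c_infinity_derivative k)
  have cont_fx: "continuous_on (UNIV \<times> cbox (-a) a) (\<lambda>(x, y). h y *\<^sub>R B (x - y))"
    unfolding split_beta
    by (intro continuous_intros continuous_on_compose2[OF contB] continuous_on_compose2[OF h(1)]) auto
  have "((\<lambda>x. integral (cbox (-a) a) (\<lambda>y. h y * k (x - y))) has_derivative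
      blinfun_apply (integral (cbox (-a) a) (\<lambda>y. h y *\<^sub>R B (x - y)))) (at x within UNIV)"
  proof (rule leibniz_rule[where fx="\<lambda>x y. h y *\<^sub>R B (x - y)" and U=UNIV])
    fix x y :: 'a
    have "((\<lambda>x. k (x - y)) has_derivative frechet_derivative k (at (x - y))) (at x)"
      by (rule has_derivative_compose[OF _ C_c_infinity_has_derivative[OF k]])
         (auto intro!: derivative_eq_intros)
    then show "((\<lambda>x. h y * k (x - y)) has_derivative blinfun_apply (h y *\<^sub>R B (x - y))) (at x within UNIV)"
      by (auto simp: B blinfun.scaleR_left intro!: derivative_eq_intros)
  next
    fix x :: 'a
    show "(\<lambda>y. h y * k (x - y)) integrable_on cbox (- a) a"
      by (intro integrable_continuous continuous_intros continuous_on_compose2[OF h(1)]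
          continuous_on_compose2[OF C_c_infinity_continuous[OF k]]) auto
  qed (use cont_fx in auto)
  moreover have "blinfun_apply (integral (cbox (-a) a) (\<lambda>y. h y *\<^sub>R B (x - y))) =
      (\<lambda>v. conv h (\<lambda>y. frechet_derivative k (at y) v) x)"
  proof
    fix v
    have "(\<lambda>y. h y *\<^sub>R B (x - y)) integrable_on cbox (-a) a"
      by (intro integrable_continuous continuous_intros continuous_on_compose2[OF contB]
          continuous_on_compose2[OF h(1)]) auto
    then show "blinfun_apply (integral (cbox (-a) a) (\<lambda>y. h y *\<^sub>R B (x - y))) v =
        conv h (\<lambda>y. frechet_derivative k (at y) v) x"
      by (simp add: blinfun_apply_integral conv_eq C_c_infinity_derivative k blinfun.scaleR_left B)
  qed
  moreover have "conv h k = (\<lambda>x. integral (cbox (-a) a) (\<lambda>y. h y * k (x - y)))"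
    by (rule ext) (rule conv_eq[OF k])
  ultimately show ?thesis by simp
qed

lemma conv_smooth:
  fixes h k :: "'a::euclidean_space \<Rightarrow> real"
  assumes h: "continuous_on UNIV h" "bounded {y. h y \<noteq> 0}" and k: "k \<in> C_c_infinity"
  shows "conv h k \<in> C_c_infinity"
proof -
  obtain r where r: "\<And>y. norm y > r \<Longrightarrow> k y = 0" using C_c_infinity_support[OF k] by metis
  obtain s where s: "\<And>y. norm y > s \<Longrightarrow> h y = 0"
    using h(2) unfolding bounded_iff by (metis (mono_tags) mem_Collect_eq not_le)
  show ?thesis
  proof (rule C_c_infinityI[OF C_k_coinduct[of _ "conv h ` C_c_infinity"]])
    fix u assume "u \<in> conv h ` C_c_infinity"
    then obtain k where u: "u = conv h k" "k \<in> C_c_infinity" by blast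
    show "\<exists>D. (\<forall>x. (u has_derivative D x) (at x)) \<and> (\<forall>v. (\<lambda>x. D x v) \<in> conv h ` C_c_infinity)"
    proof (intro exI conjI allI)
      show "(u has_derivative (\<lambda>v. conv h (\<lambda>y. frechet_derivative k (at y) v) x)) (at x)" for x
        unfolding u(1) by (rule conv_has_derivative[OF h u(2)])
      show "(\<lambda>x. conv h (\<lambda>y. frechet_derivative k (at y) v) x) \<in> conv h ` C_c_infinity" for v
        using C_c_infinity_derivative[OF u(2), of v] by blast
    qed
  next
    show "conv h k x = 0" if x: "norm x > r + s" for x
    proof -
      have eq: "h y * k (x - y) = 0" for y
        using r[of "x - y"] s[of y] norm_triangle_ineq2[of x y] x by (cases "norm y > s") auto
      show ?thesis unfolding conv_def eq by simp
    qed
  qed (use k in auto)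
qed

text \<open>
  The kernel is normalised in the form in which it enters the convolution, so that constants are
  reproduced without a reflection of the variable.
\<close>

definition mollifier :: "real \<Rightarrow> ('a::euclidean_space \<Rightarrow> real) \<Rightarrow> bool" where
  "mollifier d k \<longleftrightarrow> k \<in> C_c_infinity \<and> (\<forall>x. k x \<ge> 0) \<and> (\<forall>x. norm x \<ge> d \<longrightarrow> k x = 0) \<and>
     (\<forall>x. (\<integral>y. k (x - y) \<partial>lborel) = 1)"

lemma mollifier_exists:
  assumes d: "d > 0"
  obtains k :: "'a::euclidean_space \<Rightarrow> real" where "mollifier d k"
proof -
  define c where "c = 1 / d^2"
  have c: "c > 0" using d by (simp add: c_def)
  define I where "I = (\<integral>y. bump c (y::'a) \<partial>lborel)"
  have b: "bump c \<in> C_c_infinity" by (rule bump_smooth[OF c])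
  have cont: "continuous_on UNIV (bump c :: 'a \<Rightarrow> real)" by (rule C_c_infinity_continuous[OF b])
  obtain r where r: "\<And>x::'a. norm x > r \<Longrightarrow> bump c x = 0"
    using C_c_infinity_support[OF b] by metis
  have int: "integrable lborel (bump c :: 'a \<Rightarrow> real)"
    by (rule integrable_compact_support[OF cont r])
  have "I \<noteq> 0"
  proof
    assume "I = 0"
    then have "AE y in lborel. bump c (y::'a) = 0"
      unfolding I_def by (subst (asm) integral_nonneg_eq_0_iff_AE[OF int]) (auto simp: bump_nonneg)
    then have "{y. bump c (y::'a) \<noteq> 0} \<in> null_sets lborel"
      by (subst (asm) AE_iff_null) (auto intro!: borel_open open_Collect_neq cont)
    then have "{y. bump c (y::'a) \<noteq> 0} \<in> null_sets lebesgue" by (rule null_sets_completionI)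
    then have "negligible {y. bump c (y::'a) \<noteq> 0}" by (simp add: negligible_iff_null_sets)
    moreover have "open {y. bump c (y::'a) \<noteq> 0}"
      by (intro open_Collect_neq cont continuous_on_const)
    moreover have "0 \<in> {y. bump c (y::'a) \<noteq> 0}" using bump_pos[of c] by (metis (mono_tags) less_irrefl mem_Collect_eq)
    ultimately show False using open_not_negligible by blast
  qed
  moreover have "I \<ge> 0" unfolding I_def by (simp add: bump_nonneg)
  ultimately have I: "I > 0" by simp
  have eq: "(\<integral>y. bump c (x - y) \<partial>lborel) = I" for x :: 'a
  proof -
    have "bump c (x - y) = bump c (- x + y)" for y
      using bump_minus[of c "x - y"] by simp
    then have "(\<integral>y. bump c (x - y) \<partial>lborel) = (\<integral>y. bump c (- x + y) \<partial>lborel)" by simp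
    also have "\<dots> = I"
      unfolding I_def by (rule lborel_integral_translation) (rule borel_measurable_continuous_onI[OF cont])
    finally show ?thesis .
  qed
  have "mollifier d (\<lambda>x::'a. 1 / I * bump c x)"
    unfolding mollifier_def
  proof (intro conjI allI impI)
    show "(\<lambda>x::'a. 1 / I * bump c x) \<in> C_c_infinity"
      using C_c_infinity_lincomb[OF b b, of "1 / I" 0] by simp
    show "1 / I * bump c x = 0" if "d \<le> norm x" for x :: 'a
    proof -
      have "1 \<le> c * (norm x)^2" using that d power_mono[of d "norm x" 2] by (simp add: c_def divide_simps)
      then show ?thesis using bump_eq_0[OF c, of x] by simp
    qed
    show "(\<integral>y. 1 / I * bump c (x - y) \<partial>lborel) = 1" for x :: 'a
      using I by (simp add: eq)
  qed (simp add: I bump_nonneg less_imp_le)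
  then show thesis by (rule that)
qed

lemma mollifier_integrable:
  assumes "mollifier d k" "continuous_on UNIV h"
  shows "integrable lborel (\<lambda>y. h y * k (x - y))"
proof -
  have "k \<in> C_c_infinity" "\<And>y. norm y > d \<Longrightarrow> k y = 0"
    using assms(1) by (auto simp: mollifier_def)
  then show ?thesis
    using integrable_conv[OF assms(2) C_c_infinity_continuous] by blast
qed

lemma conv_bound:
  assumes k: "mollifier d k" and h: "continuous_on UNIV h"
    and le: "\<And>y. norm (x - y) < d \<Longrightarrow> \<bar>h y\<bar> \<le> e"
  shows "\<bar>conv h k x\<bar> \<le> e"
proof -
  have "\<bar>conv h k x\<bar> \<le> (\<integral>y. e * k (x - y) \<partial>lborel)"
    unfolding conv_def real_norm_def[symmetric]
  proof (rule Bochner_Integration.integral_norm_bound_integral)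
    show "integrable lborel (\<lambda>y. h y * k (x - y))" by (rule mollifier_integrable[OF k h])
    show "integrable lborel (\<lambda>y. e * k (x - y))" by (rule mollifier_integrable[OF k]) simp
    show "norm (h y * k (x - y)) \<le> e * k (x - y)" for y
      using k le[of y] unfolding mollifier_def
      by (cases "norm (x - y) < d") (auto simp: abs_mult intro!: mult_mono)
  qed
  also have "\<dots> = e" using k by (simp add: mollifier_def)
  finally show ?thesis .
qed

lemma conv_diff:
  assumes k: "mollifier d k" and h: "continuous_on UNIV h" "continuous_on UNIV u"
  shows "conv h k x - conv u k x = conv (\<lambda>y. h y - u y) k x"
  unfolding conv_def left_diff_distrib
  by (intro Bochner_Integration.integral_diff[symmetric] mollifier_integrable[OF k] h)

lemma conv_const: "mollifier d k \<Longrightarrow> conv (\<lambda>_. c) k x = c"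
  by (simp add: conv_def mollifier_def)

lemma conv_close:
  assumes k: "mollifier d k" and h: "continuous_on UNIV h"
    and le: "\<And>y. norm (x - y) < d \<Longrightarrow> \<bar>h y - h x\<bar> \<le> e"
  shows "\<bar>conv h k x - h x\<bar> \<le> e"
  using conv_bound[OF k continuous_on_diff[OF h continuous_on_const] le]
    conv_diff[OF k h continuous_on_const, of x "h x"] conv_const[OF k, of "h x" x] by simp

lemma conv_translate:
  assumes k: "mollifier d k" and h: "continuous_on UNIV h"
  shows "conv h k (x + v) = conv (\<lambda>y. h (y + v)) k x"
proof -
  have [continuous_intros]: "continuous_on UNIV k"
    using k by (simp add: mollifier_def C_c_infinity_continuous)
  have "(\<lambda>y. h y * k (x + v - y)) \<in> borel_measurable borel"
    by (intro borel_measurable_continuous_onI continuous_intros h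
        continuous_on_compose2[OF \<open>continuous_on UNIV k\<close>]) auto
  from lborel_integral_translation[OF this, of v] show ?thesis
    by (simp add: conv_def algebra_simps)
qed

text \<open>
  Soft thresholding makes the function compactly supported without moving it by more than half of
  the allowed error; mollification takes care of smoothness.
\<close>

lemma C_c_infinity_dense:
  fixes h :: "'a::euclidean_space \<Rightarrow> real"
  assumes h: "h \<in> C_0" and e: "e > 0"
  obtains F where "F \<in> C_c_infinity" "\<And>x. \<bar>F x - h x\<bar> \<le> e"
proof -
  define u where "u x = h x - max (- (e / 2)) (min (e / 2) (h x))" for x
  have cont: "continuous_on UNIV u"
    unfolding u_def using C_0_continuous[OF h] by (intro continuous_intros)
  obtain r where "r > 0" "\<And>x. norm x > r \<Longrightarrow> \<bar>h x\<bar> \<le> e / 2"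
    using C_0_small[OF h, of "e/2"] e by auto
  \<comment> \<open>Subtracting the truncation at height e / 2 is soft thresholding: it moves h by at most e / 2
    and kills it wherever h is small, hence outside a ball.\<close>
  then have r: "u x = 0" if "norm x > r" for x
    using that e unfolding u_def by (smt (verit) max_def min_def)
  have u: "u \<in> C_0" by (rule C_0I_compact_support[OF cont r])
  have close: "\<bar>u x - h x\<bar> \<le> e / 2" for x
    using e unfolding u_def by (auto simp: max_def min_def abs_if)
  obtain d where d: "d > 0" "\<And>x y. dist x y < d \<Longrightarrow> \<bar>u x - u y\<bar> \<le> e / 2"
    using C_0_uniformly_continuous[OF u, of "e/2"] e by auto
  obtain k :: "'a \<Rightarrow> real" where k: "mollifier d k" using mollifier_exists[OF d(1)] .
  show thesis
  proof (rule that)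
    show "conv u k \<in> C_c_infinity"
      using k r by (intro conv_smooth cont) (auto simp: mollifier_def bounded_iff intro!: exI[of _ r] leI)
    fix x
    have "\<bar>conv u k x - u x\<bar> \<le> e / 2"
      by (intro conv_close[OF k cont] d) (simp add: dist_norm norm_minus_commute)
    with close[of x] show "\<bar>conv u k x - h x\<bar> \<le> e" by linarith
  qed
qed

section \<open>The flow of a Lipschitz vector field\<close>

lemma has_real_derivative_inner_self:
  fixes d :: "real \<Rightarrow> 'a::real_inner"
  assumes "(d has_vector_derivative d') (at s within A)"
  shows "((\<lambda>s. d s \<bullet> d s) has_real_derivative 2 * (d s \<bullet> d')) (at s within A)"
  using has_derivative_inner[OF assms[unfolded has_vector_derivative_def] assms[unfolded has_vector_derivative_def]]
  by (rule has_derivative_imp_has_field_derivative) (simp add: inner_commute algebra_simps)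

lemma nonincreasing_of_derivative:
  fixes u :: "real \<Rightarrow> real"
  assumes "\<And>s. s \<ge> 0 \<Longrightarrow> (u has_real_derivative u' s) (at s within {0..})"
    and "\<And>s. s \<ge> 0 \<Longrightarrow> u' s \<le> 0" and "t \<ge> 0"
  shows "u t \<le> u 0"
proof (cases "t = 0")
  case False
  then have "0 < t" using assms(3) by simp
  have "\<exists>x\<in>{0<..<t}. u t - u 0 = u' x * (t - 0)"
  proof (rule mvt_simple[OF \<open>0 < t\<close>])
    fix x assume x: "0 \<le> x" "x \<le> t"
    show "(u has_derivative (*) (u' x)) (at x within {0..t})"
      using has_field_derivative_subset[OF assms(1)[OF x(1)], of "{0..t}"]
      by (auto simp: has_field_derivative_def)
  qed
  then obtain x where "0 < x" "u t - u 0 = u' x * t" by auto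
  moreover have "u' x * t \<le> 0" using assms(2)[of x] \<open>0 < x\<close> assms(3) by (intro mult_nonpos_nonneg) auto
  ultimately show ?thesis by linarith
qed simp

lemma path_increment_bound:
  fixes u :: "real \<Rightarrow> 'b::real_normed_vector"
  assumes "\<And>s. s \<ge> 0 \<Longrightarrow> (u has_vector_derivative u' s) (at s within {0..})"
    and "\<And>s. 0 \<le> s \<Longrightarrow> s \<le> t \<Longrightarrow> norm (u' s) \<le> B" and "t \<ge> 0"
  shows "norm (u t - u 0) \<le> B * t"
proof -
  have "norm (u t - u 0) \<le> B * norm (t - 0)"
  proof (rule differentiable_bound[of "{0..t}"])
    fix x assume x: "x \<in> {0..t}"
    show "(u has_derivative (\<lambda>h. h *\<^sub>R u' x)) (at x within {0..t})"
      using has_vector_derivative_within_subset[OF assms(1), of x "{0..t}"] x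
      by (auto simp: has_vector_derivative_def)
    show "onorm (\<lambda>h. h *\<^sub>R u' x) \<le> B"
      using assms(2)[of x] x by (intro onorm_le) (auto simp: mult.commute[of B] intro!: mult_left_mono)
  qed (use assms in auto)
  then show ?thesis using assms(3) by simp
qed

text \<open>
  Gronwall for two solutions: \<open>exp (- 2 L t) \<parallel>x - y\<parallel>\<^sup>2\<close> is nonincreasing. It yields the Lipschitz
  dependence of the flow on the starting point and, through uniqueness, the semigroup property.
\<close>

lemma lipschitz_ode_contraction:
  fixes x y :: "real \<Rightarrow> 'a::euclidean_space"
  assumes x: "\<And>s. s \<ge> 0 \<Longrightarrow> (x has_vector_derivative g (x s)) (at s within {0..})"
    and y: "\<And>s. s \<ge> 0 \<Longrightarrow> (y has_vector_derivative g (y s)) (at s within {0..})"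
    and g: "L-lipschitz_on UNIV g" and t: "t \<ge> 0"
  shows "norm (x t - y t) \<le> exp (L * t) * norm (x 0 - y 0)"
proof -
  define d where "d s = x s - y s" for s
  define u where "u s = exp (- 2 * L * s) * (d s \<bullet> d s)" for s
  define u' where "u' s = exp (- 2 * L * s) * (2 * (d s \<bullet> (g (x s) - g (y s))) - 2 * L * (d s \<bullet> d s))" for s
  have "u t \<le> u 0"
  proof (rule nonincreasing_of_derivative[OF _ _ t])
    fix s :: real assume s: "s \<ge> 0"
    have "(d has_vector_derivative (g (x s) - g (y s))) (at s within {0..})"
      unfolding d_def by (intro derivative_intros x y s)
    note * = has_real_derivative_inner_self[OF this]
    show "(u has_real_derivative u' s) (at s within {0..})"
      unfolding u_def u'_def
      by (rule derivative_eq_intros * refl)+ (simp add: algebra_simps)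
    have "d s \<bullet> (g (x s) - g (y s)) \<le> norm (d s) * norm (g (x s) - g (y s))"
      by (rule norm_cauchy_schwarz)
    also have "\<dots> \<le> norm (d s) * (L * norm (d s))"
      using lipschitz_onD[OF g, of "x s" "y s"] by (intro mult_left_mono) (auto simp: dist_norm d_def)
    also have "\<dots> = L * (d s \<bullet> d s)" by (simp add: dot_square_norm power2_eq_square)
    finally show "u' s \<le> 0"
      unfolding u'_def by (intro mult_nonneg_nonpos) auto
  qed
  then have "d t \<bullet> d t \<le> exp (2 * L * t) * (d 0 \<bullet> d 0)"
    by (simp add: u_def exp_minus field_simps)
  then have "(norm (d t))^2 \<le> (exp (L * t) * norm (d 0))^2"
    by (simp add: power_mult_distrib dot_square_norm exp_double[symmetric] mult.assoc)
  then have "norm (d t) \<le> exp (L * t) * norm (d 0)"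
    by (rule power2_le_imp_le) simp
  then show ?thesis by (simp add: d_def)
qed

locale lipschitz_flow =
  fixes g :: "'a::euclidean_space \<Rightarrow> 'a" and \<phi> :: "real \<Rightarrow> 'a \<Rightarrow> 'a" and L :: real
  assumes flow: "is_flow g \<phi>" and lipschitz: "L-lipschitz_on UNIV g"
begin

lemma flow_0 [simp]: "\<phi> 0 z = z"
  using flow by (simp add: is_flow_def)

lemma flow_derivative:
  "t \<ge> 0 \<Longrightarrow> ((\<lambda>s. \<phi> s z) has_vector_derivative g (\<phi> t z)) (at t within {0..})"
  using flow by (simp add: is_flow_def)

lemma L_nonneg: "L \<ge> 0"
  using lipschitz by (rule lipschitz_on_nonneg)

lemma flow_lipschitz: "t \<ge> 0 \<Longrightarrow> norm (\<phi> t z - \<phi> t w) \<le> exp (L * t) * norm (z - w)"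
  using lipschitz_ode_contraction[OF flow_derivative flow_derivative lipschitz] by simp

lemma flow_add:
  assumes "s \<ge> 0" "t \<ge> 0"
  shows "\<phi> (s + t) z = \<phi> s (\<phi> t z)"
proof -
  have "((\<lambda>r. \<phi> (r + t) z) has_vector_derivative g (\<phi> (r + t) z)) (at r within {0..})" if "r \<ge> 0" for r
  proof -
    have "((\<lambda>s. \<phi> s z) \<circ> (\<lambda>r. r + t) has_vector_derivative 1 *\<^sub>R g (\<phi> (r + t) z)) (at r within {0..})"
    proof (rule vector_diff_chain_within)
      show "((\<lambda>r. r + t) has_vector_derivative 1) (at r within {0..})"
        by (auto intro!: derivative_eq_intros)
      show "((\<lambda>s. \<phi> s z) has_vector_derivative g (\<phi> (r + t) z)) (at (r + t) within (\<lambda>r. r + t) ` {0..})"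
        using assms that
        by (intro has_vector_derivative_within_subset[OF flow_derivative]) auto
    qed
    then show ?thesis by (simp add: o_def)
  qed
  from lipschitz_ode_contraction[OF this flow_derivative lipschitz assms(1), of "\<phi> t z"]
  show ?thesis by simp
qed

text \<open>
  The constant is chosen to dominate both \<open>\<parallel>g x\<parallel>\<close> and \<open>2 \<bar>x \<bullet> g x\<bar>\<close> relative to \<open>1 + \<parallel>x\<parallel>\<^sup>2\<close>
  (\<open>norm_field_le\<close> and \<open>inner_field_le\<close>).
\<close>

definition speed :: real where "speed = 2 * (L + norm (g 0))"

definition weight :: "'a \<Rightarrow> real" where "weight z = 1 + z \<bullet> z"

lemma speed_nonneg: "speed \<ge> 0"
  using L_nonneg by (simp add: speed_def)

lemma weight_ge_1: "weight z \<ge> 1"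
  by (simp add: weight_def)

lemma norm_le_weight: "norm z \<le> weight z"
proof -
  have "0 \<le> (norm z - 1)^2" by simp
  then show ?thesis
    using norm_ge_zero[of z] unfolding power2_diff weight_def dot_square_norm power_one by linarith
qed

lemma norm_field_le: "norm (g x) \<le> speed * weight x"
proof -
  have "norm (g x) \<le> norm (g x - g 0) + norm (g 0)" by norm
  also have "\<dots> \<le> L * norm x + norm (g 0)"
    using lipschitz_onD[OF lipschitz, of x 0] by (simp add: dist_norm)
  also have "\<dots> \<le> L * weight x + norm (g 0) * weight x"
    using L_nonneg norm_le_weight[of x] weight_ge_1[of x]
    by (intro add_mono mult_left_mono) (auto simp: mult_le_cancel_left1)
  also have "\<dots> \<le> speed * weight x"
  proof -
    have "0 \<le> (L + norm (g 0)) * weight x" using L_nonneg weight_ge_1[of x] by simp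
    then show ?thesis by (simp add: speed_def algebra_simps)
  qed
  finally show ?thesis .
qed

lemma inner_field_le: "2 * \<bar>x \<bullet> g x\<bar> \<le> speed * weight x"
proof -
  have "norm (g x) \<le> norm (g x - g 0) + norm (g 0)" by norm
  also have "\<dots> \<le> L * norm x + norm (g 0)"
    using lipschitz_onD[OF lipschitz, of x 0] by (simp add: dist_norm)
  finally have "norm x * norm (g x) \<le> norm x * (L * norm x + norm (g 0))"
    by (intro mult_left_mono) auto
  also have "\<dots> \<le> L * weight x + norm (g 0) * weight x"
  proof -
    have "L * (norm x * norm x) \<le> L * weight x"
      using L_nonneg by (intro mult_left_mono) (auto simp: weight_def dot_square_norm power2_eq_square)
    moreover have "norm (g 0) * norm x \<le> norm (g 0) * weight x"
      using norm_le_weight by (intro mult_left_mono) auto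
    ultimately show ?thesis by (simp add: algebra_simps)
  qed
  finally show ?thesis
    using Cauchy_Schwarz_ineq2[of x "g x"] by (simp add: speed_def algebra_simps)
qed

text \<open>
  Since \<open>2 \<bar>x \<bullet> g x\<bar> \<le> speed * weight x\<close>, the weight can neither grow nor decay along the flow faster
  than exponentially. The weight depends on the norm only, so that norm-preserving jumps do not
  change it; this is the quantity by which the process is confined.
\<close>

lemma weight_flow:
  assumes "t \<ge> 0"
  shows "weight (\<phi> t z) \<le> exp (speed * t) * weight z" and "weight z \<le> exp (speed * t) * weight (\<phi> t z)"
proof -
  have deriv: "((\<lambda>s. weight (\<phi> s z)) has_real_derivative 2 * (\<phi> s z \<bullet> g (\<phi> s z))) (at s within {0..})"
    if "s \<ge> 0" for s
    unfolding weight_def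
    using has_real_derivative_inner_self[OF flow_derivative[OF that, of z]]
    by (auto intro!: derivative_eq_intros)
  have "exp (- speed * t) * weight (\<phi> t z) \<le> exp (- speed * 0) * weight (\<phi> 0 z)"
  proof (rule nonincreasing_of_derivative[OF _ _ assms])
    fix s :: real assume s: "s \<ge> 0"
    show "((\<lambda>s. exp (- speed * s) * weight (\<phi> s z)) has_real_derivative
        exp (- speed * s) * (2 * (\<phi> s z \<bullet> g (\<phi> s z)) - speed * weight (\<phi> s z))) (at s within {0..})"
      by (rule derivative_eq_intros deriv[OF s] refl)+ (simp add: algebra_simps)
    show "exp (- speed * s) * (2 * (\<phi> s z \<bullet> g (\<phi> s z)) - speed * weight (\<phi> s z)) \<le> 0"
      using inner_field_le[of "\<phi> s z"] by (intro mult_nonneg_nonpos) auto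
  qed
  then show "weight (\<phi> t z) \<le> exp (speed * t) * weight z"
    by (simp add: exp_minus field_simps)
  have "- (exp (speed * t) * weight (\<phi> t z)) \<le> - (exp (speed * 0) * weight (\<phi> 0 z))"
  proof (rule nonincreasing_of_derivative[OF _ _ assms])
    fix s :: real assume s: "s \<ge> 0"
    show "((\<lambda>s. - (exp (speed * s) * weight (\<phi> s z))) has_real_derivative
        exp (speed * s) * (- 2 * (\<phi> s z \<bullet> g (\<phi> s z)) - speed * weight (\<phi> s z))) (at s within {0..})"
      by (rule derivative_eq_intros deriv[OF s] refl)+ (simp add: algebra_simps)
    show "exp (speed * s) * (- 2 * (\<phi> s z \<bullet> g (\<phi> s z)) - speed * weight (\<phi> s z)) \<le> 0"
      using inner_field_le[of "\<phi> s z"] by (intro mult_nonneg_nonpos) auto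
  qed
  then show "weight z \<le> exp (speed * t) * weight (\<phi> t z)" by simp
qed

lemma weight_flow_mono:
  assumes "0 \<le> t" "t \<le> T"
  shows "weight (\<phi> t z) \<le> exp (speed * T) * weight z" and "weight z \<le> exp (speed * T) * weight (\<phi> t z)"
proof -
  have "exp (speed * t) \<le> exp (speed * T)"
    using assms speed_nonneg by (simp add: mult_left_mono)
  then have "exp (speed * t) * weight w \<le> exp (speed * T) * weight w" for w
    using weight_ge_1[of w] by (intro mult_right_mono) auto
  then show "weight (\<phi> t z) \<le> exp (speed * T) * weight z" "weight z \<le> exp (speed * T) * weight (\<phi> t z)"
    using weight_flow[OF assms(1), of z] order_trans by blast+
qed

lemma flow_displacement:
  assumes "t \<ge> 0"
  shows "norm (\<phi> t z - z) \<le> speed * exp (speed * t) * weight z * t"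
proof -
  have "norm (\<phi> t z - \<phi> 0 z) \<le> speed * (exp (speed * t) * weight z) * t"
  proof (rule path_increment_bound[OF flow_derivative _ assms])
    fix s assume s: "0 \<le> s" "s \<le> t"
    have "norm (g (\<phi> s z)) \<le> speed * weight (\<phi> s z)" by (rule norm_field_le)
    also have "\<dots> \<le> speed * (exp (speed * t) * weight z)"
      using weight_flow_mono[OF s] speed_nonneg by (intro mult_left_mono) auto
    finally show "norm (g (\<phi> s z)) \<le> speed * (exp (speed * t) * weight z)" .
  qed
  then show ?thesis by (simp add: mult.assoc)
qed

lemma flow_continuous_time: "continuous_on {0..} (\<lambda>s. \<phi> s z)"
  unfolding continuous_on_eq_continuous_within
  by (intro ballI has_vector_derivative_continuous[OF flow_derivative]) simp

lemma flow_continuous: "continuous_on UNIV (\<lambda>(t, z). \<phi> (max 0 t) z)"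
proof -
  have "((\<lambda>p. \<phi> (max 0 (fst p)) (snd p)) \<longlongrightarrow> \<phi> (max 0 t) z) (at (t, z))" for t z
  proof -
    have fst: "(fst \<longlongrightarrow> t) (at (t, z))" and snd: "(snd \<longlongrightarrow> z) (at (t, z))"
      by (auto intro!: tendsto_eq_intros)
    have "continuous_on UNIV (\<lambda>s. \<phi> (max 0 s) z)"
      by (rule continuous_on_compose2[OF flow_continuous_time]) (auto intro!: continuous_intros)
    then have "isCont (\<lambda>s. \<phi> (max 0 s) z) t" by (simp add: continuous_on_eq_continuous_at)
    from isCont_tendsto_compose[OF this fst]
    have 1: "((\<lambda>p. \<phi> (max 0 (fst p)) z) \<longlongrightarrow> \<phi> (max 0 t) z) (at (t, z))" .
    have "((\<lambda>p. exp (L * max 0 (fst p)) * norm (snd p - z)) \<longlongrightarrow> exp (L * max 0 t) * norm (z - z)) (at (t, z))"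
      by (intro tendsto_intros fst snd)
    then have "((\<lambda>p. exp (L * max 0 (fst p)) * norm (snd p - z)) \<longlongrightarrow> 0) (at (t, z))" by simp
    then have 2: "((\<lambda>p. \<phi> (max 0 (fst p)) (snd p) - \<phi> (max 0 (fst p)) z) \<longlongrightarrow> 0) (at (t, z))"
      by (rule Lim_null_comparison[rotated]) (auto intro!: always_eventually flow_lipschitz)
    from tendsto_add[OF 2 1] show ?thesis by simp
  qed
  then show ?thesis
    by (auto simp: continuous_on_def split_beta)
qed

lemma flow_continuous_compose:
  assumes "continuous_on A u" "continuous_on A v" "\<And>x. x \<in> A \<Longrightarrow> u x \<ge> 0"
  shows "continuous_on A (\<lambda>x. \<phi> (u x) (v x))"
proof -
  have "continuous_on A (\<lambda>x. case (u x, v x) of (t, z) \<Rightarrow> \<phi> (max 0 t) z)"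
    by (rule continuous_on_compose2[OF flow_continuous]) (auto intro!: continuous_intros assms)
  then show ?thesis
    by (rule continuous_on_cong[THEN iffD1, rotated 2]) (auto simp: max_def assms(3))
qed

text \<open>
  The flow does not move points uniformly little, but a point of large norm keeps a large norm for
  a short time, and there \<open>a\<close> is small before and after.
\<close>

lemma flow_strongly_continuous:
  assumes a: "a \<in> C_0" and e: "e > 0"
  obtains d where "d > 0" "\<And>s z. 0 \<le> s \<Longrightarrow> s \<le> d \<Longrightarrow> \<bar>a (\<phi> s z) - a z\<bar> \<le> e"
proof -
  obtain r where r: "r > 0" "\<And>x. norm x > r \<Longrightarrow> \<bar>a x\<bar> \<le> e / 2"
    using C_0_small[OF a, of "e/2"] e by auto
  obtain d where d: "d > 0" "\<And>x y. dist x y < d \<Longrightarrow> \<bar>a x - a y\<bar> \<le> e"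
    using C_0_uniformly_continuous[OF a e] by blast
  define N where "N = exp speed * (1 + r^2)"
  define K where "K = speed * exp speed * N"
  have N: "N > 0" unfolding N_def by (intro mult_pos_pos add_pos_nonneg) auto
  have K: "K \<ge> 0" using N speed_nonneg by (simp add: K_def)
  show thesis
  proof (rule that[of "min 1 (d / (K + 1) / 2)"])
    show "0 < min 1 (d / (K + 1) / 2)" using d K by simp
    fix s z assume s: "0 \<le> s" "s \<le> min 1 (d / (K + 1) / 2)"
    show "\<bar>a (\<phi> s z) - a z\<bar> \<le> e"
    proof (cases "weight z \<le> N")
      case True
      have "norm (\<phi> s z - z) \<le> speed * exp (speed * s) * weight z * s" by (rule flow_displacement[OF s(1)])
      also have "\<dots> \<le> speed * exp speed * N * s"
        using True s speed_nonneg weight_ge_1[of z] N mult_left_mono[of s 1 speed]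
        by (intro mult_mono) auto
      also have "\<dots> \<le> K * (d / (K + 1) / 2)"
        using s K unfolding K_def[symmetric] by (intro mult_left_mono) auto
      also have "\<dots> < d" using d K by (simp add: field_simps add_nonneg_pos)
      finally show ?thesis using d(2)[of "\<phi> s z" z] by (simp add: dist_norm)
    next
      case False
      have "weight (\<phi> s z) > 1 + r^2"
      proof (rule ccontr)
        assume "\<not> ?thesis"
        then have "exp speed * weight (\<phi> s z) \<le> N" unfolding N_def by (intro mult_left_mono) auto
        with weight_flow_mono(2)[of s 1 z] s False show False by simp
      qed
      then have 1: "norm (\<phi> s z) > r" using r(1) by (simp add: weight_def dot_square_norm power_less_imp_less_base)
      have "1 * (1 + r^2) \<le> N" unfolding N_def using speed_nonneg by (intro mult_right_mono) auto
      with False have "weight z > 1 + r^2" by simp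
      then have 2: "norm z > r" using r(1) by (simp add: weight_def dot_square_norm power_less_imp_less_base)
      from r(2)[OF 1] r(2)[OF 2] show ?thesis by linarith
    qed
  qed
qed

text \<open>
  Friedrichs' commutator argument. The hypothesis \<open>deriv\<close> says that \<open>f\<close> has derivative \<open>a\<close> along the
  flow. Mollification uses differences of \<open>f\<close> at \<open>y\<close> in the direction \<open>g x\<close> with \<open>\<parallel>x - y\<parallel> < d\<close>, and
  replacing \<open>g x\<close> by \<open>g y\<close> costs at most \<open>L d\<close> times the Lipschitz constant \<open>M\<close> of \<open>f\<close>.
\<close>

lemma mollify_along_flow:
  assumes f: "continuous_on UNIV f" "\<And>x. norm x > r \<Longrightarrow> f x = 0" and fl: "M-lipschitz_on UNIV f"
    and a: "a \<in> C_0"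
    and deriv: "\<And>z t. t \<ge> 0 \<Longrightarrow> ((\<lambda>t. f (\<phi> t z)) has_real_derivative a (\<phi> t z)) (at t within {0..})"
    and e: "e > 0"
  obtains F where "F \<in> C_c_infinity" "\<And>x. \<bar>F x - f x\<bar> \<le> e"
    "\<And>x. \<bar>frechet_derivative F (at x) (g x) - a x\<bar> \<le> e"
proof -
  have M: "M \<ge> 0" using fl by (rule lipschitz_on_nonneg)
  have f0: "f \<in> C_0" by (rule C_0I_compact_support[OF f])
  have ac: "continuous_on UNIV a" by (rule C_0_continuous[OF a])
  obtain d1 where d1: "d1 > 0" "\<And>x y. dist x y < d1 \<Longrightarrow> \<bar>f x - f y\<bar> \<le> e"
    using C_0_uniformly_continuous[OF f0 e] by blast
  obtain d2 where d2: "d2 > 0" "\<And>x y. dist x y < d2 \<Longrightarrow> \<bar>a x - a y\<bar> \<le> e / 2"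
    using C_0_uniformly_continuous[OF a, of "e/2"] e by auto
  \<comment> \<open>The last term of the minimum bounds the commutator M * L * d by e / 2.\<close>
  define d where "d = min (min d1 d2) (e / 2 / (M * L + 1))"
  have ML0: "M * L \<ge> 0" using M L_nonneg by simp
  have d: "d > 0" using d1 d2 e ML0 by (simp add: d_def)
  have "M * L * d \<le> M * L * (e / 2 / (M * L + 1))" unfolding d_def using ML0 by (intro mult_left_mono) auto
  also have "\<dots> \<le> e / 2" using ML0 e by (simp add: field_simps)
  finally have MLd: "M * L * d \<le> e / 2" .
  obtain k :: "'a \<Rightarrow> real" where k: "mollifier d k" using mollifier_exists[OF d] .
  define F where "F = conv f k"
  have F: "F \<in> C_c_infinity"
    unfolding F_def using k f by (intro conv_smooth) (auto simp: mollifier_def bounded_iff intro!: exI[of _ r] leI)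
  have close: "\<bar>F x - f x\<bar> \<le> e" for x
    unfolding F_def by (intro conv_close[OF k f(1)] d1(2)) (simp add: dist_norm norm_minus_commute d_def)
  have quot: "\<forall>\<^sub>F t in at_right 0. \<bar>(F (x + t *\<^sub>R g x) - F x) / t - conv a k x\<bar> \<le> M * L * d + \<eta>"
    if \<eta>: "\<eta> > 0" for x \<eta>
  proof -
    obtain t1 where t1: "t1 > 0" "\<And>s z. 0 \<le> s \<Longrightarrow> s \<le> t1 \<Longrightarrow> \<bar>a (\<phi> s z) - a z\<bar> \<le> \<eta> / 2"
      using flow_strongly_continuous[OF a, of "\<eta>/2"] \<eta> by auto
    define N where "N = 1 + (norm x + d)^2"
    define K where "K = M * L * (speed * exp speed * N)"
    have N: "N \<ge> 1" by (simp add: N_def)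
    have K: "K \<ge> 0" unfolding K_def using N speed_nonneg ML0 by auto
    define t0 where "t0 = min (min 1 t1) (\<eta> / 2 / (K + 1))"
    have t0: "t0 > 0" unfolding t0_def using t1 \<eta> K by simp
    have "\<bar>(F (x + t *\<^sub>R g x) - F x) / t - conv a k x\<bar> \<le> M * L * d + \<eta>" if t: "0 < t" "t < t0" for t
    proof -
      let ?h = "\<lambda>y. (f (y + t *\<^sub>R g x) - f y) / t - a y"
      have fc: "continuous_on UNIV (\<lambda>y. f (y + t *\<^sub>R g x))"
        by (rule continuous_on_compose2[OF f(1)]) (auto intro!: continuous_intros)
      have "(F (x + t *\<^sub>R g x) - F x) / t - conv a k x = conv (\<lambda>y. f (y + t *\<^sub>R g x) - f y) k x / t - conv a k x"
        unfolding F_def conv_translate[OF k f(1)] by (subst conv_diff[OF k fc f(1)]) simp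
      also have "conv (\<lambda>y. f (y + t *\<^sub>R g x) - f y) k x / t = conv (\<lambda>y. (f (y + t *\<^sub>R g x) - f y) / t) k x"
        unfolding conv_def by (subst integral_divide_zero[symmetric]) simp
      also have "\<dots> - conv a k x = conv ?h k x"
        using t by (intro conv_diff[OF k _ ac] continuous_intros fc f(1)) auto
      finally have eq: "(F (x + t *\<^sub>R g x) - F x) / t - conv a k x = conv ?h k x" .
      \<comment> \<open>Compare y + t g(x), where the mollified quotient evaluates f, with the flow \<phi> t y, along
        which f is differentiable; both start at y.\<close>
      show ?thesis unfolding eq
      proof (rule conv_bound[OF k])
        show "continuous_on UNIV ?h" using t by (intro continuous_intros fc f(1) ac) auto
        fix y assume y: "norm (x - y) < d"
        have sy: "weight y \<le> N"
        proof -
          have "norm y \<le> norm x + d" using y norm_triangle_ineq3[of x y] by linarith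
          then show ?thesis unfolding weight_def N_def by (simp add: dot_square_norm power_mono)
        qed
        have disp: "norm (\<phi> s y - y) \<le> speed * exp speed * N * t" if s: "0 \<le> s" "s \<le> t" for s
        proof -
          have "norm (\<phi> s y - y) \<le> speed * exp (speed * s) * weight y * s" by (rule flow_displacement[OF s(1)])
          also have "\<dots> \<le> speed * exp speed * N * t"
            using s t sy speed_nonneg weight_ge_1[of y] N mult_left_mono[of s 1 speed]
            by (intro mult_mono) (auto simp: t0_def)
          finally show ?thesis .
        qed
        have "norm ((\<phi> t y - t *\<^sub>R g y) - (\<phi> 0 y - 0 *\<^sub>R g y)) \<le> L * (speed * exp speed * N * t) * t"
        proof (rule path_increment_bound)
          show "((\<lambda>s. \<phi> s y - s *\<^sub>R g y) has_vector_derivative g (\<phi> s y) - g y) (at s within {0..})" if "s \<ge> 0" for s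
            using flow_derivative[OF that, of y] by (auto intro!: derivative_eq_intros)
          show "norm (g (\<phi> s y) - g y) \<le> L * (speed * exp speed * N * t)" if s: "0 \<le> s" "s \<le> t" for s
          proof -
            have "norm (g (\<phi> s y) - g y) \<le> L * norm (\<phi> s y - y)"
              using lipschitz_onD[OF lipschitz, of "\<phi> s y" y] by (simp add: dist_norm)
            also have "\<dots> \<le> L * (speed * exp speed * N * t)"
              by (intro mult_left_mono disp s L_nonneg)
            finally show ?thesis .
          qed
        qed (use t in auto)
        then have A: "norm (\<phi> t y - y - t *\<^sub>R g y) \<le> L * (speed * exp speed * N * t) * t"
          by (simp add: algebra_simps)
        have B: "norm (g x - g y) \<le> L * d"
          using lipschitz_onD[OF lipschitz, of x y] mult_left_mono[OF less_imp_le[OF y] L_nonneg] by (simp add: dist_norm)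
        have "norm (y + t *\<^sub>R g x - \<phi> t y) = norm (t *\<^sub>R (g x - g y) - (\<phi> t y - y - t *\<^sub>R g y))"
          by (simp add: algebra_simps)
        also have "\<dots> \<le> norm (t *\<^sub>R (g x - g y)) + norm (\<phi> t y - y - t *\<^sub>R g y)"
          by (rule norm_triangle_ineq4)
        also have "\<dots> \<le> t * (L * d) + L * (speed * exp speed * N * t) * t"
          using A B t by (auto intro!: add_mono)
        finally have C: "norm (y + t *\<^sub>R g x - \<phi> t y) \<le> t * (L * d) + L * (speed * exp speed * N * t) * t" .
        have "\<bar>f (y + t *\<^sub>R g x) - f (\<phi> t y)\<bar> \<le> M * norm (y + t *\<^sub>R g x - \<phi> t y)"
          using lipschitz_onD[OF fl, of "y + t *\<^sub>R g x" "\<phi> t y"] by (simp add: dist_norm)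
        also have "\<dots> \<le> M * (t * (L * d) + L * (speed * exp speed * N * t) * t)"
          by (intro mult_left_mono C M)
        also have "\<dots> = (M * L * d + K * t) * t" by (simp add: K_def algebra_simps)
        also have "\<dots> \<le> (M * L * d + \<eta> / 2) * t"
        proof -
          have "K * t \<le> K * (\<eta> / 2 / (K + 1))" using t K by (intro mult_left_mono) (auto simp: t0_def)
          also have "\<dots> \<le> \<eta> / 2" using K \<eta> by (simp add: field_simps)
          finally show ?thesis using t by (intro mult_right_mono) linarith+
        qed
        finally have D: "\<bar>f (y + t *\<^sub>R g x) - f (\<phi> t y)\<bar> \<le> (M * L * d + \<eta> / 2) * t" .
        have "norm ((f (\<phi> t y) - t * a y) - (f (\<phi> 0 y) - 0 * a y)) \<le> \<eta> / 2 * t"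
        proof (rule path_increment_bound)
          show "((\<lambda>s. f (\<phi> s y) - s * a y) has_vector_derivative a (\<phi> s y) - a y) (at s within {0..})" if "s \<ge> 0" for s
            unfolding has_real_derivative_iff_has_vector_derivative[symmetric]
            using deriv[OF that, of y] by (auto intro!: derivative_eq_intros)
          show "norm (a (\<phi> s y) - a y) \<le> \<eta> / 2" if "0 \<le> s" "s \<le> t" for s
            using t1(2)[of s y] that t by (simp add: t0_def)
        qed (use t in auto)
        then have E: "\<bar>f (\<phi> t y) - f y - t * a y\<bar> \<le> \<eta> / 2 * t" by (simp add: algebra_simps)
        have "?h y = ((f (y + t *\<^sub>R g x) - f (\<phi> t y)) + (f (\<phi> t y) - f y - t * a y)) / t"
          using t by (simp add: field_simps)
        then have "\<bar>?h y\<bar> = \<bar>(f (y + t *\<^sub>R g x) - f (\<phi> t y)) + (f (\<phi> t y) - f y - t * a y)\<bar> / t"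
          using t by simp
        also have "\<dots> \<le> ((M * L * d + \<eta> / 2) * t + \<eta> / 2 * t) / t"
          using D E t by (intro divide_right_mono) linarith+
        also have "\<dots> = M * L * d + \<eta>" using t by (simp add: field_simps)
        finally show "\<bar>?h y\<bar> \<le> M * L * d + \<eta>" .
      qed
    qed
    then show ?thesis using t0 by (auto simp: eventually_at_right_field intro!: exI[of _ t0])
  qed
  have "\<bar>frechet_derivative F (at x) (g x) - a x\<bar> \<le> e" for x
  proof -
    have "((\<lambda>t. F (x + t *\<^sub>R g x)) has_derivative (\<lambda>t. frechet_derivative F (at x) (t *\<^sub>R g x))) (at 0)"
      by (rule has_derivative_compose[where f="\<lambda>t. x + t *\<^sub>R g x" and x=0])
         (use C_c_infinity_has_derivative[OF F, of x] in \<open>auto intro!: derivative_eq_intros\<close>)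
    moreover have "frechet_derivative F (at x) (t *\<^sub>R g x) = frechet_derivative F (at x) (g x) * t" for t
      using linear_scale[OF has_derivative_linear[OF C_c_infinity_has_derivative[OF F]]] by simp
    ultimately have "((\<lambda>t. F (x + t *\<^sub>R g x)) has_real_derivative frechet_derivative F (at x) (g x)) (at 0)"
      by (simp add: has_field_derivative_def)
    then have lim: "((\<lambda>t. (F (x + t *\<^sub>R g x) - F x) / t) \<longlongrightarrow> frechet_derivative F (at x) (g x)) (at_right 0)"
      unfolding DERIV_def by (auto intro: tendsto_mono[OF at_le])
    have "\<bar>frechet_derivative F (at x) (g x) - conv a k x\<bar> \<le> M * L * d + \<eta>" if "\<eta> > 0" for \<eta>
      by (rule tendsto_upperbound[OF _ quot[OF that, of x]]) (intro tendsto_intros lim, simp)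
    then have "\<bar>frechet_derivative F (at x) (g x) - conv a k x\<bar> \<le> M * L * d"
      by (rule field_le_epsilon)
    moreover have "\<bar>conv a k x - a x\<bar> \<le> e / 2"
      by (intro conv_close[OF k ac] d2(2)) (simp add: dist_norm norm_minus_commute d_def)
    ultimately show ?thesis using MLd by linarith
  qed
  with F close show thesis by (rule that)
qed

end

section \<open>Density of the range of the resolvent equation\<close>

lemma antiderivative_from_0:
  fixes k :: "real \<Rightarrow> real"
  assumes k: "continuous_on {0..} k" and t: "t \<ge> 0"
  shows "((\<lambda>t. integral {0..t} k) has_real_derivative k t) (at t within {0..})"
proof -
  have "((\<lambda>t. integral {0..t} k) has_real_derivative k t) (at t within {0..t + 1})"
    using t by (intro integral_has_real_derivative continuous_on_subset[OF k]) auto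
  moreover have "at t within {0..t + 1} = at t within {0..}"
    by (rule at_within_nhd[of _ "{..<t+1}"]) auto
  ultimately show ?thesis by simp
qed

lemma C_0_attains_max_abs:
  assumes u: "u \<in> C_0"
  obtains x where "\<And>y. \<bar>u y\<bar> \<le> \<bar>u x\<bar>"
proof (cases "\<exists>x. u x \<noteq> 0")
  case True
  then obtain x0 where x0: "u x0 \<noteq> 0" by blast
  obtain r where r: "r > 0" "\<And>x. norm x > r \<Longrightarrow> \<bar>u x\<bar> \<le> \<bar>u x0\<bar> / 2"
    using C_0_small[OF u, of "\<bar>u x0\<bar> / 2"] x0 by auto
  have x0r: "norm x0 \<le> r" using r(2)[of x0] x0 by linarith
  have "continuous_on (cball 0 r) (\<lambda>x. \<bar>u x\<bar>)"
    using C_0_continuous[OF u] by (intro continuous_intros) (auto intro: continuous_on_subset)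
  then obtain x where x: "x \<in> cball 0 r" "\<And>y. y \<in> cball 0 r \<Longrightarrow> \<bar>u y\<bar> \<le> \<bar>u x\<bar>"
    using continuous_attains_sup[of "cball 0 r" "\<lambda>x. \<bar>u x\<bar>"] r(1) by auto
  have "\<bar>u y\<bar> \<le> \<bar>u x\<bar>" for y
  proof (cases "norm y \<le> r")
    case False
    then have "\<bar>u y\<bar> \<le> \<bar>u x0\<bar>" using r(2)[of y] by linarith
    also have "\<dots> \<le> \<bar>u x\<bar>" using x(2)[of x0] x0r by simp
    finally show ?thesis .
  qed (use x in simp)
  then show thesis by (rule that)
next
  case False
  then show thesis using that[of 0] by simp
qed

lemma C_c_infinity_derivative_support:
  fixes F :: "'a::euclidean_space \<Rightarrow> real"
  assumes F: "F \<in> C_c_infinity"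
  obtains r where "r > 0" "\<And>x. norm x > r \<Longrightarrow> F x = 0" "\<And>x v. norm x > r \<Longrightarrow> frechet_derivative F (at x) v = 0"
proof -
  obtain r where r: "r > 0" "\<And>x. norm x > r \<Longrightarrow> F x = 0" using C_c_infinity_support[OF F] by metis
  have "frechet_derivative F (at x) v = 0" if x: "norm x > r" for x v
  proof -
    have "(F has_derivative (\<lambda>_. 0)) (at x)"
    proof (rule has_derivative_transform_within_open)
      show "((\<lambda>_. 0) has_derivative (\<lambda>_. 0)) (at x)" by simp
      show "open (- cball 0 r)" by (intro open_Compl closed_cball)
    qed (use x r in auto)
    then have "frechet_derivative F (at x) = (\<lambda>_. 0)"
      using frechet_derivative_at by metis
    then show ?thesis by simp
  qed
  with r show thesis by (rule that)
qed

definition dense_range :: "(('a::euclidean_space \<Rightarrow> real) \<Rightarrow> 'a \<Rightarrow> real) \<Rightarrow> bool" where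
  "dense_range T \<longleftrightarrow> (\<forall>h\<in>C_0. \<forall>e>0. \<exists>F\<in>C_c_infinity. \<forall>x. \<bar>T F x - h x\<bar> \<le> e)"

text \<open>
  One approximate solution with relative error \<open>q < 1\<close> suffices: applied to the residual of the
  previous step, it improves the error by the factor \<open>q\<close> each time.
\<close>

lemma dense_range_of_contraction:
  fixes T :: "('a::euclidean_space \<Rightarrow> real) \<Rightarrow> 'a \<Rightarrow> real"
  assumes add: "\<And>F G x. F \<in> C_c_infinity \<Longrightarrow> G \<in> C_c_infinity \<Longrightarrow> T (\<lambda>x. F x + G x) x = T F x + T G x"
    and C0: "\<And>F. F \<in> C_c_infinity \<Longrightarrow> T F \<in> C_0"
    and q: "0 \<le> q" "q < 1"
    and contr: "\<And>h B. h \<in> C_0 \<Longrightarrow> B > 0 \<Longrightarrow> (\<And>x. \<bar>h x\<bar> \<le> B) \<Longrightarrow>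
      \<exists>F\<in>C_c_infinity. \<forall>x. \<bar>T F x - h x\<bar> \<le> q * B"
  shows "dense_range T"
  unfolding dense_range_def
proof (intro ballI allI impI)
  fix h :: "'a \<Rightarrow> real" and e :: real assume h: "h \<in> C_0" and e: "e > 0"
  obtain B where B: "B > 0" "\<And>x. \<bar>h x\<bar> \<le> B" using C_0_bounded[OF h] by blast
  \<comment> \<open>The detour through p > 0 avoids the case q = 0.\<close>
  define p where "p = (q + 1) / 2"
  have p: "0 < p" "p < 1" "q \<le> p" using q by (auto simp: p_def)
  have "\<exists>F\<in>C_c_infinity. \<forall>x. \<bar>T F x - h x\<bar> \<le> p ^ Suc n * B" for n
  proof (induction n)
    case 0
    obtain F where "F \<in> C_c_infinity" "\<And>x. \<bar>T F x - h x\<bar> \<le> q * B" using contr[OF h B] by blast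
    moreover have "q * B \<le> p * B" using p B by simp
    ultimately show ?case by (intro bexI[of _ F]) (auto intro: order_trans)
  next
    case (Suc n)
    then obtain F where F: "F \<in> C_c_infinity" "\<And>x. \<bar>T F x - h x\<bar> \<le> p ^ Suc n * B" by blast
    have "(\<lambda>x. 1 * h x + (-1) * T F x) \<in> C_0" by (rule C_0_lincomb[OF h C0[OF F(1)]])
    then have "(\<lambda>x. h x - T F x) \<in> C_0" by simp
    moreover have "p ^ Suc n * B > 0" using p B by simp
    moreover have "\<bar>h x - T F x\<bar> \<le> p ^ Suc n * B" for x using F(2)[of x] by (simp add: abs_minus_commute)
    ultimately obtain G where G: "G \<in> C_c_infinity" "\<And>x. \<bar>T G x - (h x - T F x)\<bar> \<le> q * (p ^ Suc n * B)"
      using contr[of "\<lambda>x. h x - T F x" "p ^ Suc n * B"] by blast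
    have "(\<lambda>x. F x + G x) \<in> C_c_infinity" using C_c_infinity_lincomb[OF F(1) G(1), of 1 1] by simp
    moreover have "\<bar>T (\<lambda>x. F x + G x) x - h x\<bar> \<le> p ^ Suc (Suc n) * B" for x
    proof -
      have "\<bar>T (\<lambda>x. F x + G x) x - h x\<bar> \<le> q * (p ^ Suc n * B)"
        using G(2)[of x] add[OF F(1) G(1)] by (simp add: algebra_simps)
      also have "\<dots> \<le> p * (p ^ Suc n * B)" using p B by (intro mult_right_mono) auto
      finally show ?thesis by (simp add: mult.assoc)
    qed
    ultimately show ?case by blast
  qed
  moreover obtain n where "p ^ n < e / B" using real_arch_pow_inv[of "e / B" p] e B p by auto
  moreover have "p ^ Suc n * B \<le> p ^ n * B" using p B by (simp add: mult_le_cancel_right1)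
  ultimately obtain F where F: "F \<in> C_c_infinity" "\<And>x. \<bar>T F x - h x\<bar> \<le> p ^ Suc n * B" by blast
  have "p ^ Suc n * B \<le> e" using \<open>p ^ n < e / B\<close> \<open>p ^ Suc n * B \<le> p ^ n * B\<close> B(1) unfolding pos_less_divide_eq[OF B(1)] by linarith
  with F show "\<exists>F\<in>C_c_infinity. \<forall>x. \<bar>T F x - h x\<bar> \<le> e" by (meson order_trans)
qed

context lipschitz_flow
begin

definition transport :: "('a \<Rightarrow> real) \<Rightarrow> 'a \<Rightarrow> real" where
  "transport F x = frechet_derivative F (at x) (g x)"

lemma field_continuous: "continuous_on UNIV g"
  using lipschitz by (rule lipschitz_on_continuous_on)

lemma transport_support:
  assumes F: "F \<in> C_c_infinity"
  obtains r where "r > 0" "\<And>x. norm x > r \<Longrightarrow> F x = 0" "\<And>x. norm x > r \<Longrightarrow> transport F x = 0"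
  using C_c_infinity_derivative_support[OF F] unfolding transport_def by metis

lemma transport_C_0:
  assumes F: "F \<in> C_c_infinity"
  shows "transport F \<in> C_0"
proof -
  have "transport F = (\<lambda>x. \<Sum>b\<in>Basis. (g x \<bullet> b) * frechet_derivative F (at x) b)"
    unfolding transport_def using frechet_derivative_Basis[OF F] by blast
  then have "continuous_on UNIV (transport F)"
    using C_c_infinity_continuous[OF C_c_infinity_derivative[OF F]]
    by (simp add: continuous_intros field_continuous)
  then show ?thesis
    using transport_support[OF F] C_0I_compact_support by metis
qed

lemma transport_add:
  assumes "F \<in> C_c_infinity" "G \<in> C_c_infinity"
  shows "transport (\<lambda>x. F x + G x) x = transport F x + transport G x"
  unfolding transport_def
  using frechet_derivative_at[OF has_derivative_add[OF C_c_infinity_has_derivative[OF assms(1)]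
        C_c_infinity_has_derivative[OF assms(2)]], of x]
  by (metis (no_types, lifting))

lemma transport_mult:
  assumes "F \<in> C_c_infinity" "G \<in> C_c_infinity"
  shows "transport (\<lambda>x. F x * G x) x = F x * transport G x + transport F x * G x"
  unfolding transport_def
  using frechet_derivative_at[OF has_derivative_mult[OF C_c_infinity_has_derivative[OF assms(1)]
        C_c_infinity_has_derivative[OF assms(2)]], of x]
  by (metis (no_types, lifting))

text \<open>
  At a point where \<open>\<bar>F\<bar>\<close> is maximal the differential of \<open>F\<close> vanishes.
\<close>

lemma transport_dissipative:
  assumes F: "F \<in> C_c_infinity" and \<alpha>: "\<alpha> > 0" and B: "\<And>x. \<bar>\<alpha> * F x - transport F x\<bar> \<le> B"
  shows "\<bar>F x\<bar> \<le> B / \<alpha>"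
proof -
  obtain y where y: "\<And>z. \<bar>F z\<bar> \<le> \<bar>F y\<bar>" using C_0_attains_max_abs[OF C_c_infinity_C_0[OF F]] by metis
  have "(\<forall>z\<in>UNIV. F z \<le> F y) \<or> (\<forall>z\<in>UNIV. F y \<le> F z)"
    using y by (cases "F y \<ge> 0") (force simp: abs_le_iff)+
  then have "frechet_derivative F (at y) = (\<lambda>_. 0)"
    by (intro differential_zero_maxmin[OF UNIV_I open_UNIV C_c_infinity_has_derivative[OF F]])
  then have "\<alpha> * \<bar>F y\<bar> \<le> B" using B[of y] \<alpha> by (simp add: transport_def abs_mult)
  with y[of x] \<alpha> show ?thesis
    by (simp add: field_simps) (meson \<alpha> less_imp_le mult_left_mono order_trans)
qed

lemma flow_escapes:
  assumes "exp (speed * T) * (1 + r^2) < norm x" "r \<ge> 0" "0 \<le> s" "s \<le> T"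
  shows "r < norm (\<phi> s x)"
proof (rule ccontr)
  assume "\<not> ?thesis"
  then have "(norm (\<phi> s x))^2 \<le> r^2" by (intro power_mono) auto
  then have "weight (\<phi> s x) \<le> 1 + r^2" by (simp add: weight_def dot_square_norm)
  then have "exp (speed * T) * weight (\<phi> s x) \<le> exp (speed * T) * (1 + r^2)" by simp
  with weight_flow_mono(2)[of s T x] norm_le_weight[of x] assms show False by simp
qed

lemma C_0_flow:
  assumes h: "h \<in> C_0" and t: "t \<ge> 0"
  shows "(\<lambda>z. h (\<phi> t z)) \<in> C_0"
  unfolding C_0_iff
proof (intro conjI allI impI)
  show "continuous_on UNIV (\<lambda>z. h (\<phi> t z))"
    using t by (intro continuous_on_compose2[OF C_0_continuous[OF h]] flow_continuous_compose continuous_intros) auto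
  fix e :: real assume "e > 0"
  then obtain r where r: "r > 0" "\<And>x. norm x > r \<Longrightarrow> \<bar>h x\<bar> \<le> e" using C_0_small[OF h] by blast
  then have "\<bar>h (\<phi> t z)\<bar> \<le> e" if "norm z > exp (speed * t) * (1 + r^2)" for z
    using flow_escapes[OF that, of t] t by simp
  then show "\<exists>r. \<forall>z. norm z > r \<longrightarrow> \<bar>h (\<phi> t z)\<bar> \<le> e" by blast
qed

text \<open>
  \<open>f\<close> is the resolvent integral of \<open>h\<close> along the flow cut off at time 1. The finite horizon keeps the
  support compact and makes \<open>f\<close> Lipschitz for every \<open>\<alpha>\<close>, at the price of the boundary term
  \<open>exp (- \<alpha>) h(\<phi>_1 x)\<close>, whose factor is less than 1.
\<close>

lemma finite_horizon_solution:
  assumes h: "h \<in> C_c_infinity" and \<alpha>: "\<alpha> > 0"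
  obtains f r M a where "continuous_on UNIV f" "\<And>x. norm x > r \<Longrightarrow> f x = 0" "M-lipschitz_on UNIV f" "a \<in> C_0"
    "\<And>z t. t \<ge> 0 \<Longrightarrow> ((\<lambda>t. f (\<phi> t z)) has_real_derivative a (\<phi> t z)) (at t within {0..})"
    "\<And>x. \<alpha> * f x - a x = h x - exp (- \<alpha>) * h (\<phi> 1 x)"
proof -
  obtain r where r: "r > 0" "\<And>x. norm x > r \<Longrightarrow> h x = 0" using C_c_infinity_support[OF h] by blast
  obtain M where M: "M-lipschitz_on UNIV h" using C_c_infinity_lipschitz[OF h] by blast
  have M0: "M \<ge> 0" using M by (rule lipschitz_on_nonneg)
  have hc: "continuous_on UNIV h" by (rule C_c_infinity_continuous[OF h])
  define k where "k z s = exp (- \<alpha> * s) * h (\<phi> s z)" for z s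
  define f where "f z = integral {0..1} (k z)" for z
  define a where "a x = \<alpha> * f x + exp (- \<alpha>) * h (\<phi> 1 x) - h x" for x
  have kc: "continuous_on {0..} (k z)" for z
    unfolding k_def
    by (intro continuous_intros continuous_on_compose2[OF hc] flow_continuous_time) auto
  have kc1: "continuous_on {0..1} (k z)" for z by (rule continuous_on_subset[OF kc]) auto
  define R where "R = exp speed * (1 + r^2)"
  have esc: "h (\<phi> s x) = 0" if "norm x > R" "0 \<le> s" "s \<le> 1" for x s
    using flow_escapes[of 1 r x s] that r unfolding R_def by auto
  have f0: "f x = 0" if "norm x > R" for x
  proof -
    have "f x = integral {0..1} (\<lambda>_::real. 0)"
      unfolding f_def by (rule Henstock_Kurzweil_Integration.integral_cong) (simp add: k_def esc that)
    then show ?thesis by simp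
  qed
  have fl: "(M * exp L)-lipschitz_on UNIV f"
  proof (rule lipschitz_onI)
    fix x y :: 'a
    have "f x - f y = integral {0..1} (\<lambda>s. k x s - k y s)"
      unfolding f_def by (rule Henstock_Kurzweil_Integration.integral_diff[symmetric]; rule integrable_continuous_interval[OF kc1])
    also have "norm \<dots> \<le> (M * (exp L * norm (x - y))) * (1 - 0)"
    proof (rule integral_bound)
      show "continuous_on {0..1} (\<lambda>s. k x s - k y s)" by (intro continuous_intros kc1)
      fix s :: real assume s: "s \<in> {0..1}"
      have "norm (k x s - k y s) = exp (- \<alpha> * s) * \<bar>h (\<phi> s x) - h (\<phi> s y)\<bar>"
        by (simp add: k_def abs_mult flip: right_diff_distrib)
      also have "\<dots> \<le> 1 * (M * norm (\<phi> s x - \<phi> s y))"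
        using s \<alpha> lipschitz_onD[OF M, of "\<phi> s x" "\<phi> s y"] M0
        by (intro mult_mono) (auto simp: dist_norm)
      also have "\<dots> \<le> M * (exp L * norm (x - y))"
      proof -
        have "norm (\<phi> s x - \<phi> s y) \<le> exp (L * s) * norm (x - y)" using s by (intro flow_lipschitz) auto
        also have "\<dots> \<le> exp L * norm (x - y)"
          using s L_nonneg mult_left_mono[of s 1 L] by (intro mult_right_mono) auto
        finally show ?thesis using M0 by (simp add: mult_left_mono)
      qed
      finally show "norm (k x s - k y s) \<le> M * (exp L * norm (x - y))" .
    qed simp
    finally show "dist (f x) (f y) \<le> M * exp L * dist x y" by (simp add: dist_norm mult.assoc)
  qed (use M0 in simp)
  have fc: "continuous_on UNIV f" using fl by (rule lipschitz_on_continuous_on)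
  have "a \<in> C_0"
  proof (rule C_0I_compact_support)
    show "continuous_on UNIV a"
      unfolding a_def
      by (intro continuous_intros fc hc continuous_on_compose2[OF hc] flow_continuous_compose) auto
    show "a x = 0" if "norm x > R" for x
      using f0[OF that] esc[OF that, of 0] esc[OF that, of 1] by (simp add: a_def)
  qed
  moreover have "((\<lambda>t. f (\<phi> t z)) has_real_derivative a (\<phi> t z)) (at t within {0..})" if t: "t \<ge> 0" for z t
  proof -
    \<comment> \<open>Along a trajectory the integral becomes exp (\<alpha> t) times an increment of an
      antiderivative over [t, t + 1], which can be differentiated in t.\<close>
    define I where "I t = integral {0..t} (k z)" for t
    have I: "(I has_real_derivative k z t) (at t within {0..})" if "t \<ge> 0" for t
      unfolding I_def by (rule antiderivative_from_0[OF kc that])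
    have shift: "((\<lambda>s. I (s + c)) has_real_derivative k z (s + c)) (at s within {0..})"
      if "s \<ge> 0" "c \<ge> 0" for s c
    proof -
      have "((\<lambda>s. s + c) has_real_derivative 1) (at s within {0..})"
        by (auto intro!: derivative_eq_intros)
      moreover have "(I has_real_derivative k z (s + c)) (at (s + c) within (\<lambda>s. s + c) ` {0..})"
        using that by (intro has_field_derivative_subset[OF I]) auto
      ultimately show ?thesis using DERIV_chain2 DERIV_image_chain[of I "k z (s + c)" "\<lambda>s. s + c"]
        by (fastforce simp: o_def)
    qed
    have k_shift: "exp (\<alpha> * t) * k z (s + t) = exp (- \<alpha> * s) * h (\<phi> (s + t) z)" for s t
    proof -
      have "exp (\<alpha> * t) * exp (- \<alpha> * (s + t)) = exp (- \<alpha> * s)"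
        unfolding exp_add[symmetric] by (simp add: algebra_simps)
      then show ?thesis unfolding k_def by (simp only: mult.assoc[symmetric])
    qed
    have eq: "f (\<phi> t z) = exp (\<alpha> * t) * (I (t + 1) - I t)" if t: "t \<ge> 0" for t
    proof -
      have "((\<lambda>s. k z (s + t)) has_integral I (1 + t) - I (0 + t)) {0..1}"
      proof (rule fundamental_theorem_of_calculus)
        fix s :: real assume "s \<in> {0..1}"
        then show "((\<lambda>s. I (s + t)) has_vector_derivative k z (s + t)) (at s within {0..1})"
          using has_field_derivative_subset[OF shift[of s t], of "{0..1}"] t
          by (auto simp: has_real_derivative_iff_has_vector_derivative)
      qed simp
      then have "integral {0..1} (\<lambda>s. exp (\<alpha> * t) * k z (s + t)) = exp (\<alpha> * t) * (I (t + 1) - I t)"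
        by (simp add: integral_unique add.commute)
      moreover have "integral {0..1} (k (\<phi> t z)) = integral {0..1} (\<lambda>s. exp (\<alpha> * t) * k z (s + t))"
        unfolding k_shift using t
        by (intro Henstock_Kurzweil_Integration.integral_cong) (simp add: flow_add k_def)
      ultimately show ?thesis by (simp add: f_def)
    qed
    have "((\<lambda>t. exp (\<alpha> * t) * (I (t + 1) - I t)) has_real_derivative
        exp (\<alpha> * t) * (k z (t + 1) - k z t) + \<alpha> * exp (\<alpha> * t) * (I (t + 1) - I t)) (at t within {0..})"
      using shift[OF t, of 1] I[OF t] by (auto intro!: derivative_eq_intros)
    also have "exp (\<alpha> * t) * (k z (t + 1) - k z t) + \<alpha> * exp (\<alpha> * t) * (I (t + 1) - I t) = a (\<phi> t z)"
      using k_shift[of t 1] k_shift[of t 0] flow_add[OF zero_le_one t, of z]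
      by (simp add: a_def eq[OF t] algebra_simps)
    finally show ?thesis
      by (rule has_field_derivative_transform_within[of _ _ _ _ 1]) (use t eq in auto)
  qed
  ultimately show thesis
    using fc f0 fl that[of f R "M * exp L" a] by (simp add: a_def)
qed

lemma dense_range_transport:
  assumes \<alpha>: "\<alpha> > 0"
  shows "dense_range (\<lambda>F x. \<alpha> * F x - transport F x)"
proof (rule dense_range_of_contraction[where q="(1 + exp (- \<alpha>)) / 2"])
  show "(1 + exp (- \<alpha>)) / 2 < 1" using \<alpha> by simp
  fix h :: "'a \<Rightarrow> real" and B :: real assume h: "h \<in> C_0" and B: "B > 0" "\<And>x. \<bar>h x\<bar> \<le> B"
  \<comment> \<open>Three errors of size e, from h, from f and from the boundary term, fill half of the gap
    between exp (- \<alpha>) * B and B.\<close>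
  define e where "e = (1 - exp (- \<alpha>)) * B / 6"
  have e: "e > 0" using \<alpha> B by (simp add: e_def)
  obtain u where u: "u \<in> C_c_infinity" "\<And>x. \<bar>u x - h x\<bar> \<le> e" using C_c_infinity_dense[OF h e] by blast
  obtain f r M a where f: "continuous_on UNIV f" "\<And>x. norm x > r \<Longrightarrow> f x = 0" "M-lipschitz_on UNIV f" "a \<in> C_0"
    "\<And>z t. t \<ge> 0 \<Longrightarrow> ((\<lambda>t. f (\<phi> t z)) has_real_derivative a (\<phi> t z)) (at t within {0..})"
    "\<And>x. \<alpha> * f x - a x = u x - exp (- \<alpha>) * u (\<phi> 1 x)"
    by (rule finite_horizon_solution[OF u(1) \<alpha>]) blast
  have "e / (\<alpha> + 1) > 0" using e \<alpha> by simp
  then obtain F where F: "F \<in> C_c_infinity" "\<And>x. \<bar>F x - f x\<bar> \<le> e / (\<alpha> + 1)"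
    "\<And>x. \<bar>transport F x - a x\<bar> \<le> e / (\<alpha> + 1)"
    using mollify_along_flow[OF f(1-5)] unfolding transport_def by metis
  have "\<bar>\<alpha> * F x - transport F x - h x\<bar> \<le> (1 + exp (- \<alpha>)) / 2 * B" for x
  proof -
    have "\<bar>\<alpha> * (F x - f x)\<bar> \<le> \<alpha> * (e / (\<alpha> + 1))"
      unfolding abs_mult using F(2)[of x] \<alpha> by (intro mult_mono) auto
    moreover have "\<alpha> * (e / (\<alpha> + 1)) + e / (\<alpha> + 1) = e"
    proof -
      have "\<alpha> * (e / (\<alpha> + 1)) + e / (\<alpha> + 1) = (\<alpha> + 1) * (e / (\<alpha> + 1))"
        by (simp only: distrib_right mult_1)
      also have "\<dots> = e" using \<alpha> by simp
      finally show ?thesis .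
    qed
    moreover have "\<bar>exp (- \<alpha>) * u (\<phi> 1 x)\<bar> \<le> exp (- \<alpha>) * B + e"
    proof -
      have "\<bar>exp (- \<alpha>) * u (\<phi> 1 x)\<bar> \<le> exp (- \<alpha>) * (B + e)"
        unfolding abs_mult using u(2)[of "\<phi> 1 x"] B(2)[of "\<phi> 1 x"] by (intro mult_mono) auto
      also have "\<dots> \<le> exp (- \<alpha>) * B + e" using \<alpha> e by (simp add: algebra_simps)
      finally show ?thesis .
    qed
    moreover have "\<alpha> * F x - transport F x - h x =
        \<alpha> * (F x - f x) - (transport F x - a x) + (u x - h x) - exp (- \<alpha>) * u (\<phi> 1 x)"
      using f(6)[of x] by (simp add: algebra_simps)
    ultimately have "\<bar>\<alpha> * F x - transport F x - h x\<bar> \<le> e + e + (exp (- \<alpha>) * B + e)"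
      using F(3)[of x] u(2)[of x] by linarith
    also have "\<dots> = (1 + exp (- \<alpha>)) / 2 * B" by (simp add: e_def field_simps)
    finally show ?thesis .
  qed
  with F(1) show "\<exists>F\<in>C_c_infinity. \<forall>x. \<bar>\<alpha> * F x - transport F x - h x\<bar> \<le> (1 + exp (- \<alpha>)) / 2 * B" by blast
next
  fix F assume F: "F \<in> (C_c_infinity :: ('a \<Rightarrow> real) set)"
  show "(\<lambda>x. \<alpha> * F x - transport F x) \<in> C_0"
    using C_0_lincomb[OF C_c_infinity_C_0[OF F] transport_C_0[OF F], of \<alpha> "-1"] by simp
qed (auto simp: transport_add algebra_simps add_nonneg_nonneg)

end

text \<open>
  \<open>flat_exp 2\<close> is the derivative of \<open>flat_exp 0\<close>; the bound controls the gradient of the cutoff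
  functions.
\<close>

lemma flat_exp_2_le: "\<bar>flat_exp 2 u\<bar> \<le> 2"
proof (cases "u \<le> 0")
  case False
  define w where "w = inverse u"
  have "w \<ge> 0" using False by (simp add: w_def)
  then have "w^2 / 2 \<le> exp w" using exp_lower_Taylor_quadratic[of w] by linarith
  then have "exp (- w) * w^2 \<le> 2" by (simp add: exp_minus field_simps)
  then show ?thesis using False by (simp add: flat_exp_def w_def)
qed (simp add: flat_exp_def)

text \<open>
  The factor \<open>exp 1\<close> normalises the bump to 1 at the origin. As \<open>c\<close> tends to 0 the support, the ball
  of radius \<open>1 / sqrt c\<close>, fills the space and the cutoff tends to 1 locally uniformly.
\<close>

definition cutoff :: "real \<Rightarrow> 'a::euclidean_space \<Rightarrow> real" where
  "cutoff c x = exp 1 * bump c x"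

lemma cutoff_smooth: "c > 0 \<Longrightarrow> cutoff c \<in> C_c_infinity"
  using C_c_infinity_lincomb[OF bump_smooth bump_smooth, of c c "exp 1" 0] by (simp add: cutoff_def[abs_def])

lemma cutoff_radial: "norm x = norm y \<Longrightarrow> cutoff c x = cutoff c y"
  by (simp add: cutoff_def bump_def dot_square_norm)

lemma cutoff_eq_0: "c > 0 \<Longrightarrow> c * (norm x)^2 \<ge> 1 \<Longrightarrow> cutoff c x = 0"
  by (simp add: cutoff_def bump_eq_0)

lemma cutoff_bounds:
  assumes "c \<ge> 0"
  shows "0 \<le> cutoff c x" "cutoff c x \<le> 1"
proof -
  show "0 \<le> cutoff c x" by (simp add: cutoff_def bump_nonneg)
  define u where "u = 1 - c * (x \<bullet> x)"
  have "u \<le> 1" using assms by (simp add: u_def)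
  then have "exp 1 * flat_exp 0 u \<le> 1"
    by (auto simp: flat_exp_def exp_add[symmetric] one_le_inverse_iff)
  then show "cutoff c x \<le> 1" by (simp add: cutoff_def bump_def u_def)
qed

lemma cutoff_near_1:
  assumes "c \<ge> 0" "c * (norm x)^2 \<le> 1 / 2"
  shows "1 - cutoff c x \<le> 2 * (c * (norm x)^2)"
proof -
  define s where "s = c * (norm x)^2"
  have s: "0 \<le> s" "s \<le> 1/2" using assms by (auto simp: s_def)
  have "1 - cutoff c x = 1 - exp (1 - inverse (1 - s))"
    using s by (simp add: cutoff_def bump_def flat_exp_def s_def[symmetric] dot_square_norm exp_add[symmetric])
  also have "\<dots> \<le> inverse (1 - s) - 1"
    using exp_ge_add_one_self[of "1 - inverse (1 - s)"] by linarith
  also have "\<dots> \<le> 2 * s"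
  proof -
    have "s * (s * 2) \<le> s * 1" using s by (intro mult_left_mono) auto
    then show ?thesis using s by (simp add: field_simps)
  qed
  finally show ?thesis by (simp add: s_def)
qed

text \<open>
  The jump part enters the density argument only through an additive contraction \<open>Q\<close> of \<open>C_0\<close>.
\<close>

locale jump_transport = lipschitz_flow g \<phi> L
  for g :: "'a::euclidean_space \<Rightarrow> 'a" and \<phi> L +
  fixes Q :: "('a \<Rightarrow> real) \<Rightarrow> 'a \<Rightarrow> real"
  assumes Q_bound: "F \<in> C_0 \<Longrightarrow> (\<And>x. \<bar>F x\<bar> \<le> B) \<Longrightarrow> \<bar>Q F x\<bar> \<le> B"
    and Q_add: "F \<in> C_0 \<Longrightarrow> G \<in> C_0 \<Longrightarrow> Q (\<lambda>x. F x + G x) x = Q F x + Q G x"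
    and Q_C_0: "F \<in> C_0 \<Longrightarrow> Q F \<in> C_0"
begin

definition generator :: "('a \<Rightarrow> real) \<Rightarrow> ('a \<Rightarrow> real) \<Rightarrow> 'a \<Rightarrow> real" where
  "generator l F x = transport F x + l x * (Q F x - F x)"

lemma generator_add:
  assumes "F \<in> C_c_infinity" "G \<in> C_c_infinity"
  shows "generator l (\<lambda>x. F x + G x) x = generator l F x + generator l G x"
  using assms by (simp add: generator_def transport_add Q_add C_c_infinity_C_0 algebra_simps)

lemma bounded_rate_generator_C_0:
  assumes l: "continuous_on UNIV l" "\<And>x. 0 \<le> l x" "\<And>x. l x \<le> \<Lambda>" and F: "F \<in> C_c_infinity"
  shows "generator l F \<in> C_0"
proof -
  have F0: "F \<in> C_0" by (rule C_c_infinity_C_0[OF F])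
  have "(\<lambda>x. l x * (1 * Q F x + (-1) * F x)) \<in> C_0"
    by (rule C_0_mult_bounded[OF C_0_lincomb[OF Q_C_0[OF F0] F0] l(1), of \<Lambda>]) (use l in auto)
  from C_0_lincomb[OF transport_C_0[OF F] this, of 1 1] show ?thesis
    by (simp add: generator_def[abs_def])
qed

text \<open>
  Moving the jump part to the right-hand side of \<open>\<beta> F - L F\<close> leaves \<open>(\<beta> + \<Lambda>) F - A F\<close>. The jump part
  is at most \<open>\<Lambda>\<close> times the maximum of \<open>\<bar>F\<bar>\<close>, which the surplus \<open>\<Lambda>\<close> on the left absorbs.
\<close>

lemma bounded_rate_dissipative:
  assumes l: "\<And>x. 0 \<le> l x" "\<And>x. l x \<le> \<Lambda>" and \<beta>: "\<beta> > 0" and F: "F \<in> C_c_infinity"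
    and B: "\<And>x. \<bar>\<beta> * F x - generator l F x\<bar> \<le> B"
  shows "\<bar>F x\<bar> \<le> B / \<beta>"
proof -
  have F0: "F \<in> C_0" by (rule C_c_infinity_C_0[OF F])
  obtain y where y: "\<And>z. \<bar>F z\<bar> \<le> \<bar>F y\<bar>" using C_0_attains_max_abs[OF F0] by metis
  define m where "m = \<bar>F y\<bar>"
  have \<Lambda>: "\<Lambda> \<ge> 0" using l order_trans by blast
  have "\<bar>(\<beta> + \<Lambda>) * F z - transport F z\<bar> \<le> B + \<Lambda> * m" for z
  proof -
    have "(\<beta> + \<Lambda>) * F z - transport F z = (\<beta> * F z - generator l F z) + ((\<Lambda> - l z) * F z + l z * Q F z)"
      by (simp add: generator_def algebra_simps)
    moreover have "\<bar>(\<Lambda> - l z) * F z\<bar> \<le> (\<Lambda> - l z) * m"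
      unfolding abs_mult using l[of z] y[of z] by (intro mult_mono) (auto simp: m_def)
    moreover have "\<bar>l z * Q F z\<bar> \<le> l z * m"
      unfolding abs_mult using l[of z] Q_bound[OF F0, of m z] y by (intro mult_mono) (auto simp: m_def)
    moreover have "(\<Lambda> - l z) * m + l z * m = \<Lambda> * m" by (simp add: algebra_simps)
    ultimately show ?thesis using B[of z] by linarith
  qed
  then have "m \<le> (B + \<Lambda> * m) / (\<beta> + \<Lambda>)"
    using transport_dissipative[OF F, of "\<beta> + \<Lambda>" "B + \<Lambda> * m" y] \<beta> \<Lambda> by (simp add: m_def)
  then have "m * (\<beta> + \<Lambda>) \<le> B + \<Lambda> * m" using \<beta> \<Lambda> by (simp add: pos_le_divide_eq)
  then have "m \<le> B / \<beta>" using \<beta> by (simp add: field_simps)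
  with y[of x] show ?thesis by (simp add: m_def)
qed

text \<open>
  The exact inverse of \<open>(\<beta> + \<Lambda>) - A\<close> has norm at most \<open>1 / (\<beta> + \<Lambda>)\<close>, and the neglected operator
  \<open>(\<Lambda> - l) + l Q\<close> has norm at most \<open>\<Lambda>\<close>: the relative error is less than 1 for every \<open>\<beta> > 0\<close>.
\<close>

lemma bounded_rate_dense_range:
  assumes l: "continuous_on UNIV l" "\<And>x. 0 \<le> l x" "\<And>x. l x \<le> \<Lambda>" and \<beta>: "\<beta> > 0"
  shows "dense_range (\<lambda>F x. \<beta> * F x - generator l F x)"
proof (rule dense_range_of_contraction[where q="(\<Lambda> / (\<beta> + \<Lambda>) + 1) / 2"])
  have \<Lambda>: "\<Lambda> \<ge> 0" using l order_trans by blast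
  define \<alpha> where "\<alpha> = \<beta> + \<Lambda>"
  have \<alpha>: "\<alpha> > 0" "\<Lambda> < \<alpha>" using \<beta> \<Lambda> by (auto simp: \<alpha>_def)
  show "0 \<le> (\<Lambda> / (\<beta> + \<Lambda>) + 1) / 2" "(\<Lambda> / (\<beta> + \<Lambda>) + 1) / 2 < 1" using \<beta> \<Lambda> by auto
  fix h :: "'a \<Rightarrow> real" and B :: real assume h: "h \<in> C_0" and B: "B > 0" "\<And>x. \<bar>h x\<bar> \<le> B"
  define p where "p = \<Lambda> / \<alpha>"
  have p: "0 \<le> p" "p < 1" using \<alpha> \<Lambda> by (auto simp: p_def)
  define e where "e = (1 - p) * B / 4"
  have e: "e > 0" using p B by (simp add: e_def)
  obtain F where F: "F \<in> C_c_infinity" "\<And>x. \<bar>(\<alpha> * F x - transport F x) - h x\<bar> \<le> e"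
    using dense_range_transport[OF \<alpha>(1)] h e unfolding dense_range_def by blast
  have F0: "F \<in> C_0" by (rule C_c_infinity_C_0[OF F(1)])
  have Fb: "\<bar>F x\<bar> \<le> (B + e) / \<alpha>" for x
  proof (rule transport_dissipative[OF F(1) \<alpha>(1)])
    show "\<bar>\<alpha> * F x - transport F x\<bar> \<le> B + e" for x using F(2)[of x] B(2)[of x] by linarith
  qed
  have "\<bar>\<beta> * F x - generator l F x - h x\<bar> \<le> (\<Lambda> / (\<beta> + \<Lambda>) + 1) / 2 * B" for x
  proof -
    let ?m = "(B + e) / \<alpha>"
    have "\<beta> * F x - generator l F x - h x =
        (\<alpha> * F x - transport F x - h x) - ((\<Lambda> - l x) * F x + l x * Q F x)"
      by (simp add: generator_def \<alpha>_def algebra_simps)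
    moreover have "\<bar>(\<Lambda> - l x) * F x\<bar> \<le> (\<Lambda> - l x) * ?m"
      unfolding abs_mult using l(2,3)[of x] Fb[of x] by (intro mult_mono) auto
    moreover have "\<bar>l x * Q F x\<bar> \<le> l x * ?m"
      unfolding abs_mult using l(2)[of x] Q_bound[OF F0 Fb, of x] by (intro mult_mono) auto
    moreover have "(\<Lambda> - l x) * ?m + l x * ?m = p * (B + e)"
      unfolding distrib_right[symmetric] by (simp add: p_def)
    ultimately have "\<bar>\<beta> * F x - generator l F x - h x\<bar> \<le> e + p * (B + e)"
      using F(2)[of x] by linarith
    also have "\<dots> \<le> e + p * B + e" using p e by (simp add: algebra_simps mult_left_le_one_le)
    also have "\<dots> = (p + 1) / 2 * B" by (simp add: e_def field_simps)
    finally show ?thesis by (simp add: p_def \<alpha>_def)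
  qed
  with F(1) show "\<exists>F\<in>C_c_infinity. \<forall>x. \<bar>\<beta> * F x - generator l F x - h x\<bar> \<le> (\<Lambda> / (\<beta> + \<Lambda>) + 1) / 2 * B"
    by blast
next
  fix F assume F: "F \<in> (C_c_infinity :: ('a \<Rightarrow> real) set)"
  show "(\<lambda>x. \<beta> * F x - generator l F x) \<in> C_0"
    using C_0_lincomb[OF C_c_infinity_C_0[OF F] bounded_rate_generator_C_0[OF l F], of \<beta> "-1"] by simp
qed (simp add: generator_add algebra_simps)

end

text \<open>
  A jump that preserves the norm does not see radial factors.
\<close>

locale radial_jump_transport = jump_transport +
  assumes Q_radial: "F \<in> C_0 \<Longrightarrow> (\<And>x y. norm x = norm y \<Longrightarrow> w x = w y) \<Longrightarrow> Q (\<lambda>x. w x * F x) x = w x * Q F x"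
begin

text \<open>
  The gradient of the cutoff has size \<open>c \<parallel>x\<parallel>\<close> on a ball of radius \<open>1 / sqrt c\<close>, where \<open>g\<close> grows at most
  linearly, so the bound is uniform in \<open>c\<close>.
\<close>

lemma cutoff_gradient:
  assumes c: "0 < c" "c \<le> 1"
  shows "\<bar>transport (cutoff c) x\<bar> \<le> 4 * exp 1 * speed"
proof -
  have D: "frechet_derivative (cutoff c) (at x) =
      (\<lambda>v. exp 1 * (- 2 * c * ((x \<bullet> v) * flat_exp 2 (1 - c * (x \<bullet> x)))))"
    unfolding cutoff_def[abs_def] bump_def
    by (rule frechet_derivative_at[symmetric])
       (use has_derivative_mult_right[OF has_derivative_flat_exp_inner[of 0 c x], of "exp 1"]
        in \<open>simp add: numeral_2_eq_2\<close>)
  show ?thesis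
  proof (cases "c * (x \<bullet> x) \<ge> 1")
    case True
    then show ?thesis using speed_nonneg unfolding transport_def D by (simp add: flat_exp_def)
  next
    case False
    have "c * (2 * \<bar>x \<bullet> g x\<bar>) \<le> c * (speed * weight x)"
      using c inner_field_le[of x] by (intro mult_left_mono) auto
    also have "\<dots> = speed * (c + c * (x \<bullet> x))" by (simp add: weight_def algebra_simps)
    also have "\<dots> \<le> speed * 2" using False c speed_nonneg by (intro mult_left_mono) auto
    finally have *: "c * (2 * \<bar>x \<bullet> g x\<bar>) \<le> speed * 2" .
    have "\<bar>transport (cutoff c) x\<bar> = exp 1 * (c * (2 * \<bar>x \<bullet> g x\<bar>) * \<bar>flat_exp 2 (1 - c * (x \<bullet> x))\<bar>)"
      using c by (simp add: transport_def D abs_mult)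
    also have "\<dots> \<le> exp 1 * ((speed * 2) * 2)"
      by (rule mult_left_mono[OF mult_mono[OF * flat_exp_2_le]]) (use speed_nonneg in auto)
    finally show ?thesis by simp
  qed
qed

lemma generator_cutoff:
  assumes F: "F \<in> C_c_infinity" and c: "0 < c" and l: "\<And>x. c * (norm x)^2 < 1 \<Longrightarrow> l x = lam x"
  shows "generator lam (\<lambda>x. cutoff c x * F x) x = cutoff c x * generator l F x + transport (cutoff c) x * F x"
proof -
  have "generator lam (\<lambda>x. cutoff c x * F x) x =
      cutoff c x * (transport F x + lam x * (Q F x - F x)) + transport (cutoff c) x * F x"
    using Q_radial[OF C_c_infinity_C_0[OF F], where w="cutoff c" and x=x, OF cutoff_radial] transport_mult[OF cutoff_smooth[OF c] F, of x]
    by (simp add: generator_def algebra_simps)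
  then show ?thesis
    using l[of x] cutoff_eq_0[OF c, of x] by (cases "c * (norm x)^2 < 1") (simp_all add: generator_def)
qed

lemma generator_C_0:
  assumes lam: "continuous_on UNIV lam" and F: "F \<in> C_c_infinity"
  shows "generator lam F \<in> C_0"
proof -
  have F0: "F \<in> C_0" by (rule C_c_infinity_C_0[OF F])
  obtain r where r: "r > 0" "\<And>x. norm x > r \<Longrightarrow> F x = 0" "\<And>x. norm x > r \<Longrightarrow> transport F x = 0"
    using transport_support[OF F] by blast
  show ?thesis
  proof (rule C_0I_compact_support)
    show "continuous_on UNIV (generator lam F)"
      unfolding generator_def[abs_def]
      by (intro continuous_intros C_0_continuous transport_C_0 F F0 Q_C_0 lam)
    show "generator lam F x = 0" if x: "norm x > r" for x
    proof -
      have "(\<lambda>x. (if norm x > r then 0 else 1) * F x) = F" using r(2) by auto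
      then have "Q F x = 0" using Q_radial[OF F0, of "\<lambda>x. if norm x > r then 0 else 1" x] x by simp
      with r x show ?thesis by (simp add: generator_def)
    qed
  qed
qed

text \<open>
  The equation is solved with an intensity that is capped outside the support of the cutoff. By
  \<open>generator_cutoff\<close>, multiplying the solution by the cutoff makes the cap invisible and adds only
  the gradient term, which is at most half of the data since \<open>\<beta>\<close> exceeds twice the gradient bound.
\<close>

lemma unbounded_rate_dense_range:
  assumes lam: "continuous_on UNIV lam" "\<And>x. 0 \<le> lam x"
  obtains \<beta> where "\<beta> > 0" "dense_range (\<lambda>F x. \<beta> * F x - generator lam F x)"
proof -
  define C where "C = 4 * exp 1 * speed"
  have C: "C \<ge> 0" using speed_nonneg by (simp add: C_def)
  define \<beta> where "\<beta> = 2 * C + 1"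
  have \<beta>: "\<beta> > 0" using C by (simp add: \<beta>_def)
  have "dense_range (\<lambda>F x. \<beta> * F x - generator lam F x)"
  proof (rule dense_range_of_contraction[where q="3 / 4"])
    fix h :: "'a \<Rightarrow> real" and B :: real assume h: "h \<in> C_0" and B: "B > 0" "\<And>x. \<bar>h x\<bar> \<le> B"
    \<comment> \<open>The gradient term is at most (B + e) / 2 and two further errors are at most e each; with
      e = B / 12 the sum stays below 3 / 4 * B.\<close>
    define e where "e = B / 12"
    have e: "e > 0" using B by (simp add: e_def)
    obtain r where r: "r > 0" "\<And>x. norm x > r \<Longrightarrow> \<bar>h x\<bar> \<le> e" using C_0_small[OF h e] by blast
    \<comment> \<open>With c * r^2 at most 1 / 24 the cutoff differs from 1 by at most 1 / 12 where h is not small.\<close>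
    define c where "c = min 1 (1 / 24 / r^2)"
    have c: "0 < c" "c \<le> 1" "c * r^2 \<le> 1 / 24" using r by (auto simp: c_def min_def field_simps)
    have "compact (lam ` cball 0 (1 / sqrt c))"
      by (intro compact_continuous_image continuous_on_subset[OF lam(1)]) auto
    then have "bounded (lam ` cball 0 (1 / sqrt c))" by (rule compact_imp_bounded)
    then obtain \<Lambda> where "\<forall>y\<in>lam ` cball 0 (1 / sqrt c). norm y \<le> \<Lambda>"
      unfolding bounded_iff by blast
    then have \<Lambda>: "lam x \<le> \<Lambda>" if "norm x \<le> 1 / sqrt c" for x
      using that by (force intro: order_trans[OF abs_ge_self])
    define l where "l x = min (lam x) (max 0 \<Lambda>)" for x
    have l: "continuous_on UNIV l" "\<And>x. 0 \<le> l x" "\<And>x. l x \<le> max 0 \<Lambda>"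
      unfolding l_def using lam by (auto intro!: continuous_intros)
    have l_eq: "l x = lam x" if "c * (norm x)^2 < 1" for x
    proof -
      have "(norm x * sqrt c)^2 < 1^2" using that c by (simp add: power_mult_distrib algebra_simps)
      then have "norm x * sqrt c < 1" by (rule power_less_imp_less_base) simp
      then have "norm x \<le> 1 / sqrt c" using c by (simp add: field_simps)
      from \<Lambda>[OF this] show ?thesis by (simp add: l_def)
    qed
    obtain F where F: "F \<in> C_c_infinity" "\<And>x. \<bar>(\<beta> * F x - generator l F x) - h x\<bar> \<le> e"
      using bounded_rate_dense_range[OF l \<beta>] h e unfolding dense_range_def by blast
    have Fb: "\<bar>F x\<bar> \<le> (B + e) / \<beta>" for x
    proof (rule bounded_rate_dissipative[OF l(2,3) \<beta> F(1)])
      show "\<bar>\<beta> * F x - generator l F x\<bar> \<le> B + e" for x using F(2)[of x] B(2)[of x] by linarith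
    qed
    define G where "G x = cutoff c x * F x" for x
    have "G \<in> C_c_infinity" unfolding G_def by (intro C_c_infinity_mult cutoff_smooth c F)
    moreover have "\<bar>\<beta> * G x - generator lam G x - h x\<bar> \<le> 3 / 4 * B" for x
    proof -
      have eq: "\<beta> * G x - generator lam G x - h x =
          cutoff c x * (\<beta> * F x - generator l F x - h x) - transport (cutoff c) x * F x - (1 - cutoff c x) * h x"
        using generator_cutoff[where x=x, OF F(1) c(1) l_eq] unfolding G_def[abs_def] by (simp add: algebra_simps)
      have 1: "\<bar>cutoff c x * (\<beta> * F x - generator l F x - h x)\<bar> \<le> 1 * e"
        unfolding abs_mult using F(2)[of x] cutoff_bounds[of c x] c by (intro mult_mono) auto
      have 2: "\<bar>transport (cutoff c) x * F x\<bar> \<le> C * ((B + e) / \<beta>)"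
        unfolding abs_mult C_def using cutoff_gradient[OF c(1,2)] Fb[of x] speed_nonneg by (intro mult_mono) auto
      have 3: "C * ((B + e) / \<beta>) \<le> (B + e) / 2"
        using C B e by (simp add: \<beta>_def field_simps)
      have 4: "\<bar>(1 - cutoff c x) * h x\<bar> \<le> e"
      proof (cases "norm x \<le> r")
        case True
        then have "c * (norm x)^2 \<le> c * r^2" using c by (intro mult_left_mono power_mono) auto
        then have "1 - cutoff c x \<le> 1 / 12" using cutoff_near_1[of c x] c by linarith
        then have "\<bar>(1 - cutoff c x) * h x\<bar> \<le> 1 / 12 * B"
          unfolding abs_mult using B(2)[of x] cutoff_bounds[of c x] c by (intro mult_mono) auto
        then show ?thesis by (simp add: e_def)
      next
        case False
        then have "\<bar>(1 - cutoff c x) * h x\<bar> \<le> 1 * e"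
          unfolding abs_mult using r(2)[of x] cutoff_bounds[of c x] c by (intro mult_mono) auto
        then show ?thesis by simp
      qed
      have "\<bar>a - b - d\<bar> \<le> \<bar>a\<bar> + \<bar>b\<bar> + \<bar>d\<bar>" for a b d :: real by linarith
      from this[of "cutoff c x * (\<beta> * F x - generator l F x - h x)" "transport (cutoff c) x * F x"
          "(1 - cutoff c x) * h x"]
      have "\<bar>\<beta> * G x - generator lam G x - h x\<bar> \<le> 1 * e + (B + e) / 2 + e"
        unfolding eq using 1 2 3 4 by linarith
      then show ?thesis using B(1) by (simp add: e_def)
    qed
    ultimately show "\<exists>F\<in>C_c_infinity. \<forall>x. \<bar>\<beta> * F x - generator lam F x - h x\<bar> \<le> 3 / 4 * B" by blast
  next
    fix F assume F: "F \<in> (C_c_infinity :: ('a \<Rightarrow> real) set)"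
    show "(\<lambda>x. \<beta> * F x - generator lam F x) \<in> C_0"
      using C_0_lincomb[OF C_c_infinity_C_0[OF F] generator_C_0[OF lam(1) F], of \<beta> "-1"] by simp
  qed (simp_all add: generator_add algebra_simps)
  with \<beta> show thesis by (rule that)
qed

end

section \<open>Cores from density of the range\<close>

lemma gen_eq:
  assumes "generates P f h"
  shows "gen P f = h"
  unfolding gen_def
proof (rule the_equality)
  fix k assume "generates P f k"
  then have "uniform_limit UNIV (\<lambda>t z. (P t f z - f z) / t) k (at_right 0)"
    "uniform_limit UNIV (\<lambda>t z. (P t f z - f z) / t) h (at_right 0)"
    using assms by (auto simp: generates_def)
  then have "((\<lambda>t. (P t f z - f z) / t) \<longlongrightarrow> k z) (at_right 0)"
    "((\<lambda>t. (P t f z - f z) / t) \<longlongrightarrow> h z) (at_right 0)" for z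
    by (auto dest: tendsto_uniform_limitI)
  then show "k = h"
    by (intro ext tendsto_unique[OF trivial_limit_at_right_real])
qed (rule assms)

text \<open>
  A contraction family is dissipative at its generator: at a maximum of \<open>\<bar>u\<bar>\<close> the difference quotient
  has the sign opposite to \<open>u\<close>. This turns density of the range into approximation in the graph norm.
\<close>

lemma is_core_of_dense_range:
  fixes P :: "real \<Rightarrow> ('a::euclidean_space \<Rightarrow> real) \<Rightarrow> 'a \<Rightarrow> real"
  assumes bound: "\<And>t f B z. t > 0 \<Longrightarrow> f \<in> C_0 \<Longrightarrow> (\<And>x. \<bar>f x\<bar> \<le> B) \<Longrightarrow> \<bar>P t f z\<bar> \<le> B"
    and lin: "\<And>t f h z. t > 0 \<Longrightarrow> f \<in> C_0 \<Longrightarrow> h \<in> C_0 \<Longrightarrow> P t (\<lambda>x. f x - h x) z = P t f z - P t h z"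
    and gen: "\<And>F. F \<in> C_c_infinity \<Longrightarrow> generates P F (A F)"
    and \<beta>: "\<beta> > 0" and dense: "dense_range (\<lambda>F x. \<beta> * F x - A F x)"
  shows "is_core P C_c_infinity"
proof -
  \<comment> \<open>Dissipativity, in the form of an estimate of u by its image under \<beta> minus the generator.\<close>
  have diss: "\<bar>u x\<bar> \<le> e / \<beta>" if u: "generates P u k" and e: "\<And>x. \<bar>\<beta> * u x - k x\<bar> \<le> e" for u k e x
  proof -
    have u0: "u \<in> C_0" and lim: "uniform_limit UNIV (\<lambda>t z. (P t u z - u z) / t) k (at_right 0)"
      using u by (auto simp: generates_def)
    obtain y where y: "\<And>z. \<bar>u z\<bar> \<le> \<bar>u y\<bar>" using C_0_attains_max_abs[OF u0] by metis
    have lim: "((\<lambda>t. (P t u y - u y) / t) \<longlongrightarrow> k y) (at_right 0)"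
      using tendsto_uniform_limitI[OF lim] by simp
    have pos: "\<forall>\<^sub>F t in at_right 0. (t::real) > 0" by (simp add: eventually_at_filter)
    have "\<beta> * \<bar>u y\<bar> \<le> e"
    proof (cases "u y \<ge> 0")
      case True
      have "k y \<le> 0"
      proof (rule tendsto_upperbound[OF lim])
        show "\<forall>\<^sub>F t in at_right 0. (P t u y - u y) / t \<le> 0"
          using pos
        proof eventually_elim
          case (elim t)
          then show ?case using bound[OF elim u0 y, of y] True by (simp add: divide_nonpos_pos)
        qed
      qed simp
      with e[of y] True show ?thesis by simp
    next
      case False
      have "k y \<ge> 0"
      proof (rule tendsto_lowerbound[OF lim])
        show "\<forall>\<^sub>F t in at_right 0. 0 \<le> (P t u y - u y) / t"
          using pos
        proof eventually_elim
          case (elim t)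
          then show ?case using bound[OF elim u0 y, of y] False by simp
        qed
      qed simp
      with e[of y] False show ?thesis by simp
    qed
    then have "\<bar>u y\<bar> \<le> e / \<beta>" using \<beta> by (simp add: field_simps)
    with y[of x] show ?thesis by linarith
  qed
  have "\<exists>F :: nat \<Rightarrow> 'a \<Rightarrow> real. (\<forall>n. F n \<in> C_c_infinity) \<and> uniform_limit UNIV F f sequentially \<and>
      uniform_limit UNIV (\<lambda>n. gen P (F n)) (gen P f) sequentially" if f: "f \<in> gen_dom P" for f
  proof -
    obtain h where h: "generates P f h" using f by (auto simp: gen_dom_def)
    have f0: "f \<in> C_0" and h0: "h \<in> C_0" using h by (auto simp: generates_def)
    have "(\<lambda>x. \<beta> * f x - h x) \<in> C_0" using C_0_lincomb[OF f0 h0, of \<beta> "-1"] by simp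
    then have "\<exists>F\<in>C_c_infinity. \<forall>x. \<bar>\<beta> * F x - A F x - (\<beta> * f x - h x)\<bar> \<le> inverse (real (Suc n))" for n
      using dense unfolding dense_range_def by auto
    then obtain F where F: "\<And>n. F n \<in> C_c_infinity"
      "\<And>n x. \<bar>\<beta> * F n x - A (F n) x - (\<beta> * f x - h x)\<bar> \<le> inverse (real (Suc n))" by metis
    have F1: "\<bar>F n x - f x\<bar> \<le> inverse (real (Suc n)) / \<beta>" for n x
    proof (rule diss)
      have Fn0: "F n \<in> C_0" by (rule C_c_infinity_C_0[OF F(1)])
      have g: "generates P (F n) (A (F n))" by (rule gen[OF F(1)])
      have A0: "A (F n) \<in> C_0" using g by (simp add: generates_def)
      have "uniform_limit UNIV (\<lambda>t z. (P t (F n) z - F n z) / t - (P t f z - f z) / t) (\<lambda>x. A (F n) x - h x) (at_right 0)"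
        using g h by (intro uniform_limit_minus) (auto simp: generates_def)
      then have "uniform_limit UNIV (\<lambda>t z. (P t (\<lambda>x. F n x - f x) z - (F n z - f z)) / t) (\<lambda>x. A (F n) x - h x) (at_right 0)"
        by (rule uniform_limit_cong[THEN iffD1, rotated 2])
           (auto simp: eventually_at_filter lin Fn0 f0 diff_divide_distrib[symmetric] algebra_simps)
      moreover have "(\<lambda>x. F n x - f x) \<in> C_0" using C_0_lincomb[OF Fn0 f0, of 1 "-1"] by simp
      moreover have "(\<lambda>x. A (F n) x - h x) \<in> C_0" using C_0_lincomb[OF A0 h0, of 1 "-1"] by simp
      ultimately show "generates P (\<lambda>x. F n x - f x) (\<lambda>x. A (F n) x - h x)" by (simp add: generates_def)
      show "\<bar>\<beta> * (F n x - f x) - (A (F n) x - h x)\<bar> \<le> inverse (real (Suc n))" for x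
        using F(2)[of n x] by (simp add: algebra_simps)
    qed
    have F2: "\<bar>A (F n) x - h x\<bar> \<le> 2 * inverse (real (Suc n))" for n x
    proof -
      have "\<bar>\<beta> * (F n x - f x)\<bar> \<le> \<beta> * (inverse (real (Suc n)) / \<beta>)"
        unfolding abs_mult using F1[of n x] \<beta> by (intro mult_mono) auto
      also have "\<dots> = inverse (real (Suc n))" using \<beta> by simp
      finally have "\<bar>\<beta> * F n x - \<beta> * f x\<bar> \<le> inverse (real (Suc n))" by (simp add: algebra_simps)
      then show ?thesis using F(2)[of n x] by linarith
    qed
    have ul: "uniform_limit UNIV G k sequentially"
      if b: "\<And>n x. \<bar>G n x - k x\<bar> \<le> C * inverse (real (Suc n))" for G :: "nat \<Rightarrow> 'a \<Rightarrow> real" and k C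
    proof (rule uniform_limitI)
      fix e :: real assume "e > 0"
      have "(\<lambda>n. C * inverse (real (Suc n))) \<longlonglongrightarrow> C * 0"
        by (intro tendsto_intros LIMSEQ_inverse_real_of_nat)
      then have "\<forall>\<^sub>F n in sequentially. C * inverse (real (Suc n)) < e"
        using \<open>e > 0\<close> by (auto dest: order_tendstoD(2))
      then show "\<forall>\<^sub>F n in sequentially. \<forall>x\<in>UNIV. dist (G n x) (k x) < e"
        by eventually_elim (auto simp: dist_real_def intro: le_less_trans[OF b])
    qed
    have "uniform_limit UNIV F f sequentially"
      using F1 by (intro ul[where C="1 / \<beta>"]) (simp add: divide_inverse mult.commute)
    moreover have "uniform_limit UNIV (\<lambda>n. gen P (F n)) (gen P f) sequentially"
      unfolding gen_eq[OF h] gen_eq[OF gen[OF F(1)]] by (rule ul[OF F2])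
    ultimately show ?thesis using F(1) by blast
  qed
  moreover have "C_c_infinity \<subseteq> gen_dom P" using gen by (auto simp: gen_dom_def)
  ultimately show ?thesis by (simp add: is_core_def)
qed

section \<open>The process as a function of the noise sequence\<close>

lemma prob_space_unif01: "prob_space unif01"
  unfolding unif01_def by (rule prob_space_restrict_space) auto

text \<open>
  The two noise sequences are kept together as one sequence of pairs \<open>\<omega>\<close>, whose law is a product
  measure.
\<close>

locale lipschitz_pdmp = pdmp g \<phi> lam \<Xi> R W M U \<xi> + lipschitz_flow g \<phi> L
  for g :: "'a::euclidean_space \<Rightarrow> 'a" and \<phi> lam and \<Xi> :: "'s measure" and R W and M :: "'w measure" and U \<xi> L +
  assumes R_continuous: "s \<in> space \<Xi> \<Longrightarrow> continuous_on UNIV (R s)"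
begin

abbreviation noise :: "(real \<times> 's) measure" where "noise \<equiv> unif01 \<Otimes>\<^sub>M \<Xi>"

abbreviation noise_seq :: "(nat \<Rightarrow> real \<times> 's) measure" where "noise_seq \<equiv> \<Pi>\<^sub>M i\<in>(UNIV::nat set). noise"

sublocale unif: prob_space unif01 by (rule prob_space_unif01)

sublocale noise: prob_space noise
  by (rule prob_space_pair) unfold_locales

sublocale seq: sequence_space noise by unfold_locales

abbreviation chain :: "'a \<Rightarrow> (nat \<Rightarrow> real \<times> 's) \<Rightarrow> nat \<Rightarrow> ennreal \<times> 'a" where
  "chain z \<omega> \<equiv> jump_chain \<phi> R W z (\<lambda>k. fst (\<omega> k)) (\<lambda>k. snd (\<omega> k))"

abbreviation state :: "'a \<Rightarrow> (nat \<Rightarrow> real \<times> 's) \<Rightarrow> real \<Rightarrow> 'a" where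
  "state z \<omega> \<equiv> pdmp_process \<phi> R W z (\<lambda>k. fst (\<omega> k)) (\<lambda>k. snd (\<omega> k))"

abbreviation wait :: "'a \<Rightarrow> (nat \<Rightarrow> real \<times> 's) \<Rightarrow> ennreal" where
  "wait z \<omega> \<equiv> W z (fst (\<omega> 0))"

abbreviation restart :: "'a \<Rightarrow> (nat \<Rightarrow> real \<times> 's) \<Rightarrow> 'a" where
  "restart z \<omega> \<equiv> R (snd (\<omega> 0)) (\<phi> (enn2real (wait z \<omega>)) z)"

text \<open>
  \<open>jump_chain\<close> is defined by appending jumps at the end, whereas the renewal argument conditions on
  the first jump. After that jump the chain continues from \<open>restart z \<omega>\<close> with the shifted noise.
\<close>

lemma chain_Suc:
  "fst (chain z \<omega> (Suc n)) = wait z \<omega> + fst (chain (restart z \<omega>) (\<lambda>k. \<omega> (Suc k)) n) \<and>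
   snd (chain z \<omega> (Suc n)) = snd (chain (restart z \<omega>) (\<lambda>k. \<omega> (Suc k)) n)"
proof (induction n)
  case (Suc n)
  show ?case
    by (subst (1 3) jump_chain.simps(2), subst (1 2) jump_chain.simps(2))
       (simp add: split_beta Let_def Suc.IH add.assoc del: jump_chain.simps)
qed (simp add: split_beta Let_def)

lemma chain_mono: "incseq (\<lambda>n. fst (chain z \<omega> n))"
  by (rule incseq_SucI) (simp add: split_beta Let_def)

lemma state_eq:
  "state z \<omega> t = \<phi> (t - enn2real (fst (chain z \<omega> (Max {k. fst (chain z \<omega> k) \<le> ennreal t}))))
     (snd (chain z \<omega> (Max {k. fst (chain z \<omega> k) \<le> ennreal t})))"
  by (simp add: pdmp_process_def Let_def split_beta)

lemma state_before_jump:
  assumes "ennreal t < wait z \<omega>"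
  shows "state z \<omega> t = \<phi> t z"
proof -
  have "{k. fst (chain z \<omega> k) \<le> ennreal t} = {0}"
  proof safe
    fix k assume k: "fst (chain z \<omega> k) \<le> ennreal t"
    show "k = 0"
    proof (cases k)
      case (Suc n)
      have "wait z \<omega> \<le> fst (chain z \<omega> k)" unfolding Suc chain_Suc[THEN conjunct1] by simp
      with k assms show ?thesis by (metis leD order_trans)
    qed
  qed simp
  then show ?thesis by (simp add: state_eq)
qed

lemma ennreal_time_shift:
  assumes "w \<le> ennreal t" "t \<ge> 0"
  shows "w + T \<le> ennreal t \<longleftrightarrow> T \<le> ennreal (t - enn2real w)" "enn2real w \<le> t"
proof -
  obtain r where r: "w = ennreal r" "r \<ge> 0" using assms by (cases w) (auto simp: top_unique)
  show "enn2real w \<le> t" using assms r by simp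
  show "w + T \<le> ennreal t \<longleftrightarrow> T \<le> ennreal (t - enn2real w)"
    using assms r by (cases T) (auto simp: ennreal_plus[symmetric] top_unique simp del: ennreal_plus)
qed

text \<open>
  The premise on \<open>T_{n+1}\<close> makes the set of jump indices up to time \<open>t\<close> finite, so that its
  maximum is meaningful and shifts by one.
\<close>

lemma state_after_jump:
  assumes w: "wait z \<omega> \<le> ennreal t" and t: "t \<ge> 0" and n: "ennreal t < fst (chain z \<omega> (Suc n))"
  shows "state z \<omega> t = state (restart z \<omega>) (\<lambda>k. \<omega> (Suc k)) (t - enn2real (wait z \<omega>))"
proof -
  let ?T = "\<lambda>k. fst (chain z \<omega> k)" and ?T' = "\<lambda>k. fst (chain (restart z \<omega>) (\<lambda>k. \<omega> (Suc k)) k)"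
  define s where "s = t - enn2real (wait z \<omega>)"
  define A where "A = {k. ?T' k \<le> ennreal s}"
  have T: "?T (Suc k) = wait z \<omega> + ?T' k" for k using chain_Suc by blast
  have le: "?T (Suc k) \<le> ennreal t \<longleftrightarrow> ?T' k \<le> ennreal s" for k
    unfolding T s_def by (rule ennreal_time_shift(1)[OF w t])
  have eq: "{k. ?T k \<le> ennreal t} = insert 0 (Suc ` A)"
  proof (rule set_eqI)
    fix k show "k \<in> {k. ?T k \<le> ennreal t} \<longleftrightarrow> k \<in> insert 0 (Suc ` A)"
      using le by (cases k) (auto simp: A_def simp del: jump_chain.simps(2))
  qed
  have "A \<subseteq> {..<n}"
  proof
    fix k assume "k \<in> A"
    then have "?T (Suc k) \<le> ennreal t" using le by (simp add: A_def)
    from this n have "?T (Suc k) < ?T (Suc n)" by (rule le_less_trans)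
    then have "\<not> Suc n \<le> Suc k" using incseqD[OF chain_mono[of z \<omega>]] leD by blast
    then show "k \<in> {..<n}" by simp
  qed
  then have fin: "finite A" by (rule finite_subset) simp
  have "0 \<in> A" by (simp add: A_def)
  then have ne: "A \<noteq> {}" by blast
  have Max: "Max {k. ?T k \<le> ennreal t} = Suc (Max A)"
    unfolding eq using fin ne mono_Max_commute[OF _ fin ne, of Suc]
    by (simp add: mono_Suc)
  have "?T' (Max A) \<le> ennreal s" using Max_in[OF fin ne] by (simp add: A_def)
  then have fin': "?T' (Max A) < \<infinity>" by (rule le_less_trans) simp
  have "wait z \<omega> < \<infinity>" by (rule le_less_trans[OF w]) simp
  with fin' have "enn2real (wait z \<omega> + ?T' (Max A)) = enn2real (wait z \<omega>) + enn2real (?T' (Max A))"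
    by (simp add: enn2real_plus)
  then show ?thesis
    unfolding state_eq[of z] state_eq[of "restart z \<omega>"] Max T chain_Suc[THEN conjunct2]
    by (simp add: A_def s_def algebra_simps)
qed

text \<open>
  The random variable \<open>f(Z_t)\<close> on the event \<open>T_n > t\<close> and 0 elsewhere, unfolded from the first jump
  (\<open>payoff_eq\<close>). The term \<open>max 0 t\<close> only serves joint measurability in \<open>t\<close>, as the flow is
  specified for nonnegative times.
\<close>

primrec payoff :: "('a \<Rightarrow> real) \<Rightarrow> nat \<Rightarrow> 'a \<Rightarrow> real \<Rightarrow> (nat \<Rightarrow> real \<times> 's) \<Rightarrow> real" where
  "payoff f 0 z t \<omega> = 0"
| "payoff f (Suc n) z t \<omega> = (if ennreal t < wait z \<omega> then f (\<phi> (max 0 t) z)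
     else payoff f n (restart z \<omega>) (t - enn2real (wait z \<omega>)) (\<lambda>k. \<omega> (Suc k)))"

lemma payoff_eq:
  "t \<ge> 0 \<Longrightarrow> payoff f n z t \<omega> = (if ennreal t < fst (chain z \<omega> n) then f (state z \<omega> t) else 0)"
proof (induction n arbitrary: z t \<omega>)
  case (Suc n)
  show ?case
  proof (cases "ennreal t < wait z \<omega>")
    case True
    then have "ennreal t < fst (chain z \<omega> (Suc n))"
      unfolding chain_Suc[THEN conjunct1] by (rule less_le_trans) simp
    with True Suc.prems show ?thesis by (simp add: state_before_jump max_def del: jump_chain.simps)
  next
    case False
    then have w: "wait z \<omega> \<le> ennreal t" by simp
    note shift = ennreal_time_shift[OF w Suc.prems]
    have iff: "ennreal t < fst (chain z \<omega> (Suc n)) \<longleftrightarrow>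
        ennreal (t - enn2real (wait z \<omega>)) < fst (chain (restart z \<omega>) (\<lambda>k. \<omega> (Suc k)) n)"
      unfolding chain_Suc[THEN conjunct1] using shift(1) by (simp add: not_le[symmetric])
    show ?thesis
      using False shift(2) Suc.IH[of "t - enn2real (wait z \<omega>)" "restart z \<omega>" "\<lambda>k. \<omega> (Suc k)"] iff
        state_after_jump[of z \<omega> t n, OF w Suc.prems]
      by (auto simp del: jump_chain.simps)
  qed
qed simp

lemma payoff_bound: "(\<And>x. \<bar>f x\<bar> \<le> B) \<Longrightarrow> \<bar>payoff f n z t \<omega>\<bar> \<le> B"
proof (induction n arbitrary: z t \<omega>)
  case 0
  show ?case using 0[of z] by simp
qed auto

subsection \<open>Measurability\<close>

lemma flow_measurable [measurable]: "(\<lambda>(t, z). \<phi> (max 0 t) z) \<in> borel \<Otimes>\<^sub>M borel \<rightarrow>\<^sub>M borel"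
  using borel_measurable_continuous_onI[OF flow_continuous] by (simp add: borel_prod)

lemma flow_measurable_pos:
  assumes [measurable]: "u \<in> N \<rightarrow>\<^sub>M borel" "v \<in> N \<rightarrow>\<^sub>M borel" and "\<And>x. u x \<ge> 0"
  shows "(\<lambda>x. \<phi> (u x) (v x)) \<in> N \<rightarrow>\<^sub>M borel"
proof -
  have "(\<lambda>x. (\<lambda>(t, z). \<phi> (max 0 t) z) (u x, v x)) \<in> N \<rightarrow>\<^sub>M borel" by measurable
  then show ?thesis using assms(3) by (simp add: max_def)
qed

lemma W_measurable' [measurable (raw)]:
  assumes [measurable]: "u \<in> N \<rightarrow>\<^sub>M borel" "v \<in> N \<rightarrow>\<^sub>M unif01"
  shows "(\<lambda>x. W (u x) (v x)) \<in> N \<rightarrow>\<^sub>M borel"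
proof -
  have "(\<lambda>x. (\<lambda>(z, u). W z u) (u x, v x)) \<in> N \<rightarrow>\<^sub>M borel"
    by (rule measurable_compose[OF _ W_measurable]) measurable
  then show ?thesis by simp
qed

lemma R_measurable' [measurable (raw)]:
  assumes [measurable]: "u \<in> N \<rightarrow>\<^sub>M borel" "v \<in> N \<rightarrow>\<^sub>M \<Xi>"
  shows "(\<lambda>x. R (v x) (u x)) \<in> N \<rightarrow>\<^sub>M borel"
proof -
  have "(\<lambda>x. (\<lambda>(z, s). R s z) (u x, v x)) \<in> N \<rightarrow>\<^sub>M borel"
    by (rule measurable_compose[OF _ R_measurable]) measurable
  then show ?thesis by simp
qed

lemma shift_measurable [measurable]: "(\<lambda>\<omega> k. \<omega> (Suc k)) \<in> noise_seq \<rightarrow>\<^sub>M noise_seq"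
  by (rule measurable_PiM_single') (auto simp: space_PiM PiE_iff)

lemma payoff_measurable:
  assumes [measurable]: "f \<in> borel_measurable borel"
  shows "(\<lambda>(z, t, \<omega>). payoff f n z t \<omega>) \<in> borel_measurable (borel \<Otimes>\<^sub>M borel \<Otimes>\<^sub>M noise_seq)"
proof (induction n)
  case (Suc n)
  have [measurable]: "(\<lambda>p. wait (fst p) (snd (snd p))) \<in> borel \<Otimes>\<^sub>M borel \<Otimes>\<^sub>M noise_seq \<rightarrow>\<^sub>M borel"
    by measurable
  have [measurable]: "(\<lambda>p. \<phi> (enn2real (wait (fst p) (snd (snd p)))) (fst p)) \<in>
      (borel \<Otimes>\<^sub>M (borel :: real measure) \<Otimes>\<^sub>M noise_seq) \<rightarrow>\<^sub>M borel"
    by (rule flow_measurable_pos; (simp; fail)?; measurable?)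
  have [measurable]: "(\<lambda>p. restart (fst p) (snd (snd p))) \<in>
      (borel \<Otimes>\<^sub>M (borel :: real measure) \<Otimes>\<^sub>M noise_seq) \<rightarrow>\<^sub>M borel"
    by measurable
  have [measurable]: "(\<lambda>p. \<phi> (max 0 (fst (snd p))) (fst p)) \<in>
      (borel \<Otimes>\<^sub>M (borel :: real measure) \<Otimes>\<^sub>M noise_seq) \<rightarrow>\<^sub>M borel"
    by (rule flow_measurable_pos; (simp; fail)?; measurable?)
  have [measurable]: "(\<lambda>p k. snd (snd p) (Suc k)) \<in> (borel :: 'a measure) \<Otimes>\<^sub>M (borel :: real measure) \<Otimes>\<^sub>M noise_seq \<rightarrow>\<^sub>M noise_seq"
    by (rule measurable_compose[OF _ shift_measurable]) measurable
  have [measurable]: "(\<lambda>p. payoff f n (restart (fst p) (snd (snd p)))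
      (fst (snd p) - enn2real (wait (fst p) (snd (snd p)))) (\<lambda>k. snd (snd p) (Suc k))) \<in>
      borel_measurable (borel \<Otimes>\<^sub>M borel \<Otimes>\<^sub>M noise_seq)"
    using measurable_compose[OF _ Suc.IH, of "\<lambda>p. (restart (fst p) (snd (snd p)),
      fst (snd p) - enn2real (wait (fst p) (snd (snd p))), \<lambda>k. snd (snd p) (Suc k))"]
    by simp
  show ?case
    unfolding split_beta payoff.simps by measurable
qed simp

lemma chain_measurable:
  "(\<lambda>\<omega>. fst (chain z \<omega> n)) \<in> noise_seq \<rightarrow>\<^sub>M borel" (is ?T)
  "(\<lambda>\<omega>. snd (chain z \<omega> n)) \<in> noise_seq \<rightarrow>\<^sub>M borel" (is ?Y)
proof -
  have "?T \<and> ?Y"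
  proof (induction n)
    case (Suc n)
    then have [measurable]: "(\<lambda>\<omega>. fst (chain z \<omega> n)) \<in> noise_seq \<rightarrow>\<^sub>M borel"
      "(\<lambda>\<omega>. snd (chain z \<omega> n)) \<in> noise_seq \<rightarrow>\<^sub>M borel" by auto
    have [measurable]: "(\<lambda>\<omega>. W (snd (chain z \<omega> n)) (fst (\<omega> n))) \<in> noise_seq \<rightarrow>\<^sub>M borel" by measurable
    have [measurable]: "(\<lambda>\<omega>. \<phi> (enn2real (W (snd (chain z \<omega> n)) (fst (\<omega> n)))) (snd (chain z \<omega> n))) \<in> noise_seq \<rightarrow>\<^sub>M borel"
      by (rule flow_measurable_pos; (simp; fail)?; measurable?)
    show ?case by (simp add: split_beta Let_def)
  qed simp
  then show ?T ?Y by auto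
qed

text \<open>
  Also when infinitely many jumps occur up to time \<open>t\<close>, the unspecified maximum is an index whose
  jump time is at most \<open>t\<close>, because then all jump times are.
\<close>

lemma state_time_nonneg:
  assumes "t \<ge> 0"
  shows "enn2real (fst (chain z \<omega> (Max {k. fst (chain z \<omega> k) \<le> ennreal t}))) \<le> t"
proof -
  let ?A = "{k. fst (chain z \<omega> k) \<le> ennreal t}"
  have "fst (chain z \<omega> (Max ?A)) \<le> ennreal t"
  proof (cases "finite ?A")
    case True
    have "0 \<in> ?A" by simp
    with True have "Max ?A \<in> ?A" using Max_in[of ?A] by blast
    then show ?thesis by simp
  next
    case False
    then obtain k where "k \<ge> Max ?A" "k \<in> ?A"
      by (meson infinite_nat_iff_unbounded_le)
    then show ?thesis using incseqD[OF chain_mono[of z \<omega>], of "Max ?A" k] by simp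
  qed
  then have "enn2real (fst (chain z \<omega> (Max ?A))) \<le> enn2real (ennreal t)"
    by (rule enn2real_mono) simp
  with assms show ?thesis by simp
qed

text \<open>
  The number of the last jump takes countably many values, and for each of them the state is an
  explicit function of the chain.
\<close>

lemma state_measurable:
  assumes t: "t \<ge> 0"
  shows "(\<lambda>\<omega>. state z \<omega> t) \<in> noise_seq \<rightarrow>\<^sub>M borel"
proof -
  note [measurable] = chain_measurable
  have [measurable]: "(\<lambda>\<omega>. Max {k. fst (chain z \<omega> k) \<le> ennreal t}) \<in> noise_seq \<rightarrow>\<^sub>M count_space UNIV"
    by measurable
  have "(\<lambda>\<omega>. \<phi> (max 0 (t - enn2real (fst (chain z \<omega> n)))) (snd (chain z \<omega> n))) \<in> noise_seq \<rightarrow>\<^sub>M borel" for n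
    by (rule flow_measurable_pos; (simp; fail)?; measurable?)
  then have "(\<lambda>\<omega>. (\<lambda>n \<omega>. \<phi> (max 0 (t - enn2real (fst (chain z \<omega> n)))) (snd (chain z \<omega> n)))
      (Max {k. fst (chain z \<omega> k) \<le> ennreal t}) \<omega>) \<in> noise_seq \<rightarrow>\<^sub>M borel"
    by (rule measurable_compose_countable) measurable
  then show ?thesis
    using state_time_nonneg[OF t] by (simp add: state_eq max_def)
qed

lemma noise_seq_distr:
  "(\<lambda>\<omega> k. (U k \<omega>, \<xi> k \<omega>)) \<in> M \<rightarrow>\<^sub>M noise_seq"
  "distr M noise_seq (\<lambda>\<omega> k. (U k \<omega>, \<xi> k \<omega>)) = noise_seq"
proof -
  have rv: "random_variable noise (\<lambda>\<omega>. (U k \<omega>, \<xi> k \<omega>))" for k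
    using noise_indep unfolding indep_vars_def2 by blast
  then show "(\<lambda>\<omega> k. (U k \<omega>, \<xi> k \<omega>)) \<in> M \<rightarrow>\<^sub>M noise_seq"
  proof (intro measurable_PiM_single' Pi_I)
    fix \<omega> assume "\<omega> \<in> space M"
    then have "(U k \<omega>, \<xi> k \<omega>) \<in> space noise" for k by (rule measurable_space[OF rv])
    then show "(\<lambda>k. (U k \<omega>, \<xi> k \<omega>)) \<in> (\<Pi>\<^sub>E k\<in>UNIV. space noise)"
      unfolding PiE_iff extensional_UNIV by blast
  qed (rule rv)
  have "distr M noise_seq (\<lambda>x. \<lambda>i\<in>UNIV. (U i x, \<xi> i x)) = (\<Pi>\<^sub>M i\<in>UNIV. distr M noise (\<lambda>\<omega>. (U i \<omega>, \<xi> i \<omega>)))"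
    by (rule indep_vars_iff_distr_eq_PiM[THEN iffD1, OF _ rv noise_indep]) simp
  then show "distr M noise_seq (\<lambda>\<omega> k. (U k \<omega>, \<xi> k \<omega>)) = noise_seq"
    by (simp only: noise_law restrict_UNIV)
qed

lemma semigroup_eq:
  assumes t: "t \<ge> 0" and [measurable]: "f \<in> borel_measurable borel"
  shows "pdmp_semigroup \<phi> R W M U \<xi> t f z = (\<integral>\<omega>. f (state z \<omega> t) \<partial>noise_seq)"
proof -
  have [measurable]: "(\<lambda>\<omega>. f (state z \<omega> t)) \<in> borel_measurable noise_seq"
    by (rule measurable_compose[OF state_measurable[OF t]]) measurable
  have "(\<integral>\<omega>. f (state z \<omega> t) \<partial>noise_seq) = (\<integral>\<omega>. f (state z \<omega> t) \<partial>distr M noise_seq (\<lambda>\<omega> k. (U k \<omega>, \<xi> k \<omega>)))"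
    by (simp add: noise_seq_distr)
  also have "\<dots> = pdmp_semigroup \<phi> R W M U \<xi> t f z"
    unfolding pdmp_semigroup_def by (subst integral_distr[OF noise_seq_distr(1)]) auto
  finally show ?thesis by simp
qed

end

section \<open>Renewal equation\<close>

lemma (in prob_space) abs_integral_le:
  fixes f :: "'a \<Rightarrow> real"
  assumes "\<And>x. x \<in> space M \<Longrightarrow> \<bar>f x\<bar> \<le> B" "B \<ge> 0"
  shows "\<bar>\<integral>x. f x \<partial>M\<bar> \<le> B"
proof -
  have "\<bar>\<integral>x. f x \<partial>M\<bar> \<le> (\<integral>x. \<bar>f x\<bar> \<partial>M)" by (rule integral_abs_bound)
  also have "\<dots> \<le> (\<integral>x. B \<partial>M)" by (rule integral_mono') (use assms in auto)
  finally show ?thesis by (simp add: prob_space)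
qed

context lipschitz_pdmp
begin

text \<open>
  The intensity met at time \<open>s\<close> on the trajectory without jumps from \<open>z\<close>, extended constantly to negative
  times so that it is continuous on the whole line.
\<close>

definition rate :: "'a \<Rightarrow> real \<Rightarrow> real" where
  "rate z s = lam (\<phi> (max 0 s) z)"

definition survival :: "'a \<Rightarrow> real \<Rightarrow> real" where
  "survival z t = exp (- integral {0..max 0 t} (rate z))"

text \<open>
  The density on the half line of the waiting time from \<open>z\<close>; it is minus the derivative of
  \<open>survival z\<close>.
\<close>

definition jump_density :: "'a \<Rightarrow> real \<Rightarrow> real" where
  "jump_density z s = rate z s * survival z s"

lemma rate_continuous: "continuous_on UNIV (\<lambda>(s, z). rate z s)"
  unfolding rate_def split_beta
  by (intro continuous_on_compose2[OF lam_continuous] flow_continuous_compose continuous_intros) auto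

lemma rate_continuous_compose:
  assumes "continuous_on A u" "continuous_on A v"
  shows "continuous_on A (\<lambda>x. rate (v x) (u x))"
  using continuous_on_compose2[OF rate_continuous continuous_on_Pair[OF assms]] by simp

lemma rate_nonneg: "rate z s \<ge> 0"
  by (simp add: rate_def lam_nonneg)

lemma survival_continuous: "continuous_on UNIV (survival z)"
proof -
  have "continuous_on {0..} (\<lambda>t. integral {0..t} (rate z))"
    using antiderivative_from_0[OF continuous_on_subset[OF rate_continuous_compose[of UNIV "\<lambda>s. s" "\<lambda>_. z"]]]
    by (intro DERIV_continuous_on[where D="rate z"]) auto
  then have "continuous_on UNIV (\<lambda>t. integral {0..max 0 t} (rate z))"
    by (rule continuous_on_compose2) (auto intro!: continuous_intros)
  then show ?thesis unfolding survival_def by (intro continuous_intros)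
qed

lemma survival_derivative:
  assumes "t \<ge> 0"
  shows "(survival z has_real_derivative - jump_density z t) (at t within {0..})"
proof -
  have "((\<lambda>t. integral {0..t} (rate z)) has_real_derivative rate z t) (at t within {0..})"
    by (rule antiderivative_from_0[OF _ assms]) (intro rate_continuous_compose continuous_intros)
  then have "((\<lambda>t. exp (- integral {0..t} (rate z))) has_real_derivative
      exp (- integral {0..t} (rate z)) * (- rate z t)) (at t within {0..})"
    by (auto intro!: derivative_eq_intros)
  then have "(survival z has_real_derivative exp (- integral {0..t} (rate z)) * (- rate z t)) (at t within {0..})"
    by (rule has_field_derivative_transform_within[where d=1]) (use assms in \<open>auto simp: survival_def max_def\<close>)
  then show ?thesis using assms by (simp add: jump_density_def survival_def max_def mult.commute)
qed

lemma survival_0 [simp]: "survival z 0 = 1"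
  by (simp add: survival_def)

lemma survival_bounds: "0 < survival z t" "survival z t \<le> 1"
proof -
  have "integral {0..max 0 t} (rate z) \<ge> 0"
    by (intro integral_nonneg integrable_continuous_interval rate_continuous_compose continuous_intros)
       (auto simp: rate_nonneg)
  then show "0 < survival z t" "survival z t \<le> 1" by (auto simp: survival_def)
qed

lemma jump_density_continuous: "continuous_on UNIV (jump_density z)"
  unfolding jump_density_def by (intro continuous_intros rate_continuous_compose survival_continuous)

lemma jump_density_bounds: "0 \<le> jump_density z s" "jump_density z s \<le> rate z s"
  using survival_bounds[of z s] rate_nonneg[of z s] by (auto simp: jump_density_def mult_left_le)

lemma jump_density_integral:
  assumes "0 \<le> t"
  shows "(\<integral>s. indicator {0..t} s * jump_density z s \<partial>lborel) = 1 - survival z t"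
proof -
  have "integral\<^sup>L lborel (\<lambda>s. indicator {0..t} s *\<^sub>R jump_density z s) = - survival z t - (- survival z 0)"
  proof (rule integral_FTC_atLeastAtMost[OF assms])
    fix s assume "0 \<le> s" "s \<le> t"
    then have "((\<lambda>s. - survival z s) has_real_derivative jump_density z s) (at s within {0..t})"
      using has_field_derivative_subset[OF survival_derivative[of s z], of "{0..t}"]
      by (auto intro!: derivative_eq_intros)
    then show "((\<lambda>s. - survival z s) has_vector_derivative jump_density z s) (at s within {0..t})"
      by (simp add: has_real_derivative_iff_has_vector_derivative)
  qed (rule continuous_on_subset[OF jump_density_continuous], simp)
  then show ?thesis by simp
qed

lemma jump_density_integrable:
  assumes [measurable]: "K \<in> borel_measurable borel" and K: "\<And>s. \<bar>K s\<bar> \<le> B"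
  shows "integrable lborel (\<lambda>s. indicator {0..t} s * (jump_density z s * K s))"
proof (rule Bochner_Integration.integrable_bound)
  have [measurable]: "jump_density z \<in> borel_measurable borel"
    by (rule borel_measurable_continuous_onI[OF jump_density_continuous])
  have "integrable lborel (\<lambda>s. indicator {0..t} s *\<^sub>R jump_density z s)"
    by (rule borel_integrable_compact) (auto intro: continuous_on_subset[OF jump_density_continuous])
  then show "integrable lborel (\<lambda>s. (indicator {0..t} s * jump_density z s) * B)" by simp
  show "(\<lambda>s. indicator {0..t} s * (jump_density z s * K s)) \<in> borel_measurable lborel" by measurable
  have "B \<ge> 0" using K[of 0] by linarith
  then show "AE s in lborel. norm (indicator {0..t} s * (jump_density z s * K s)) \<le> norm ((indicator {0..t} s * jump_density z s) * B)"
    using K jump_density_bounds(1)[of z] by (auto simp: abs_mult mult.assoc intro!: mult_left_mono)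
qed

lemma wait_measurable [measurable]: "W z \<in> unif01 \<rightarrow>\<^sub>M borel"
  by measurable

text \<open>
  The waiting law prescribes the probability of \<open>{t..}\<close>. That of \<open>{t<..}\<close> is the same, since it is
  the limit of the probabilities of \<open>{t + 1/n..}\<close> and the survival function is continuous.
\<close>

lemma survival_eq_prob:
  assumes t: "t \<ge> 0"
  shows "measure unif01 {u \<in> space unif01. ennreal t < W z u} = survival z t"
proof -
  let ?m = "distr unif01 borel (W z)"
  interpret m: prob_space ?m by (rule unif.prob_space_distr) measurable
  have tail: "measure ?m {ennreal t..} = survival z t" if "t \<ge> 0" for t
  proof -
    have "integral {0..t} (\<lambda>s. lam (\<phi> s z)) = integral {0..t} (rate z)"
      by (rule Henstock_Kurzweil_Integration.integral_cong) (simp add: rate_def)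
    with W_law[of z] that show ?thesis by (auto simp: is_waiting_law_def survival_def)
  qed
  define e where "e n = t + inverse (real (Suc n))" for n
  have e: "e \<longlonglongrightarrow> t" unfolding e_def
    using tendsto_add[OF tendsto_const LIMSEQ_inverse_real_of_nat, of t] by simp
  have "(\<lambda>n. measure ?m {ennreal (e n)..}) \<longlonglongrightarrow> measure ?m (\<Union>n. {ennreal (e n)..})"
  proof (rule m.finite_Lim_measure_incseq)
    show "incseq (\<lambda>n. {ennreal (e n)..})"
      unfolding e_def using t
      by (auto simp: incseq_def intro!: order_trans[OF ennreal_leI] le_imp_inverse_le)
  qed auto
  also have "(\<Union>n. {ennreal (e n)..}) = {ennreal t<..}"
  proof safe
    fix w n assume "ennreal (e n) \<le> w"
    moreover have "ennreal t < ennreal (e n)" using t by (intro ennreal_lessI) (auto simp: e_def intro: add_nonneg_pos)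
    ultimately show "ennreal t < w" by (rule less_le_trans[rotated])
  next
    fix w assume w: "ennreal t < w"
    show "w \<in> (\<Union>n. {ennreal (e n)..})"
    proof (cases w)
      case (real r)
      with w t have "t < r" by (simp add: ennreal_less_iff)
      with order_tendstoD(2)[OF e] obtain n where "e n < r" by (auto simp: eventually_sequentially)
      then show ?thesis using real by (auto intro!: exI[of _ n] ennreal_leI)
    qed auto
  qed
  also have "(\<lambda>n. measure ?m {ennreal (e n)..}) = (\<lambda>n. survival z (e n))"
    using t by (intro ext tail) (simp add: e_def)
  finally have "(\<lambda>n. survival z (e n)) \<longlonglongrightarrow> measure ?m {ennreal t<..}" .
  moreover have "(\<lambda>n. survival z (e n)) \<longlonglongrightarrow> survival z t"
    using survival_continuous[of z] by (intro continuous_on_tendsto_compose[OF _ e]) auto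
  ultimately have "measure ?m {ennreal t<..} = survival z t" by (rule LIMSEQ_unique)
  then show ?thesis
    by (subst (asm) measure_distr) (auto simp: vimage_def Int_def conj_commute)
qed

text \<open>
  The waiting time restricted to \<open>[0, t]\<close> has density \<open>jump_density z\<close>: both measures have the same
  distribution function, on the one side by \<open>survival_eq_prob\<close>, on the other by the fundamental
  theorem of calculus.
\<close>

lemma wait_integral:
  assumes t: "t \<ge> 0" and K [measurable]: "K \<in> borel_measurable borel" and B: "\<And>s. \<bar>K s\<bar> \<le> B"
  shows "(\<integral>u. (if ennreal t < W z u then c else K (enn2real (W z u))) \<partial>unif01) =
    survival z t * c + (\<integral>s. indicator {0..t} s * (jump_density z s * K s) \<partial>lborel)"
proof -
  define k where "k u = (if W z u \<le> ennreal t then 1 else 0 :: real)" for u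
  have k [measurable]: "k \<in> borel_measurable unif01" unfolding k_def by measurable
  have int_if: "(\<integral>u. (if P u then 1 else 0 :: real) \<partial>unif01) = measure unif01 {u \<in> space unif01. P u}" for P
  proof -
    have "(\<lambda>u. if P u then 1 else 0 :: real) = indicator {u. P u}" by (auto simp: indicator_def)
    then show ?thesis by (simp add: Int_def conj_commute)
  qed
  have [measurable]: "jump_density z \<in> borel_measurable borel"
    by (rule borel_measurable_continuous_onI[OF jump_density_continuous])
  have wm: "(\<lambda>u. enn2real (W z u)) \<in> unif01 \<rightarrow>\<^sub>M borel" by measurable
  define m1 where "m1 = distr (density unif01 (\<lambda>u. ennreal (k u))) borel (\<lambda>u. enn2real (W z u))"
  define d where "d s = indicator {0..t} s * jump_density z s" for s
  have d0: "d s \<ge> 0" for s using jump_density_bounds(1) by (simp add: d_def)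
  have [measurable]: "d \<in> borel_measurable borel" unfolding d_def by measurable
  have d_int: "integrable lborel d"
    unfolding d_def using jump_density_integrable[of "\<lambda>_. 1" 1 t z] by simp
  define m2 where "m2 = density lborel (\<lambda>s. ennreal (d s))"
  have int1: "(\<integral>s. h s \<partial>m1) = (\<integral>u. k u * h (enn2real (W z u)) \<partial>unif01)" if [measurable]: "h \<in> borel_measurable borel" for h :: "real \<Rightarrow> real"
  proof -
    have "(\<integral>s. h s \<partial>m1) = (\<integral>u. h (enn2real (W z u)) \<partial>density unif01 (\<lambda>u. ennreal (k u)))"
      unfolding m1_def by (rule integral_distr) (use wm that in simp_all)
    also have "\<dots> = (\<integral>u. k u *\<^sub>R h (enn2real (W z u)) \<partial>unif01)"
      by (rule integral_density) (use measurable_compose[OF wm that] k in \<open>simp_all add: k_def\<close>)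
    finally show ?thesis by simp
  qed
  have int2: "(\<integral>s. h s \<partial>m2) = (\<integral>s. d s * h s \<partial>lborel)" if [measurable]: "h \<in> borel_measurable borel" for h :: "real \<Rightarrow> real"
  proof -
    have "(\<integral>s. h s \<partial>m2) = (\<integral>s. d s *\<^sub>R h s \<partial>lborel)"
      unfolding m2_def by (rule integral_density) (simp_all add: d0)
    then show ?thesis by simp
  qed
  have sets: "sets m1 = sets borel" "sets m2 = sets borel" by (auto simp: m1_def m2_def)
  have "m1 = m2"
  proof (rule cdf_unique')
    have "finite_measure m1"
    proof
      have "emeasure m1 (space m1) = (\<integral>\<^sup>+u. ennreal (k u) \<partial>unif01)"
        unfolding m1_def by (simp add: emeasure_distr emeasure_density)
      also have "\<dots> \<le> (\<integral>\<^sup>+u. 1 \<partial>unif01)" by (intro nn_integral_mono) (simp add: k_def)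
      also have "\<dots> = 1" by (simp add: unif.emeasure_space_1)
      finally show "emeasure m1 (space m1) \<noteq> \<infinity>" by (auto simp: top_unique)
    qed
    then show "finite_borel_measure m1"
      using sets by (simp add: finite_borel_measure_def finite_borel_measure_axioms_def)
    have "finite_measure m2"
    proof
      have "emeasure m2 (space m2) = (\<integral>\<^sup>+s. ennreal (d s) \<partial>lborel)"
        unfolding m2_def by (simp add: emeasure_density)
      also have "\<dots> < \<infinity>" using d_int d0 by (simp add: nn_integral_eq_integral)
      finally show "emeasure m2 (space m2) \<noteq> \<infinity>" by simp
    qed
    then show "finite_borel_measure m2"
      using sets by (simp add: finite_borel_measure_def finite_borel_measure_axioms_def)
    show "cdf m1 = cdf m2"
    proof
      fix a :: real
      have sp: "space m1 = UNIV" "space m2 = UNIV" by (auto simp: m1_def m2_def)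
      have 1: "cdf m1 a = measure unif01 {u \<in> space unif01. W z u \<le> ennreal t \<and> enn2real (W z u) \<le> a}"
      proof -
        have "cdf m1 a = (\<integral>s. indicator {..a} s \<partial>m1)" by (simp add: cdf_def sp)
        also have "\<dots> = (\<integral>u. (if W z u \<le> ennreal t \<and> enn2real (W z u) \<le> a then 1 else 0) \<partial>unif01)"
          by (subst int1) (auto simp: k_def indicator_def intro!: Bochner_Integration.integral_cong)
        finally show ?thesis by (simp add: int_if)
      qed
      have 2: "cdf m2 a = (\<integral>s. indicator {0..min a t} s * jump_density z s \<partial>lborel)"
      proof -
        have "cdf m2 a = (\<integral>s. indicator {..a} s \<partial>m2)" by (simp add: cdf_def sp)
        also have "\<dots> = (\<integral>s. indicator {0..min a t} s * jump_density z s \<partial>lborel)"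
          by (subst int2) (auto simp: d_def indicator_def intro!: Bochner_Integration.integral_cong)
        finally show ?thesis .
      qed
      show "cdf m1 a = cdf m2 a"
      proof (cases "a \<ge> 0")
        case True
        then have "min a t \<ge> 0" using t by simp
        have "{u \<in> space unif01. W z u \<le> ennreal t \<and> enn2real (W z u) \<le> a} =
            space unif01 - {u \<in> space unif01. ennreal (min a t) < W z u}"
        proof -
          have "w \<le> ennreal t \<and> enn2real w \<le> a \<longleftrightarrow> \<not> ennreal (min a t) < w" for w :: ennreal
            using True t by (cases w) (auto simp: not_less top_unique min_def split: if_splits)
          then show ?thesis by auto
        qed
        then have "cdf m1 a = 1 - survival z (min a t)"
          using unif.prob_compl[of "{u \<in> space unif01. ennreal (min a t) < W z u}"]
            survival_eq_prob[OF \<open>min a t \<ge> 0\<close>, of z] by (simp add: 1)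
        then show ?thesis using jump_density_integral[OF \<open>min a t \<ge> 0\<close>, of z] by (simp add: 2)
      next
        case False
        then have "\<not> enn2real w \<le> a" for w using enn2real_nonneg[of w] by linarith
        with False show ?thesis by (simp add: 1 2)
      qed
    qed
  qed
  have "(\<integral>u. (if ennreal t < W z u then c else K (enn2real (W z u))) \<partial>unif01) =
      (\<integral>u. (if ennreal t < W z u then 1 else 0) * c + k u * K (enn2real (W z u)) \<partial>unif01)"
    by (intro Bochner_Integration.integral_cong) (auto simp: k_def)
  also have "\<dots> = (\<integral>u. (if ennreal t < W z u then 1 else 0) * c \<partial>unif01) + (\<integral>u. k u * K (enn2real (W z u)) \<partial>unif01)"
  proof (rule Bochner_Integration.integral_add)
    show "integrable unif01 (\<lambda>u. (if ennreal t < W z u then 1 else 0) * c)"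
      by (rule unif.integrable_const_bound[where B="\<bar>c\<bar>"]) auto
    have "\<bar>k u * K r\<bar> \<le> \<bar>B\<bar>" for u r using B[of r] by (auto simp: k_def)
    then show "integrable unif01 (\<lambda>u. k u * K (enn2real (W z u)))"
      by (intro unif.integrable_const_bound[where B="\<bar>B\<bar>"]) auto
  qed
  also have "(\<integral>u. (if ennreal t < W z u then 1 else 0) * c \<partial>unif01) = survival z t * c"
    using survival_eq_prob[OF t, of z] by (simp add: int_if del: if_distrib)
  also have "(\<integral>u. k u * K (enn2real (W z u)) \<partial>unif01) = (\<integral>s. d s * K s \<partial>lborel)"
    using int1[OF K] int2[OF K] \<open>m1 = m2\<close> by simp
  finally show ?thesis by (simp add: d_def mult.assoc)
qed

text \<open>
  The operator \<open>Q\<close> of the introduction.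
\<close>

definition jump_avg :: "('a \<Rightarrow> real) \<Rightarrow> 'a \<Rightarrow> real" where
  "jump_avg F z = (\<integral>x. F (R x z) \<partial>\<Xi>)"

text \<open>
  By \<open>payoff_eq\<close> this is the expectation of \<open>f(Z_t)\<close> on the event that fewer than \<open>n\<close> jumps
  have occurred up to time \<open>t\<close>.
\<close>

definition trunc :: "('a \<Rightarrow> real) \<Rightarrow> nat \<Rightarrow> 'a \<Rightarrow> real \<Rightarrow> real" where
  "trunc f n z t = (\<integral>\<omega>. payoff f n z t \<omega> \<partial>noise_seq)"

lemma payoff_measurable':
  assumes "f \<in> borel_measurable borel" "u \<in> N \<rightarrow>\<^sub>M borel" "v \<in> N \<rightarrow>\<^sub>M borel" "w \<in> N \<rightarrow>\<^sub>M noise_seq"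
  shows "(\<lambda>x. payoff f n (u x) (v x) (w x)) \<in> borel_measurable N"
proof -
  note [measurable] = assms
  show ?thesis
    using measurable_compose[OF _ payoff_measurable[OF assms(1), of n], of "\<lambda>x. (u x, v x, w x)" N] by simp
qed

lemma trunc_measurable:
  assumes "f \<in> borel_measurable borel" "u \<in> N \<rightarrow>\<^sub>M borel" "v \<in> N \<rightarrow>\<^sub>M borel"
  shows "(\<lambda>x. trunc f n (u x) (v x)) \<in> borel_measurable N"
  unfolding trunc_def
proof (rule seq.borel_measurable_lebesgue_integral)
  note [measurable] = assms(2,3)
  show "(\<lambda>(x, \<omega>). payoff f n (u x) (v x) \<omega>) \<in> borel_measurable (N \<Otimes>\<^sub>M noise_seq)"
    unfolding split_beta' by (rule payoff_measurable'[OF assms(1)]) measurable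
qed

lemma payoff_integrable:
  assumes "f \<in> borel_measurable borel" "\<And>x. \<bar>f x\<bar> \<le> B"
  shows "integrable noise_seq (payoff f n z t)"
  by (rule seq.integrable_const_bound[where B=B])
     (auto intro!: AE_I2 payoff_bound[OF assms(2)] payoff_measurable' assms(1))

lemma trunc_bound:
  assumes f: "\<And>x. \<bar>f x\<bar> \<le> B"
  shows "\<bar>trunc f n z t\<bar> \<le> B"
proof -
  have B: "B \<ge> 0" using f[of 0] by linarith
  then show ?thesis unfolding trunc_def by (rule seq.abs_integral_le[OF payoff_bound[OF f]])
qed

lemma trunc_0 [simp]: "trunc f 0 z t = 0"
  by (simp add: trunc_def)

lemma jump_avg_bound:
  assumes "\<And>x. \<bar>F x\<bar> \<le> B"
  shows "\<bar>jump_avg F z\<bar> \<le> B"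
proof -
  have "B \<ge> 0" using assms[of z] by linarith
  then show ?thesis unfolding jump_avg_def by (rule \<Xi>.abs_integral_le[OF assms])
qed

lemma jump_avg_trunc_measurable:
  assumes f: "f \<in> borel_measurable borel"
  shows "(\<lambda>s. jump_avg (\<lambda>y. trunc f n y (t - s)) (\<phi> (max 0 s) z)) \<in> borel_measurable borel"
  unfolding jump_avg_def
proof (rule \<Xi>.borel_measurable_lebesgue_integral)
  have [measurable]: "(\<lambda>a. \<phi> (max 0 (fst a)) z) \<in> borel \<Otimes>\<^sub>M \<Xi> \<rightarrow>\<^sub>M borel"
    by (rule flow_measurable_pos; (simp; fail)?; measurable?)
  show "(\<lambda>(s, x). trunc f n (R x (\<phi> (max 0 s) z)) (t - s)) \<in> borel_measurable (borel \<Otimes>\<^sub>M \<Xi>)"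
    unfolding split_beta by (rule trunc_measurable[OF f]) measurable
qed

text \<open>
  The renewal equation: condition on the first pair of the noise sequence. Either the first jump
  comes after \<open>t\<close>, or the process starts afresh from the state after the jump with the remaining
  time and one jump fewer to go.
\<close>

lemma trunc_Suc:
  assumes f [measurable]: "f \<in> borel_measurable borel" and B: "\<And>x. \<bar>f x\<bar> \<le> B" and t: "t \<ge> 0"
  shows "trunc f (Suc n) z t = survival z t * f (\<phi> t z) +
    (\<integral>s. indicator {0..t} s * (jump_density z s * jump_avg (\<lambda>y. trunc f n y (t - s)) (\<phi> (max 0 s) z)) \<partial>lborel)"
proof -
  interpret NS: pair_sigma_finite noise noise_seq by unfold_locales
  interpret UX: pair_sigma_finite unif01 \<Xi> by unfold_locales
  interpret NSP: prob_space "noise \<Otimes>\<^sub>M noise_seq" by (rule prob_space_pair) unfold_locales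
  let ?h = "\<lambda>a \<omega>. payoff f (Suc n) z t (case_nat a \<omega>)"
  have iter [measurable]: "(\<lambda>(a, \<omega>). case_nat a \<omega>) \<in> noise \<Otimes>\<^sub>M noise_seq \<rightarrow>\<^sub>M noise_seq"
    unfolding split_beta' by measurable
  have pm [measurable]: "payoff f (Suc n) z t \<in> borel_measurable noise_seq"
    by (rule payoff_measurable') auto
  have "trunc f (Suc n) z t = (\<integral>\<omega>. payoff f (Suc n) z t \<omega> \<partial>distr (noise \<Otimes>\<^sub>M noise_seq) noise_seq (\<lambda>(a, \<omega>). case_nat a \<omega>))"
    unfolding trunc_def seq.PiM_iter ..
  also have "\<dots> = (\<integral>p. payoff f (Suc n) z t (case p of (a, \<omega>) \<Rightarrow> case_nat a \<omega>) \<partial>(noise \<Otimes>\<^sub>M noise_seq))"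
    by (rule integral_distr) measurable
  also have "\<dots> = (\<integral>a. (\<integral>\<omega>. ?h a \<omega> \<partial>noise_seq) \<partial>noise)"
  proof -
    have "integrable (noise \<Otimes>\<^sub>M noise_seq) (\<lambda>p. payoff f (Suc n) z t (case p of (a, \<omega>) \<Rightarrow> case_nat a \<omega>))"
      by (rule NSP.integrable_const_bound[where B=B])
         (auto intro!: AE_I2 payoff_bound[OF B] measurable_compose[OF iter pm] simp del: payoff.simps)
    from NS.integral_fst'[OF this] show ?thesis by simp
  qed
  also have "\<dots> = (\<integral>a. (if ennreal t < W z (fst a) then f (\<phi> t z)
      else trunc f n (R (snd a) (\<phi> (enn2real (W z (fst a))) z)) (t - enn2real (W z (fst a)))) \<partial>noise)"
    using t by (intro Bochner_Integration.integral_cong) (auto simp: trunc_def seq.P.prob_space)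
  also have "\<dots> = (\<integral>u. (\<integral>x. (if ennreal t < W z u then f (\<phi> t z)
      else trunc f n (R x (\<phi> (enn2real (W z u)) z)) (t - enn2real (W z u))) \<partial>\<Xi>) \<partial>unif01)"
  proof -
    have [measurable]: "(\<lambda>a. \<phi> (enn2real (W z (fst a))) z) \<in> noise \<rightarrow>\<^sub>M borel"
      by (rule flow_measurable_pos; (simp; fail)?; measurable?)
    have [measurable]: "(\<lambda>a. trunc f n (R (snd a) (\<phi> (enn2real (W z (fst a))) z)) (t - enn2real (W z (fst a)))) \<in> borel_measurable noise"
      by (rule trunc_measurable[OF f]) measurable
    have "integrable noise (\<lambda>a. (if ennreal t < W z (fst a) then f (\<phi> t z)
      else trunc f n (R (snd a) (\<phi> (enn2real (W z (fst a))) z)) (t - enn2real (W z (fst a)))))"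
      by (rule noise.integrable_const_bound[where B=B])
         (auto intro!: AE_I2 trunc_bound[OF B] B, measurable)
    from UX.integral_fst'[OF this, symmetric] show ?thesis by (simp only: fst_conv snd_conv)
  qed
  also have "\<dots> = (\<integral>u. (if ennreal t < W z u then f (\<phi> t z)
      else jump_avg (\<lambda>y. trunc f n y (t - enn2real (W z u))) (\<phi> (max 0 (enn2real (W z u))) z)) \<partial>unif01)"
    by (intro Bochner_Integration.integral_cong) (auto simp: jump_avg_def \<Xi>.prob_space)
  also have "\<dots> = survival z t * f (\<phi> t z) +
    (\<integral>s. indicator {0..t} s * (jump_density z s * jump_avg (\<lambda>y. trunc f n y (t - s)) (\<phi> (max 0 s) z)) \<partial>lborel)"
    by (rule wait_integral[OF t jump_avg_trunc_measurable[OF f] jump_avg_bound[OF trunc_bound[OF B]]])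
  finally show ?thesis .
qed

end

section \<open>Feller property\<close>

lemma C_0I_sequentially:
  fixes f :: "'a::euclidean_space \<Rightarrow> real"
  assumes "continuous_on UNIV f"
    and "\<And>z. filterlim (\<lambda>k. norm (z k)) at_top sequentially \<Longrightarrow> (\<lambda>k. f (z k)) \<longlonglongrightarrow> 0"
  shows "f \<in> C_0"
  unfolding C_0_iff
proof (intro conjI allI impI assms(1))
  fix e :: real assume e: "e > 0"
  show "\<exists>r. \<forall>x. norm x > r \<longrightarrow> \<bar>f x\<bar> \<le> e"
  proof (rule ccontr)
    assume "\<not> ?thesis"
    then have "\<forall>k. \<exists>x. norm x > real k \<and> \<bar>f x\<bar> > e" by (meson not_le)
    then obtain z where z: "\<And>k. norm (z k) > real k" "\<And>k. \<bar>f (z k)\<bar> > e" by metis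
    have "filterlim (\<lambda>k. norm (z k)) at_top sequentially"
      by (rule filterlim_at_top_mono[OF filterlim_real_sequentially]) (simp add: z(1) less_imp_le)
    from tendstoD[OF assms(2)[OF this] e] obtain k where "\<bar>f (z k)\<bar> < e"
      by (auto simp: eventually_sequentially)
    with z(2)[of k] show False by simp
  qed
qed

lemma C_0_tendsto_0:
  fixes f :: "'a::euclidean_space \<Rightarrow> real"
  assumes "f \<in> C_0" "filterlim (\<lambda>k. norm (z k)) at_top F"
  shows "((\<lambda>k. f (z k)) \<longlongrightarrow> 0) F"
  using assms by (auto simp: C_0_def intro: filterlim_compose[OF _ filterlim_norm_at_top_imp_at_infinity])

lemma integrable_indicator_Icc: "integrable lborel (\<lambda>s. indicator {0..t} s * c :: real)" for t :: real
  by (intro integrable_mult_left integrable_real_indicator) (auto simp: emeasure_lborel_Icc_eq)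

lemma abs_indicator_integral_le:
  assumes h: "integrable lborel (\<lambda>s. indicator {0..t} s * h s)"
    and b: "\<And>s. 0 \<le> s \<Longrightarrow> s \<le> t \<Longrightarrow> \<bar>h s\<bar> \<le> b" and t: "(t::real) \<ge> 0"
  shows "\<bar>\<integral>s. indicator {0..t} s * h s \<partial>lborel\<bar> \<le> b * t"
proof -
  have "\<bar>\<integral>s. indicator {0..t} s * h s \<partial>lborel\<bar> \<le> (\<integral>s. \<bar>indicator {0..t} s * h s\<bar> \<partial>lborel)"
    by (rule integral_abs_bound)
  also have "\<dots> \<le> (\<integral>s. indicator {0..t} s * b \<partial>lborel)"
  proof (rule integral_mono)
    show "integrable lborel (\<lambda>s. \<bar>indicator {0..t} s * h s\<bar>)" using h by (rule integrable_abs)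
    show "integrable lborel (\<lambda>s. indicator {0..t} s * b :: real)" by (rule integrable_indicator_Icc)
    show "\<bar>indicator {0..t} s * h s\<bar> \<le> indicator {0..t} s * b" for s
      using b[of s] by (auto simp: indicator_def)
  qed
  also have "\<dots> = b * t" using t by simp
  finally show ?thesis .
qed

lemma (in prob_space) abs_integral_diff_le:
  fixes X Y Z :: "'a \<Rightarrow> real"
  assumes X: "integrable M X" and Y: "integrable M Y" and Z: "integrable M Z"
    and le: "\<And>x. \<bar>X x - Y x\<bar> \<le> B * (1 - Z x)"
  shows "\<bar>(\<integral>x. X x \<partial>M) - (\<integral>x. Y x \<partial>M)\<bar> \<le> B * (1 - (\<integral>x. Z x \<partial>M))"
proof -
  have "\<bar>(\<integral>x. X x \<partial>M) - (\<integral>x. Y x \<partial>M)\<bar> = \<bar>\<integral>x. X x - Y x \<partial>M\<bar>"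
    using X Y by simp
  also have "\<dots> \<le> (\<integral>x. \<bar>X x - Y x\<bar> \<partial>M)" by (rule integral_abs_bound)
  also have "\<dots> \<le> (\<integral>x. B * (1 - Z x) \<partial>M)"
    by (rule integral_mono) (use X Y Z le in auto)
  also have "\<dots> = B * (1 - (\<integral>x. Z x \<partial>M))" using Z by (simp add: prob_space)
  finally show ?thesis .
qed

context lipschitz_pdmp
begin

abbreviation Pt :: "real \<Rightarrow> ('a \<Rightarrow> real) \<Rightarrow> 'a \<Rightarrow> real" where
  "Pt \<equiv> pdmp_semigroup \<phi> R W M U \<xi>"

text \<open>
  \<open>V t\<close> is a set of states from which, with time \<open>t\<close> left to run, the process meets only
  intensities of at most \<open>C\<close>; after a jump at time \<open>s\<close> the state lies in the set for the remaining
  time.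
\<close>

definition confined :: "real \<Rightarrow> (real \<Rightarrow> 'a set) \<Rightarrow> bool" where
  "confined C V \<longleftrightarrow> (\<forall>t z s. 0 \<le> s \<longrightarrow> s \<le> t \<longrightarrow> z \<in> V t \<longrightarrow>
     lam (\<phi> s z) \<le> C \<and> (\<forall>x\<in>space \<Xi>. R x (\<phi> s z) \<in> V (t - s)))"

lemma confinedD:
  assumes "confined C V" "0 \<le> s" "s \<le> t" "z \<in> V t"
  shows "lam (\<phi> s z) \<le> C" "x \<in> space \<Xi> \<Longrightarrow> R x (\<phi> s z) \<in> V (t - s)"
  using assms by (auto simp: confined_def)

lemma R_measurable_point [measurable]: "(\<lambda>x. R x z) \<in> \<Xi> \<rightarrow>\<^sub>M borel"
  by measurable

lemma jump_avg_abs_le: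
  assumes "\<And>x. x \<in> space \<Xi> \<Longrightarrow> \<bar>F (R x z)\<bar> \<le> B" "B \<ge> 0"
  shows "\<bar>jump_avg F z\<bar> \<le> B"
  unfolding jump_avg_def by (rule \<Xi>.abs_integral_le[OF assms])

lemma jump_avg_integrable:
  fixes F :: "'a \<Rightarrow> real"
  assumes "F \<in> borel_measurable borel" "\<And>x. \<bar>F x\<bar> \<le> B"
  shows "integrable \<Xi> (\<lambda>x. F (R x z))"
  using assms by (intro \<Xi>.integrable_const_bound[where B=B]) (auto intro!: measurable_compose[OF R_measurable_point])

lemma jump_avg_diff:
  assumes "F \<in> borel_measurable borel" "\<And>x. \<bar>F x\<bar> \<le> B" "G \<in> borel_measurable borel" "\<And>x. \<bar>G x\<bar> \<le> B'"
  shows "jump_avg F z - jump_avg G z = jump_avg (\<lambda>x. F x - G x) z"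
  unfolding jump_avg_def
  by (rule Bochner_Integration.integral_diff[symmetric]; rule jump_avg_integrable[OF assms(1,2)] jump_avg_integrable[OF assms(3,4)])

lemma jump_avg_const [simp]: "jump_avg (\<lambda>_. c) z = c"
  by (simp add: jump_avg_def \<Xi>.prob_space)

lemma jump_avg_tendsto:
  assumes F: "F \<in> borel_measurable borel" "\<And>x. \<bar>F x\<bar> \<le> B" and G: "G \<in> borel_measurable \<Xi>"
    and lim: "\<And>x. x \<in> space \<Xi> \<Longrightarrow> (\<lambda>k. F (R x (z k))) \<longlonglongrightarrow> G x"
  shows "(\<lambda>k. jump_avg F (z k)) \<longlonglongrightarrow> (\<integral>x. G x \<partial>\<Xi>)"
  unfolding jump_avg_def
  by (rule integral_dominated_convergence[where w="\<lambda>_. B"])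
     (use F G lim in \<open>auto intro!: measurable_compose[OF R_measurable_point] AE_I2\<close>)

lemma jump_avg_continuous:
  assumes F: "continuous_on UNIV F" "\<And>x. \<bar>F x\<bar> \<le> B"
  shows "continuous_on UNIV (jump_avg F)"
  unfolding continuous_on_sequentially comp_def
proof (intro allI ballI impI)
  fix u a assume u: "(\<forall>n. u n \<in> UNIV) \<and> u \<longlonglongrightarrow> (a::'a)"
  have Fm: "F \<in> borel_measurable borel" by (rule borel_measurable_continuous_onI[OF F(1)])
  show "(\<lambda>k. jump_avg F (u k)) \<longlonglongrightarrow> jump_avg F a"
    unfolding jump_avg_def[of F a]
  proof (rule jump_avg_tendsto[OF Fm F(2)])
    show "(\<lambda>x. F (R x a)) \<in> borel_measurable \<Xi>" by (rule measurable_compose[OF R_measurable_point Fm])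
    fix x assume "x \<in> space \<Xi>"
    then have "continuous_on UNIV (\<lambda>z. F (R x z))"
      by (intro continuous_on_compose2[OF F(1) R_continuous]) auto
    then show "(\<lambda>k. F (R x (u k))) \<longlonglongrightarrow> F (R x a)"
      using u by (intro continuous_on_tendsto_compose[where f="\<lambda>z. F (R x z)"]) auto
  qed
qed

lemma jump_avg_C_0_escaping:
  assumes R: "\<And>x. x \<in> space \<Xi> \<Longrightarrow> filterlim (\<lambda>z. norm (R x z)) at_top at_infinity" and F: "F \<in> C_0"
  shows "jump_avg F \<in> C_0"
proof (rule C_0I_sequentially)
  obtain B where B: "\<And>x. \<bar>F x\<bar> \<le> B" using C_0_bounded[OF F] by metis
  show "continuous_on UNIV (jump_avg F)" by (rule jump_avg_continuous[OF C_0_continuous[OF F] B])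
  fix z :: "nat \<Rightarrow> 'a" assume z: "filterlim (\<lambda>k. norm (z k)) at_top sequentially"
  have "(\<lambda>k. jump_avg F (z k)) \<longlonglongrightarrow> (\<integral>x. 0 \<partial>\<Xi>)"
  proof (rule jump_avg_tendsto[OF C_0_measurable[OF F] B])
    fix x assume "x \<in> space \<Xi>"
    from filterlim_compose[OF R[OF this] filterlim_norm_at_top_imp_at_infinity[OF z]]
    show "(\<lambda>k. F (R x (z k))) \<longlonglongrightarrow> 0" by (rule C_0_tendsto_0[OF F])
  qed simp
  then show "(\<lambda>k. jump_avg F (z k)) \<longlonglongrightarrow> 0" by simp
qed

lemma jump_avg_C_0_isometric:
  assumes R: "\<And>x z. x \<in> space \<Xi> \<Longrightarrow> norm (R x z) = norm z" and F: "F \<in> C_0"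
  shows "jump_avg F \<in> C_0"
  unfolding C_0_iff
proof (intro conjI allI impI)
  obtain B where B: "\<And>x. \<bar>F x\<bar> \<le> B" using C_0_bounded[OF F] by metis
  show "continuous_on UNIV (jump_avg F)" by (rule jump_avg_continuous[OF C_0_continuous[OF F] B])
  fix e :: real assume e: "e > 0"
  then obtain r where r: "\<And>x. norm x > r \<Longrightarrow> \<bar>F x\<bar> \<le> e" using C_0_small[OF F] by metis
  have "\<bar>jump_avg F z\<bar> \<le> e" if "norm z > r" for z
    by (rule jump_avg_abs_le) (use R that e in \<open>auto intro!: r\<close>)
  then show "\<exists>r. \<forall>z. norm z > r \<longrightarrow> \<bar>jump_avg F z\<bar> \<le> e" by blast
qed

text \<open>
  \<open>1 - trunc (\<lambda>_. 1) n z t\<close> is the probability of \<open>n\<close> jumps up to time \<open>t\<close>. The renewal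
  equation bounds it by iterated integrals of \<open>C\<close> over a simplex, as for a Poisson process of
  intensity \<open>C\<close>.
\<close>

lemma explosion_bound:
  assumes V: "confined C V" and C: "C \<ge> 0"
  shows "0 \<le> t \<Longrightarrow> z \<in> V t \<Longrightarrow> 1 - trunc (\<lambda>_. 1) n z t \<le> (C * t) ^ n / fact n"
proof (induction n arbitrary: t z)
  case (Suc n)
  let ?one = "\<lambda>_. 1 :: real"
  define K where "K s = jump_avg (\<lambda>y. trunc ?one n y (t - s)) (\<phi> (max 0 s) z)" for s
  define q where "q s = C * (C * (t - s)) ^ n / fact n" for s
  have Km: "K \<in> borel_measurable borel" unfolding K_def by (rule jump_avg_trunc_measurable) simp
  have t1: "\<bar>trunc ?one n y s\<bar> \<le> 1" for y s by (rule trunc_bound) simp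
  have K1: "\<bar>K s\<bar> \<le> 1" for s unfolding K_def by (rule jump_avg_bound[OF t1])
  have int1: "integrable lborel (\<lambda>s. indicator {0..t} s * (jump_density z s * 1))"
    by (rule jump_density_integrable[where B=1]) auto
  have int2: "integrable lborel (\<lambda>s. indicator {0..t} s * (jump_density z s * K s))"
    by (rule jump_density_integrable[OF Km K1])
  have qc: "continuous_on {0..t} q" unfolding q_def by (intro continuous_intros) auto
  have int3: "integrable lborel (\<lambda>s. indicator {0..t} s *\<^sub>R q s)"
    by (rule borel_integrable_compact[OF _ qc]) simp
  have "trunc ?one (Suc n) z t = survival z t * 1 + (\<integral>s. indicator {0..t} s * (jump_density z s * K s) \<partial>lborel)"
    unfolding K_def by (rule trunc_Suc[where B=1]) (use Suc.prems in auto)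
  also have "survival z t = 1 - (\<integral>s. indicator {0..t} s * (jump_density z s * 1) \<partial>lborel)"
    using jump_density_integral[OF Suc.prems(1), of z] by simp
  finally have "1 - trunc ?one (Suc n) z t = (\<integral>s. indicator {0..t} s * (jump_density z s * 1) \<partial>lborel)
      - (\<integral>s. indicator {0..t} s * (jump_density z s * K s) \<partial>lborel)" by simp
  also have "\<dots> = (\<integral>s. indicator {0..t} s * (jump_density z s * 1) - indicator {0..t} s * (jump_density z s * K s) \<partial>lborel)"
    by (rule Bochner_Integration.integral_diff[symmetric, OF int1 int2])
  also have "\<dots> \<le> (\<integral>s. indicator {0..t} s *\<^sub>R q s \<partial>lborel)"
  proof (rule integral_mono[OF Bochner_Integration.integrable_diff[OF int1 int2] int3])
    fix s
    show "indicator {0..t} s * (jump_density z s * 1) - indicator {0..t} s * (jump_density z s * K s) \<le> indicator {0..t} s *\<^sub>R q s"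
    proof (cases "s \<in> {0..t}")
      case True
      then have s: "0 \<le> s" "s \<le> t" by auto
      note conf = confinedD[OF V s Suc.prems(2)]
      let ?p = "(C * (t - s)) ^ n / fact n"
      have p: "?p \<ge> 0" using s C by simp
      have dle: "jump_density z s \<le> C"
        using jump_density_bounds(2)[of z s] conf(1) s by (simp add: rate_def max_def)
      have "1 - K s = jump_avg (\<lambda>y. 1 - trunc ?one n y (t - s)) (\<phi> s z)"
        using s jump_avg_diff[of "\<lambda>_. 1" 1 "\<lambda>y. trunc ?one n y (t - s)" 1 "\<phi> s z"] t1
        by (simp add: K_def max_def trunc_measurable)
      also have "\<dots> \<le> ?p"
      proof (rule abs_le_D1, rule jump_avg_abs_le[OF _ p])
        fix x assume x: "x \<in> space \<Xi>"
        have "1 - trunc ?one n (R x (\<phi> s z)) (t - s) \<le> ?p"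
          using Suc.IH[of "t - s"] conf(2)[OF x] s by simp
        then show "\<bar>1 - trunc ?one n (R x (\<phi> s z)) (t - s)\<bar> \<le> ?p"
          using t1[of "R x (\<phi> s z)" "t - s"] by linarith
      qed
      finally have "jump_density z s * (1 - K s) \<le> C * ?p"
        using jump_density_bounds(1)[of z s] dle p C K1[of s] by (intro mult_mono) auto
      then show ?thesis using True by (simp add: q_def algebra_simps)
    qed simp
  qed
  also have "\<dots> = - ((C * (t - t)) ^ Suc n / fact (Suc n)) - (- ((C * (t - 0)) ^ Suc n / fact (Suc n)))"
  proof (rule integral_FTC_atLeastAtMost[OF Suc.prems(1) _ qc])
    fix s
    have "((\<lambda>s. - ((C * (t - s)) ^ Suc n / fact (Suc n))) has_real_derivative
        (real (Suc n) * (C * (t - s)) ^ n * C) / fact (Suc n)) (at s within {0..t})"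
      by (rule derivative_eq_intros refl | simp)+
    also have "(real (Suc n) * (C * (t - s)) ^ n * C) / fact (Suc n) = q s"
      by (simp add: q_def divide_simps del: of_nat_Suc)
    finally show "((\<lambda>s. - ((C * (t - s)) ^ Suc n / fact (Suc n))) has_vector_derivative q s) (at s within {0..t})"
      by (simp add: has_real_derivative_iff_has_vector_derivative)
  qed
  finally show ?case by simp
qed simp

text \<open>
  \<open>f(Z_t)\<close> and its truncation agree unless \<open>n\<close> jumps have occurred, and then they differ by at most
  \<open>B\<close>.
\<close>

lemma Pt_trunc_diff:
  assumes f: "f \<in> borel_measurable borel" "\<And>x. \<bar>f x\<bar> \<le> B" and t: "t \<ge> 0"
  shows "\<bar>Pt t f z - trunc f n z t\<bar> \<le> B * (1 - trunc (\<lambda>_. 1) n z t)"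
proof -
  have state_int: "integrable noise_seq (\<lambda>\<omega>. f (state z \<omega> t))"
    by (rule seq.P.integrable_const_bound[where B=B])
       (use f measurable_compose[OF state_measurable[OF t] f(1)] in auto)
  have int1: "integrable noise_seq (payoff (\<lambda>_. 1) n z t)" by (rule payoff_integrable[where B=1]) auto
  have "\<bar>f (state z \<omega> t) - payoff f n z t \<omega>\<bar> \<le> B * (1 - payoff (\<lambda>_. 1) n z t \<omega>)" for \<omega>
    unfolding payoff_eq[OF t]
    by (cases "ennreal t < fst (chain z \<omega> n)") (simp_all only: if_True if_False diff_self diff_zero mult_1_right mult_zero_right abs_zero f(2) order_refl)
  from seq.P.abs_integral_diff_le[OF state_int payoff_integrable[OF f] int1 this]
  show ?thesis unfolding semigroup_eq[OF t f(1)] trunc_def .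
qed

lemma trunc_invariant_bound:
  assumes V: "\<And>t z s x. 0 \<le> s \<Longrightarrow> s \<le> t \<Longrightarrow> z \<in> V t \<Longrightarrow> x \<in> space \<Xi> \<Longrightarrow> R x (\<phi> s z) \<in> V (t - s)"
    and f: "\<And>t z. 0 \<le> t \<Longrightarrow> z \<in> V t \<Longrightarrow> \<bar>f (\<phi> t z)\<bar> \<le> e" and e: "e \<ge> 0" and t: "t \<ge> 0" "z \<in> V t"
  shows "\<bar>trunc f n z t\<bar> \<le> e"
  unfolding trunc_def
proof (rule seq.P.abs_integral_le[OF _ e])
  have bound: "\<bar>payoff f n z t \<omega>\<bar> \<le> e" if "t \<ge> 0" "z \<in> V t" "\<And>k. snd (\<omega> k) \<in> space \<Xi>" for z t \<omega>
    using that
  proof (induction n arbitrary: z t \<omega>)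
    case (Suc n)
    show ?case
    proof (cases "ennreal t < wait z \<omega>")
      case True
      then show ?thesis using f[OF Suc.prems(1,2)] Suc.prems(1) by (simp add: max_def)
    next
      case False
      then have w: "enn2real (wait z \<omega>) \<le> t"
        using ennreal_time_shift(2)[of "wait z \<omega>" t] Suc.prems by simp
      show ?thesis
        using False Suc.IH[OF _ V[OF enn2real_nonneg w Suc.prems(2,3)], of "\<lambda>k. \<omega> (Suc k)"] w Suc.prems by simp
    qed
  qed (use e in simp)
  then show "\<bar>payoff f n z t \<omega>\<bar> \<le> e" if "\<omega> \<in> space noise_seq" for \<omega>
  proof -
    have "\<omega> k \<in> space unif01 \<times> space \<Xi>" for k
      using that by (auto simp: space_PiM PiE_iff space_pair_measure)
    then have "snd (\<omega> k) \<in> space \<Xi>" for k by (metis mem_Sigma_iff prod.collapse)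
    then show ?thesis by (rule bound[OF t])
  qed
qed

lemma survival_continuous_space: "continuous_on UNIV (\<lambda>z. survival z t)"
  unfolding survival_def
proof (intro continuous_intros)
  have "continuous_on (UNIV \<times> cbox 0 (max 0 t)) (\<lambda>(z, s). rate z s)"
    unfolding split_beta by (intro rate_continuous_compose continuous_intros)
  from integral_continuous_on_param[OF this]
  show "continuous_on UNIV (\<lambda>z. integral {0..max 0 t} (rate z))" by simp
qed

lemma jump_density_continuous_space: "continuous_on UNIV (\<lambda>z. jump_density z s)"
  unfolding jump_density_def by (intro continuous_intros rate_continuous_compose survival_continuous_space)

lemma jump_integral_tendsto:
  assumes C: "\<And>k s. 0 \<le> s \<Longrightarrow> s \<le> t \<Longrightarrow> rate (u k) s \<le> C"
    and K [measurable]: "\<And>k. K k \<in> borel_measurable borel" and KB: "\<And>k s. \<bar>K k s\<bar> \<le> B"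
    and J [measurable]: "J \<in> borel_measurable borel"
    and lim: "\<And>s. 0 \<le> s \<Longrightarrow> s \<le> t \<Longrightarrow> (\<lambda>k. jump_density (u k) s * K k s) \<longlonglongrightarrow> J s"
  shows "(\<lambda>k. \<integral>s. indicator {0..t} s * (jump_density (u k) s * K k s) \<partial>lborel) \<longlonglongrightarrow>
    (\<integral>s. indicator {0..t} s * J s \<partial>lborel)"
proof (rule integral_dominated_convergence[where w="\<lambda>s. indicator {0..t} s * (C * B)"])
  have [measurable]: "jump_density z \<in> borel_measurable borel" for z
    by (rule borel_measurable_continuous_onI[OF jump_density_continuous])
  show "(\<lambda>s. indicator {0..t} s * J s) \<in> borel_measurable lborel" by measurable
  show "(\<lambda>s. indicator {0..t} s * (jump_density (u k) s * K k s)) \<in> borel_measurable lborel" for k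
    by measurable
  show "integrable lborel (\<lambda>s. indicator {0..t} s * (C * B) :: real)" by (rule integrable_indicator_Icc)
  have "(\<lambda>k. indicator {0..t} s * (jump_density (u k) s * K k s)) \<longlonglongrightarrow> indicator {0..t} s * J s" for s
    by (cases "s \<in> {0..t}") (auto intro: lim)
  then show "AE s in lborel. (\<lambda>k. indicator {0..t} s * (jump_density (u k) s * K k s)) \<longlonglongrightarrow> indicator {0..t} s * J s"
    by simp
  have "norm (indicator {0..t} s * (jump_density (u k) s * K k s)) \<le> indicator {0..t} s * (C * B)" for k s
    using jump_density_bounds[of "u k" s] C[of s k] KB[of k s]
    by (auto simp: indicator_def abs_mult intro!: mult_mono)
  then show "AE s in lborel. norm (indicator {0..t} s * (jump_density (u k) s * K k s)) \<le> indicator {0..t} s * (C * B)" for k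
    by simp
qed

lemma trunc_continuous:
  assumes f: "continuous_on UNIV f" "\<And>x. \<bar>f x\<bar> \<le> B"
  shows "t \<ge> 0 \<Longrightarrow> continuous_on UNIV (\<lambda>z. trunc f n z t)"
proof (induction n arbitrary: t)
  case (Suc n)
  note t = Suc.prems
  have fm: "f \<in> borel_measurable borel" by (rule borel_measurable_continuous_onI[OF f(1)])
  have B: "B \<ge> 0" using f(2)[of 0] by linarith
  define K where "K z s = jump_avg (\<lambda>y. trunc f n y (t - s)) (\<phi> (max 0 s) z)" for z s
  have KB: "\<bar>K z s\<bar> \<le> B" for z s unfolding K_def by (rule jump_avg_bound[OF trunc_bound[OF f(2)]])
  have Km: "K z \<in> borel_measurable borel" for z unfolding K_def by (rule jump_avg_trunc_measurable[OF fm])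
  have Kc: "continuous_on UNIV (\<lambda>z. K z s)" if s: "s \<le> t" for s
    unfolding K_def
    by (rule continuous_on_compose2[OF jump_avg_continuous[OF Suc.IH trunc_bound[OF f(2)]]])
       (use s in \<open>auto intro!: flow_continuous_compose continuous_intros\<close>)
  have [measurable]: "jump_density z \<in> borel_measurable borel" for z
    by (rule borel_measurable_continuous_onI[OF jump_density_continuous])
  have "continuous_on UNIV (\<lambda>z. \<integral>s. indicator {0..t} s * (jump_density z s * K z s) \<partial>lborel)"
    unfolding continuous_on_sequentially comp_def
  proof (intro allI ballI impI)
    fix u a assume u: "(\<forall>n. u n \<in> UNIV) \<and> u \<longlonglongrightarrow> (a::'a)"
    then have "bounded (range u)" by (auto intro: convergent_imp_bounded)
    then obtain r where r: "\<And>k. norm (u k) \<le> r" by (auto simp: bounded_iff)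
    have "compact ((\<lambda>(s, z). rate z s) ` ({0..t} \<times> cball 0 r))"
      by (intro compact_continuous_image compact_Times continuous_on_subset[OF rate_continuous]) auto
    then have "bounded ((\<lambda>(s, z). rate z s) ` ({0..t} \<times> cball 0 r))" by (rule compact_imp_bounded)
    then obtain C where C: "\<forall>y\<in>(\<lambda>(s, z). rate z s) ` ({0..t} \<times> cball 0 r). norm y \<le> C"
      unfolding bounded_iff by blast
    have Cr: "rate (u k) s \<le> C" if "s \<in> {0..t}" for k s
    proof -
      have "norm (rate (u k) s) \<le> C" using C that r[of k] by (intro C[rule_format]) force
      then show ?thesis by simp
    qed
    show "(\<lambda>k. \<integral>s. indicator {0..t} s * (jump_density (u k) s * K (u k) s) \<partial>lborel) \<longlonglongrightarrow>
        (\<integral>s. indicator {0..t} s * (jump_density a s * K a s) \<partial>lborel)"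
    proof (rule jump_integral_tendsto[OF _ Km KB])
      show "rate (u k) s \<le> C" if "0 \<le> s" "s \<le> t" for k s using Cr that by simp
      show "(\<lambda>s. jump_density a s * K a s) \<in> borel_measurable borel" using Km[of a] by measurable
      fix s assume "0 \<le> s" "s \<le> t"
      then have "continuous_on UNIV (\<lambda>z. jump_density z s * K z s)"
        by (intro continuous_intros jump_density_continuous_space Kc) auto
      then show "(\<lambda>k. jump_density (u k) s * K (u k) s) \<longlonglongrightarrow> jump_density a s * K a s"
        using u by (intro continuous_on_tendsto_compose[where f="\<lambda>z. jump_density z s * K z s"]) auto
    qed
  qed
  moreover have "continuous_on UNIV (\<lambda>z. survival z t * f (\<phi> t z))"
    using t by (intro continuous_intros survival_continuous_space continuous_on_compose2[OF f(1)] flow_continuous_compose) auto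
  ultimately show ?case
    unfolding trunc_Suc[OF fm f(2) t] K_def by (intro continuous_on_add)
qed simp

text \<open>
  A starting point of large norm stays far away along the flow, and the average over the jumps
  preserves \<open>C_0\<close>; the bound on the intensity provides the dominating function.
\<close>

lemma trunc_C_0:
  assumes lam: "\<And>z. lam z \<le> C" and avg: "\<And>F. F \<in> C_0 \<Longrightarrow> jump_avg F \<in> C_0" and f: "f \<in> C_0"
  shows "t \<ge> 0 \<Longrightarrow> (\<lambda>z. trunc f n z t) \<in> C_0"
proof (induction n arbitrary: t)
  case 0
  show ?case using C_0I_compact_support[of "\<lambda>_. 0" 0] by simp
next
  case (Suc n)
  note t = Suc.prems
  obtain B where B: "B > 0" "\<And>x. \<bar>f x\<bar> \<le> B" using C_0_bounded[OF f] by blast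
  have fm: "f \<in> borel_measurable borel" by (rule C_0_measurable[OF f])
  define K where "K z s = jump_avg (\<lambda>y. trunc f n y (t - s)) (\<phi> (max 0 s) z)" for z s
  have KB: "\<bar>K z s\<bar> \<le> B" for z s unfolding K_def by (rule jump_avg_bound[OF trunc_bound[OF B(2)]])
  have Km: "K z \<in> borel_measurable borel" for z unfolding K_def by (rule jump_avg_trunc_measurable[OF fm])
  have K0: "(\<lambda>z. K z s) \<in> C_0" if "s \<le> t" for s
    unfolding K_def using that by (intro C_0_flow avg Suc.IH) auto
  show ?case
  proof (rule C_0I_sequentially)
    show "continuous_on UNIV (\<lambda>z. trunc f (Suc n) z t)"
      by (rule trunc_continuous[OF C_0_continuous[OF f] B(2) t])
    fix z :: "nat \<Rightarrow> 'a" assume z: "filterlim (\<lambda>k. norm (z k)) at_top sequentially"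
    have "(\<lambda>k. \<integral>s. indicator {0..t} s * (jump_density (z k) s * K (z k) s) \<partial>lborel) \<longlonglongrightarrow>
        (\<integral>s. indicator {0..t} s * 0 \<partial>lborel)"
    proof (rule jump_integral_tendsto[OF _ Km KB])
      show "rate (z k) s \<le> C" for k s by (simp add: rate_def lam)
      fix s assume s: "0 \<le> s" "s \<le> t"
      show "(\<lambda>k. jump_density (z k) s * K (z k) s) \<longlonglongrightarrow> 0"
      proof (rule Lim_null_comparison)
        have "\<bar>jump_density (z k) s\<bar> \<le> C" for k
          using jump_density_bounds[of "z k" s] lam[of "\<phi> (max 0 s) (z k)"] by (simp add: rate_def)
        then show "\<forall>\<^sub>F k in sequentially. norm (jump_density (z k) s * K (z k) s) \<le> C * \<bar>K (z k) s\<bar>"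
          by (auto simp: abs_mult intro!: always_eventually mult_right_mono)
        show "(\<lambda>k. C * \<bar>K (z k) s\<bar>) \<longlonglongrightarrow> 0"
          by (intro tendsto_mult_right_zero tendsto_rabs_zero C_0_tendsto_0[OF K0[OF s(2)] z])
      qed
    qed simp
    moreover have "(\<lambda>k. survival (z k) t * f (\<phi> t (z k))) \<longlonglongrightarrow> 0"
    proof (rule Lim_null_comparison)
      show "\<forall>\<^sub>F k in sequentially. norm (survival (z k) t * f (\<phi> t (z k))) \<le> \<bar>f (\<phi> t (z k))\<bar>"
        unfolding real_norm_def abs_mult abs_of_pos[OF survival_bounds(1)]
        by (intro always_eventually allI mult_left_le_one_le survival_bounds(2) less_imp_le[OF survival_bounds(1)] abs_ge_zero)
      show "(\<lambda>k. \<bar>f (\<phi> t (z k))\<bar>) \<longlonglongrightarrow> 0"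
        by (intro tendsto_rabs_zero C_0_tendsto_0[OF C_0_flow[OF f t] z])
    qed
    ultimately show "(\<lambda>k. trunc f (Suc n) (z k) t) \<longlonglongrightarrow> 0"
      unfolding trunc_Suc[OF fm B(2) t] K_def by (auto intro: tendsto_add_zero)
  qed
qed

end

context lipschitz_pdmp
begin

lemma jump_avg_add:
  assumes "F \<in> C_0" "G \<in> C_0"
  shows "jump_avg (\<lambda>x. F x + G x) z = jump_avg F z + jump_avg G z"
proof -
  have "integrable \<Xi> (\<lambda>x. F (R x z))" if F: "F \<in> C_0" for F
  proof -
    obtain B where "\<And>x. \<bar>F x\<bar> \<le> B" using C_0_bounded[OF F] by metis
    then show ?thesis by (rule jump_avg_integrable[OF C_0_measurable[OF F]])
  qed
  then show ?thesis using assms by (simp add: jump_avg_def)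
qed

lemma Pt_bound:
  assumes "f \<in> borel_measurable borel" "\<And>x. \<bar>f x\<bar> \<le> B" "t \<ge> 0"
  shows "\<bar>Pt t f z\<bar> \<le> B"
proof -
  have "B \<ge> 0" using assms(2)[of 0] by linarith
  then show ?thesis
    unfolding semigroup_eq[OF assms(3,1)] by (rule seq.P.abs_integral_le[OF assms(2)])
qed

lemma Pt_diff:
  assumes f: "f \<in> C_0" and h: "h \<in> C_0" and t: "t \<ge> 0"
  shows "Pt t (\<lambda>x. f x - h x) z = Pt t f z - Pt t h z"
proof -
  have m: "u \<in> borel_measurable borel" if "u \<in> C_0" for u :: "'a \<Rightarrow> real"
    by (rule C_0_measurable[OF that])
  have int: "integrable noise_seq (\<lambda>\<omega>. u (state z \<omega> t))" if u: "u \<in> C_0" for u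
  proof -
    obtain B where "\<And>x. \<bar>u x\<bar> \<le> B" using C_0_bounded[OF u] by metis
    then show ?thesis
      by (intro seq.P.integrable_const_bound[where B=B])
         (auto intro: measurable_compose[OF state_measurable[OF t] m[OF u]])
  qed
  have "(\<lambda>x. f x - h x) \<in> borel_measurable borel" using m[OF f] m[OF h] by measurable
  then show ?thesis
    by (simp add: semigroup_eq[OF t] m f h Bochner_Integration.integral_diff[OF int int])
qed

text \<open>
  This excludes explosion, uniformly for starting points in bounded sets.
\<close>

definition locally_confined :: bool where
  "locally_confined \<longleftrightarrow> (\<forall>t\<ge>0. \<forall>r. \<exists>C\<ge>0. \<exists>V. confined C V \<and> (\<forall>z. norm z \<le> r \<longrightarrow> z \<in> V t))"

lemma Pt_trunc_close:
  assumes V: "confined C V" "C \<ge> 0" and f: "f \<in> borel_measurable borel" "\<And>x. \<bar>f x\<bar> \<le> B"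
    and t: "t \<ge> 0" "z \<in> V t"
  shows "\<bar>Pt t f z - trunc f n z t\<bar> \<le> B * ((C * t) ^ n / fact n)"
proof -
  have "B \<ge> 0" using f(2)[of 0] by linarith
  then show ?thesis
    using Pt_trunc_diff[OF f t(1), of z n] mult_left_mono[OF explosion_bound[OF V t, of n], of B] by linarith
qed

lemma power_fact_small:
  fixes x B e :: real
  assumes "e > 0"
  shows "\<forall>\<^sub>F n in sequentially. B * (x ^ n / fact n) < e"
proof -
  have "(\<lambda>n. inverse (fact n) * x ^ n) \<longlonglongrightarrow> 0" by (rule summable_LIMSEQ_zero[OF summable_exp])
  then have "(\<lambda>n. B * (inverse (fact n) * x ^ n)) \<longlonglongrightarrow> B * 0" by (intro tendsto_intros)
  then show ?thesis using assms by (auto dest!: order_tendstoD(2)[of _ _ _ e] simp: field_simps)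
qed

lemma Pt_continuous:
  assumes lc: locally_confined and f: "f \<in> C_0" and t: "t \<ge> 0"
  shows "continuous_on UNIV (Pt t f)"
proof -
  obtain B where B: "\<And>x. \<bar>f x\<bar> \<le> B" using C_0_bounded[OF f] by metis
  have fm: "f \<in> borel_measurable borel" by (rule C_0_measurable[OF f])
  have "isCont (Pt t f) z0" for z0
  proof -
    obtain C V where V: "confined C V" "C \<ge> 0" "\<And>z. norm z \<le> norm z0 + 1 \<Longrightarrow> z \<in> V t"
      using lc t unfolding locally_confined_def by meson
    have "uniform_limit (ball z0 1) (\<lambda>n z. trunc f n z t) (Pt t f) sequentially"
    proof (rule uniform_limitI)
      fix e :: real assume "e > 0"
      from power_fact_small[OF this, of B "C * t"]
      show "\<forall>\<^sub>F n in sequentially. \<forall>z\<in>ball z0 1. dist (trunc f n z t) (Pt t f z) < e"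
      proof eventually_elim
        case (elim n)
        show ?case
        proof
          fix z assume "z \<in> ball z0 1"
          then have "norm z \<le> norm z0 + 1"
            using norm_triangle_ineq2[of z z0] by (simp add: dist_norm norm_minus_commute)
          from Pt_trunc_close[OF V(1,2) fm B t V(3)[OF this], of n] elim
          show "dist (trunc f n z t) (Pt t f z) < e" by (simp add: dist_real_def abs_minus_commute)
        qed
      qed
    qed
    then have "continuous_on (ball z0 1) (Pt t f)"
      by (rule uniform_limit_theorem[rotated])
         (auto intro!: always_eventually continuous_on_subset[OF trunc_continuous[OF C_0_continuous[OF f] B t]])
    then show ?thesis by (simp add: continuous_on_eq_continuous_at)
  qed
  then show ?thesis by (simp add: continuous_on_eq_continuous_at)
qed

lemma Pt_le_of_trunc_le:
  assumes lc: locally_confined and f: "f \<in> C_0" and t: "t \<ge> 0" and le: "\<And>n. \<bar>trunc f n z t\<bar> \<le> e"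
  shows "\<bar>Pt t f z\<bar> \<le> e"
proof (rule field_le_epsilon)
  fix d :: real assume d: "d > 0"
  obtain B where B: "\<And>x. \<bar>f x\<bar> \<le> B" using C_0_bounded[OF f] by metis
  have fm: "f \<in> borel_measurable borel" by (rule C_0_measurable[OF f])
  obtain C V where V: "confined C V" "C \<ge> 0" "z \<in> V t"
    using lc t unfolding locally_confined_def by (meson order_refl)
  obtain n where "B * ((C * t) ^ n / fact n) < d"
    using power_fact_small[OF d, of B "C * t"] by (auto simp: eventually_sequentially)
  with Pt_trunc_close[OF V(1,2) fm B t V(3), of n] le[of n] show "\<bar>Pt t f z\<bar> \<le> e + d" by linarith
qed

section \<open>The generator on smooth functions\<close>

lemma flow_derivative_smooth:
  assumes f: "f \<in> C_c_infinity" and t: "t \<ge> 0"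
  shows "((\<lambda>s. f (\<phi> s z)) has_real_derivative transport f (\<phi> t z)) (at t within {0..})"
proof -
  have "((\<lambda>s. f (\<phi> s z)) has_derivative (\<lambda>h. frechet_derivative f (at (\<phi> t z)) (h *\<^sub>R g (\<phi> t z)))) (at t within {0..})"
    by (rule has_derivative_compose[OF flow_derivative[OF t, unfolded has_vector_derivative_def] C_c_infinity_has_derivative[OF f]])
  moreover have "frechet_derivative f (at (\<phi> t z)) (h *\<^sub>R g (\<phi> t z)) = transport f (\<phi> t z) * h" for h
    using linear_scale[OF has_derivative_linear[OF C_c_infinity_has_derivative[OF f]]] by (simp add: transport_def)
  ultimately show ?thesis by (simp add: has_field_derivative_def)
qed

lemma survival_defect:
  assumes V: "confined C V" "C \<ge> 0" and s: "0 \<le> s" "s \<le> t" and z: "z \<in> V t"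
  shows "1 - survival z s \<le> C * s"
proof -
  have "integrable lborel (\<lambda>r. indicator {0..s} r * jump_density z r)"
    using jump_density_integrable[of "\<lambda>_. 1" 1 s z] by simp
  moreover have "\<bar>jump_density z r\<bar> \<le> C" if "0 \<le> r" "r \<le> s" for r
    using jump_density_bounds[of z r] confinedD(1)[OF V(1), of r t z] that s z by (simp add: rate_def max_def)
  ultimately have "\<bar>\<integral>r. indicator {0..s} r * jump_density z r \<partial>lborel\<bar> \<le> C * s"
    using s by (intro abs_indicator_integral_le) auto
  then show ?thesis using jump_density_integral[OF s(1), of z] by linarith
qed

lemma trunc_1:
  assumes "f \<in> borel_measurable borel" "\<And>x. \<bar>f x\<bar> \<le> B" "t \<ge> 0"
  shows "trunc f (Suc 0) z t = survival z t * f (\<phi> t z)"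
  using trunc_Suc[OF assms, of 0 z] by simp

text \<open>
  In time \<open>t\<close> the flow changes \<open>f\<close> by at most \<open>D t\<close>, and a jump occurs with probability at most
  \<open>C t\<close>.
\<close>

lemma trunc_1_close:
  assumes f: "f \<in> C_c_infinity" "\<And>x. \<bar>f x\<bar> \<le> B" "\<And>x. \<bar>transport f x\<bar> \<le> D"
    and V: "confined C V" "C \<ge> 0" and t: "t \<ge> 0" and z: "z \<in> V t"
  shows "\<bar>trunc f (Suc 0) z t - f z\<bar> \<le> (D + C * B) * t"
proof -
  have fm: "f \<in> borel_measurable borel" by (rule borel_measurable_continuous_onI[OF C_c_infinity_continuous[OF f(1)]])
  have "norm (f (\<phi> t z) - f (\<phi> 0 z)) \<le> D * t"
    using flow_derivative_smooth[OF f(1)] f(3) t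
    by (intro path_increment_bound[where u'="\<lambda>s. transport f (\<phi> s z)"])
       (auto simp: has_real_derivative_iff_has_vector_derivative)
  moreover have "\<bar>(1 - survival z t) * f (\<phi> t z)\<bar> \<le> (C * t) * B"
    unfolding abs_mult using survival_defect[OF V t order_refl z] survival_bounds[of z t] f(2) V t
    by (intro mult_mono) auto
  moreover have "survival z t * f (\<phi> t z) - f z = (f (\<phi> t z) - f z) - (1 - survival z t) * f (\<phi> t z)"
    by (simp add: algebra_simps)
  ultimately show ?thesis
    unfolding trunc_1[OF fm f(2) t] by (simp add: algebra_simps)
qed

text \<open>
  Up to an error of order \<open>t\<^sup>2\<close> at most one jump occurs before \<open>t\<close>. The contribution without a jump has
  derivative \<open>k2 = A f - lam f\<close> at time 0, the contribution of one jump is \<open>t\<close> times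
  \<open>k1 = lam Q f\<close>; both functions lie in \<open>C_0\<close>, hence vary uniformly little along the flow for a
  short time.
\<close>

lemma Pt_generator_estimate:
  assumes f: "f \<in> C_c_infinity" and k: "(\<lambda>z. lam z * jump_avg f z) \<in> C_0"
    and V: "confined C V" "C \<ge> 0" and e: "e > 0"
  obtains d where "d > 0" "\<And>t z. 0 < t \<Longrightarrow> t < d \<Longrightarrow> z \<in> V t \<Longrightarrow>
    \<bar>(Pt t f z - f z) / t - (transport f z + lam z * (jump_avg f z - f z))\<bar> \<le> e"
proof -
  have f0: "f \<in> C_0" by (rule C_c_infinity_C_0[OF f])
  obtain B where B: "B > 0" "\<And>x. \<bar>f x\<bar> \<le> B" using C_0_bounded[OF f0] by blast
  obtain D where D: "D > 0" "\<And>x. \<bar>transport f x\<bar> \<le> D" using C_0_bounded[OF transport_C_0[OF f]] by blast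
  have fm: "f \<in> borel_measurable borel" by (rule C_0_measurable[OF f0])
  define k1 where "k1 z = lam z * jump_avg f z" for z
  define k2 where "k2 z = transport f z - lam z * f z" for z
  have k1: "k1 \<in> C_0" using k by (simp add: k1_def[abs_def])
  have k2: "k2 \<in> C_0"
  proof -
    obtain r where r: "\<And>x. norm x > r \<Longrightarrow> f x = 0" "\<And>x. norm x > r \<Longrightarrow> transport f x = 0"
      using transport_support[OF f] by metis
    show ?thesis
    proof (rule C_0I_compact_support)
      show "continuous_on UNIV k2" unfolding k2_def[abs_def]
        by (intro continuous_intros C_0_continuous transport_C_0 f f0 lam_continuous)
      show "k2 x = 0" if "norm x > r" for x using r[OF that] by (simp add: k2_def)
    qed
  qed
  have e4: "e / 4 > 0" using e by simp
  obtain d1 where d1: "d1 > 0" "\<And>s z. 0 \<le> s \<Longrightarrow> s \<le> d1 \<Longrightarrow> \<bar>k1 (\<phi> s z) - k1 z\<bar> \<le> e / 4"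
    using flow_strongly_continuous[OF k1 e4] by metis
  obtain d2 where d2: "d2 > 0" "\<And>s z. 0 \<le> s \<Longrightarrow> s \<le> d2 \<Longrightarrow> \<bar>k2 (\<phi> s z) - k2 z\<bar> \<le> e / 4"
    using flow_strongly_continuous[OF k2 e4] by metis
  define E0 where "E0 = D + C * B"
  have E0: "E0 \<ge> 0" using D B V by (simp add: E0_def)
  \<comment> \<open>E * t collects all errors of first order in t, among them B * C^2 * t for two jumps.\<close>
  define E where "E = 2 * (C * E0) + 2 * (C * C * B)"
  have E: "E \<ge> 0" using E0 V B by (simp add: E_def)
  define d where "d = min (min d1 d2) (e / 2 / (E + 1))"
  have d: "d > 0" using d1 d2 e E by (simp add: d_def)
  show thesis
  proof (rule that[OF d])
    fix t z assume t: "0 < t" "t < d" and z: "z \<in> V t"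
    have t0: "t \<ge> 0" using t by simp
    have lamC: "lam (\<phi> s z) \<le> C" "rate z s = lam (\<phi> s z)" if "0 \<le> s" "s \<le> t" for s
      using confinedD(1)[OF V(1) that z] that by (auto simp: rate_def max_def)
    have defect: "1 - survival z s \<le> C * t" if s: "0 \<le> s" "s \<le> t" for s
      using survival_defect[OF V s z] mult_left_mono[OF s(2) V(2)] by linarith
    define K where "K s = jump_avg (\<lambda>y. trunc f (Suc 0) y (t - s)) (\<phi> (max 0 s) z)" for s
    have Km: "K \<in> borel_measurable borel" unfolding K_def by (rule jump_avg_trunc_measurable[OF fm])
    have KB: "\<bar>K s\<bar> \<le> B" for s unfolding K_def by (rule jump_avg_bound[OF trunc_bound[OF B(2)]])
    have A: "\<bar>survival z t * f (\<phi> t z) - f z - t * k2 z\<bar> \<le> (C * t * E0 + e / 4) * t"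
    proof -
      have "norm ((survival z t * f (\<phi> t z) - t * k2 z) - (survival z 0 * f (\<phi> 0 z) - 0 * k2 z)) \<le> (C * t * E0 + e / 4) * t"
      proof (rule path_increment_bound[OF _ _ t0])
        fix s :: real assume s: "s \<ge> 0"
        have "((\<lambda>s. survival z s * f (\<phi> s z) - s * k2 z) has_real_derivative
            survival z s * transport f (\<phi> s z) + (- jump_density z s) * f (\<phi> s z) - k2 z) (at s within {0..})"
          using survival_derivative[OF s, of z] flow_derivative_smooth[OF f s, of z]
          by (auto intro!: derivative_eq_intros)
        also have "survival z s * transport f (\<phi> s z) + (- jump_density z s) * f (\<phi> s z) - k2 z =
            survival z s * k2 (\<phi> s z) - k2 z"
          using s by (simp add: jump_density_def rate_def max_def k2_def algebra_simps)
        finally show "((\<lambda>s. survival z s * f (\<phi> s z) - s * k2 z) has_vector_derivative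
            survival z s * k2 (\<phi> s z) - k2 z) (at s within {0..})"
          by (simp add: has_real_derivative_iff_has_vector_derivative)
      next
        fix s assume s: "0 \<le> s" "s \<le> t"
        have "\<bar>lam (\<phi> s z) * f (\<phi> s z)\<bar> \<le> C * B"
          unfolding abs_mult using lamC[OF s] lam_nonneg B V by (intro mult_mono) auto
        then have k2b: "\<bar>k2 (\<phi> s z)\<bar> \<le> E0" using D(2)[of "\<phi> s z"] unfolding k2_def E0_def by linarith
        have "\<bar>(1 - survival z s) * k2 (\<phi> s z)\<bar> \<le> (C * t) * E0"
          unfolding abs_mult using defect[OF s] survival_bounds[of z s] k2b V t by (intro mult_mono) auto
        moreover have "survival z s * k2 (\<phi> s z) - k2 z = (k2 (\<phi> s z) - k2 z) - (1 - survival z s) * k2 (\<phi> s z)"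
          by (simp add: algebra_simps)
        moreover have "\<bar>k2 (\<phi> s z) - k2 z\<bar> \<le> e / 4" using d2(2)[of s z] s t by (simp add: d_def)
        ultimately show "norm (survival z s * k2 (\<phi> s z) - k2 z) \<le> C * t * E0 + e / 4"
          unfolding real_norm_def by linarith
      qed
      then show ?thesis by (simp add: algebra_simps)
    qed
    have A': "\<bar>(\<integral>s. indicator {0..t} s * (jump_density z s * K s) \<partial>lborel) - t * k1 z\<bar> \<le> (C * (E0 * t) + (C * t) * (C * B) + e / 4) * t"
    proof -
      have int: "integrable lborel (\<lambda>s. indicator {0..t} s * (jump_density z s * K s))"
        by (rule jump_density_integrable[OF Km KB])
      have eq: "indicator {0..t} s * (jump_density z s * K s) - indicator {0..t} s * k1 z =
          indicator {0..t} s * (jump_density z s * K s - k1 z)" for s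
        by (simp add: algebra_simps)
      have "(\<integral>s. indicator {0..t} s * k1 z \<partial>lborel) = t * k1 z" using t0 by simp
      then have "(\<integral>s. indicator {0..t} s * (jump_density z s * K s) \<partial>lborel) - t * k1 z =
          (\<integral>s. indicator {0..t} s * (jump_density z s * K s - k1 z) \<partial>lborel)"
        using Bochner_Integration.integral_diff[OF int integrable_indicator_Icc[of t "k1 z"]] by (simp only: eq)
      also have "\<bar>\<dots>\<bar> \<le> (C * (E0 * t) + (C * t) * (C * B) + e / 4) * t"
      proof (rule abs_indicator_integral_le[OF _ _ t0])
        show "integrable lborel (\<lambda>s. indicator {0..t} s * (jump_density z s * K s - k1 z))"
          using Bochner_Integration.integrable_diff[OF int integrable_indicator_Icc[of t "k1 z"]] by (simp only: eq)
        fix s assume s: "0 \<le> s" "s \<le> t"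
        let ?q = "jump_avg f (\<phi> s z)"
        have "K s - ?q = jump_avg (\<lambda>y. trunc f (Suc 0) y (t - s) - f y) (\<phi> s z)"
          using s jump_avg_diff[of "\<lambda>y. trunc f (Suc 0) y (t - s)" B f B "\<phi> s z"] trunc_bound[OF B(2)] B(2) fm
          by (simp add: K_def max_def trunc_measurable)
        also have "\<bar>\<dots>\<bar> \<le> E0 * t"
        proof (rule jump_avg_abs_le)
          fix x assume x: "x \<in> space \<Xi>"
          have "\<bar>trunc f (Suc 0) (R x (\<phi> s z)) (t - s) - f (R x (\<phi> s z))\<bar> \<le> E0 * (t - s)"
            unfolding E0_def using s confinedD(2)[OF V(1) s z x]
            by (intro trunc_1_close[OF f B(2) D(2) V]) auto
          also have "\<dots> \<le> E0 * t" using E0 s by (intro mult_left_mono) auto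
          finally show "\<bar>trunc f (Suc 0) (R x (\<phi> s z)) (t - s) - f (R x (\<phi> s z))\<bar> \<le> E0 * t" .
        qed (use E0 t in simp)
        finally have Kq: "\<bar>K s - ?q\<bar> \<le> E0 * t" .
        have q: "\<bar>?q\<bar> \<le> B" by (rule jump_avg_bound[OF B(2)])
        have 1: "\<bar>jump_density z s * (K s - ?q)\<bar> \<le> C * (E0 * t)"
          unfolding abs_mult using jump_density_bounds[of z s] lamC[OF s] Kq V E0 t by (intro mult_mono) auto
        have k1b: "\<bar>k1 (\<phi> s z)\<bar> \<le> C * B"
          unfolding k1_def abs_mult using lamC[OF s] lam_nonneg q V by (intro mult_mono) auto
        have 2: "\<bar>(1 - survival z s) * k1 (\<phi> s z)\<bar> \<le> (C * t) * (C * B)"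
          unfolding abs_mult using defect[OF s] survival_bounds[of z s] k1b V t by (intro mult_mono) auto
        have "jump_density z s * K s - k1 z =
            jump_density z s * (K s - ?q) - (1 - survival z s) * k1 (\<phi> s z) + (k1 (\<phi> s z) - k1 z)"
          using lamC(2)[OF s] by (simp add: jump_density_def k1_def algebra_simps)
        moreover have "\<bar>k1 (\<phi> s z) - k1 z\<bar> \<le> e / 4" using d1(2)[of s z] s t by (simp add: d_def)
        ultimately show "\<bar>jump_density z s * K s - k1 z\<bar> \<le> C * (E0 * t) + (C * t) * (C * B) + e / 4"
          using 1 2 by linarith
      qed
      finally show ?thesis .
    qed
    have "\<bar>Pt t f z - trunc f (Suc (Suc 0)) z t\<bar> \<le> B * ((C * t) ^ Suc (Suc 0) / fact (Suc (Suc 0)))"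
      by (rule Pt_trunc_close[OF V fm B(2) t0 z])
    also have "\<dots> \<le> (C * C * B * t) * t" using B V t by (simp add: field_simps)
    finally have C': "\<bar>Pt t f z - trunc f (Suc (Suc 0)) z t\<bar> \<le> (C * C * B * t) * t" .
    have "trunc f (Suc (Suc 0)) z t = survival z t * f (\<phi> t z) + (\<integral>s. indicator {0..t} s * (jump_density z s * K s) \<partial>lborel)"
      unfolding K_def by (rule trunc_Suc[OF fm B(2) t0])
    with A A' C' have "\<bar>Pt t f z - f z - t * (k1 z + k2 z)\<bar> \<le>
        (C * t * E0 + e / 4) * t + (C * (E0 * t) + (C * t) * (C * B) + e / 4) * t + (C * C * B * t) * t"
      unfolding distrib_left by linarith
    also have "\<dots> = (E * t + e / 2) * t" by (simp add: E_def algebra_simps)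
    also have "\<dots> \<le> e * t"
    proof -
      have "E * t \<le> E * (e / 2 / (E + 1))" using t E by (intro mult_left_mono) (auto simp: d_def)
      also have "\<dots> \<le> e / 2" using E e by (simp add: field_simps)
      finally show ?thesis using t by (intro mult_right_mono) auto
    qed
    finally have "\<bar>Pt t f z - f z - t * (k1 z + k2 z)\<bar> / t \<le> e" using t by (simp add: field_simps)
    moreover have "(Pt t f z - f z) / t - (transport f z + lam z * (jump_avg f z - f z)) = (Pt t f z - f z - t * (k1 z + k2 z)) / t"
      using t by (simp add: k1_def k2_def field_simps)
    ultimately show "\<bar>(Pt t f z - f z) / t - (transport f z + lam z * (jump_avg f z - f z))\<bar> \<le> e"
      using t by (simp add: abs_divide)
  qed
qed

end

context lipschitz_pdmp
begin

text \<open>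
  Starting points outside the confined set have to be treated separately: there the difference
  quotient and the candidate \<open>h\<close> both vanish by \<open>far\<close>.
\<close>

lemma generates_of_estimate:
  assumes f: "f \<in> C_c_infinity" and k: "(\<lambda>z. lam z * jump_avg f z) \<in> C_0"
    and V: "confined C V" "C \<ge> 0"
    and h: "h \<in> C_0" "\<And>z. h z = transport f z + lam z * (jump_avg f z - f z)"
    and far: "\<And>t z. 0 < t \<Longrightarrow> t \<le> 1 \<Longrightarrow> z \<notin> V t \<Longrightarrow> Pt t f z = 0 \<and> f z = 0 \<and> h z = 0"
  shows "generates Pt f h"
  unfolding generates_def
proof (intro conjI h(1) C_c_infinity_C_0[OF f] uniform_limitI)
  fix e :: real assume "e > 0"
  then have e: "e / 2 > 0" by simp
  obtain d where d: "d > 0" "\<And>t z. 0 < t \<Longrightarrow> t < d \<Longrightarrow> z \<in> V t \<Longrightarrow>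
      \<bar>(Pt t f z - f z) / t - (transport f z + lam z * (jump_avg f z - f z))\<bar> \<le> e / 2"
    using Pt_generator_estimate[OF f k V e] by metis
  have "dist ((Pt t f z - f z) / t) (h z) < e" if t: "0 < t" "t < min 1 d" for t z
  proof (cases "z \<in> V t")
    case True
    then show ?thesis using d(2)[of t z] t e by (simp add: dist_real_def h(2))
  next
    case False
    then show ?thesis using far[of t z] t e by simp
  qed
  then show "\<forall>\<^sub>F t in at_right 0. \<forall>z\<in>UNIV. dist ((Pt t f z - f z) / t) (h z) < e"
    using d(1) by (auto simp: eventually_at_right_field intro!: exI[of _ "min 1 d"])
qed

lemma is_core_of_generates:
  assumes gen: "\<And>F. F \<in> C_c_infinity \<Longrightarrow> generates Pt F (A F)"
    and \<beta>: "\<beta> > 0" and dense: "dense_range (\<lambda>F x. \<beta> * F x - A F x)"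
  shows "is_core Pt C_c_infinity"
  using Pt_bound[OF C_0_measurable] Pt_diff gen \<beta> dense
  by (intro is_core_of_dense_range[where A=A and \<beta>=\<beta>]) auto

lemma jump_transportI:
  assumes "\<And>F. F \<in> C_0 \<Longrightarrow> jump_avg F \<in> C_0"
  shows "jump_transport g \<phi> L jump_avg"
  by unfold_locales (use jump_avg_bound jump_avg_add assms in auto)

section \<open>Bounded intensity\<close>

text \<open>
  With a bounded intensity the whole space is confined, so \<open>trunc f n\<close> tends to \<open>P_t f\<close> uniformly
  and vanishing at infinity is inherited.
\<close>

theorem feller_core_bounded_intensity:
  assumes lam: "\<And>z. lam z \<le> C"
    and R: "\<And>x. x \<in> space \<Xi> \<Longrightarrow> filterlim (\<lambda>z. norm (R x z)) at_top at_infinity"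
  shows "t \<ge> 0 \<Longrightarrow> f \<in> C_0 \<Longrightarrow> Pt t f \<in> C_0" and "is_core Pt C_c_infinity"
proof -
  have C: "C \<ge> 0" using lam lam_nonneg order_trans by blast
  have avg: "jump_avg F \<in> C_0" if "F \<in> C_0" for F by (rule jump_avg_C_0_escaping[OF R that])
  have V: "confined C (\<lambda>_. UNIV)" using lam by (simp add: confined_def)
  then have lc: locally_confined unfolding locally_confined_def using C by blast
  show feller: "Pt t f \<in> C_0" if t: "t \<ge> 0" and f: "f \<in> C_0" for t f
    unfolding C_0_iff
  proof (intro conjI allI impI Pt_continuous[OF lc f t])
    obtain B where B: "\<And>x. \<bar>f x\<bar> \<le> B" using C_0_bounded[OF f] by metis
    fix e :: real assume "e > 0"
    then have e: "e / 2 > 0" by simp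
    obtain n where n: "B * ((C * t) ^ n / fact n) < e / 2"
      using power_fact_small[OF e, of B "C * t"] by (auto simp: eventually_sequentially)
    obtain r where r: "\<And>z. norm z > r \<Longrightarrow> \<bar>trunc f n z t\<bar> \<le> e / 2"
      using C_0_small[OF trunc_C_0[OF lam avg f t] e] by metis
    have "\<bar>Pt t f z\<bar> \<le> e" if "norm z > r" for z
      using Pt_trunc_close[OF V C C_0_measurable[OF f] B t UNIV_I, of z n]
        r[OF that] n by linarith
    then show "\<exists>r. \<forall>z. norm z > r \<longrightarrow> \<bar>Pt t f z\<bar> \<le> e" by blast
  qed
  interpret J: jump_transport g \<phi> L jump_avg by (rule jump_transportI[OF avg])
  have gen: "generates Pt F (J.generator lam F)" if F: "F \<in> C_c_infinity" for F
  proof (rule generates_of_estimate[OF F _ V C])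
    show "(\<lambda>z. lam z * jump_avg F z) \<in> C_0"
      by (rule C_0_mult_bounded[OF avg[OF C_c_infinity_C_0[OF F]] lam_continuous, of C])
         (use lam lam_nonneg in auto)
    show "J.generator lam F \<in> C_0"
      by (rule J.bounded_rate_generator_C_0[OF lam_continuous lam_nonneg lam F])
  qed (auto simp: J.generator_def)
  show "is_core Pt C_c_infinity"
    by (rule is_core_of_generates[OF gen zero_less_one J.bounded_rate_dense_range[OF lam_continuous lam_nonneg lam zero_less_one]])
qed

section \<open>Norm-preserving jumps\<close>

text \<open>
  Norm-preserving jumps do not change the weight, and the flow changes it by a factor of at most
  \<open>exp (speed * t)\<close>. Thus sublevel sets of the weight, with a level that decreases in the time left,
  are confined, and superlevel sets show that a process started far away is still far away at time
  \<open>t\<close>.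
\<close>

theorem feller_core_isometric_jumps:
  assumes R: "\<And>x z. x \<in> space \<Xi> \<Longrightarrow> norm (R x z) = norm z"
  shows "t \<ge> 0 \<Longrightarrow> f \<in> C_0 \<Longrightarrow> Pt t f \<in> C_0" and "is_core Pt C_c_infinity"
proof -
  have avg: "jump_avg F \<in> C_0" if "F \<in> C_0" for F by (rule jump_avg_C_0_isometric[OF R that])
  have Rw: "weight (R x z) = weight z" if "x \<in> space \<Xi>" for x z
    using R[OF that] by (simp add: weight_def dot_square_norm)
  have confined: "\<exists>C\<ge>0. confined C (\<lambda>t. {z. exp (speed * t) * weight z \<le> K})" for K
  proof -
    have "compact (lam ` cball 0 K)"
      by (intro compact_continuous_image continuous_on_subset[OF lam_continuous]) auto
    then have "bounded (lam ` cball 0 K)" by (rule compact_imp_bounded)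
    then obtain C where C: "\<forall>y\<in>lam ` cball 0 K. norm y \<le> C" unfolding bounded_iff by blast
    have "confined (max 0 C) (\<lambda>t. {z. exp (speed * t) * weight z \<le> K})"
      unfolding confined_def
    proof (intro allI impI conjI ballI)
      fix t z s assume s: "0 \<le> s" "s \<le> t" and "z \<in> {z. exp (speed * t) * weight z \<le> K}"
      then have z: "exp (speed * t) * weight z \<le> K" by simp
      have "exp (speed * (t - s)) * weight (\<phi> s z) \<le> exp (speed * (t - s)) * (exp (speed * s) * weight z)"
        by (intro mult_left_mono weight_flow(1) s) simp
      also have "\<dots> = exp (speed * t) * weight z"
        by (simp add: mult.assoc[symmetric] exp_add[symmetric] algebra_simps)
      finally have *: "exp (speed * (t - s)) * weight (\<phi> s z) \<le> K" using z by simp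
      then show "R x (\<phi> s z) \<in> {z. exp (speed * (t - s)) * weight z \<le> K}" if "x \<in> space \<Xi>" for x
        by (simp add: Rw[OF that])
      have "1 * weight (\<phi> s z) \<le> exp (speed * (t - s)) * weight (\<phi> s z)"
        using s speed_nonneg weight_ge_1[of "\<phi> s z"] by (intro mult_right_mono) auto
      then have "\<phi> s z \<in> cball 0 K" using * norm_le_weight[of "\<phi> s z"] by simp
      then have "\<bar>lam (\<phi> s z)\<bar> \<le> C" using C by simp
      then show "lam (\<phi> s z) \<le> max 0 C" by simp
    qed
    then show ?thesis by (intro exI[of _ "max 0 C"]) auto
  qed
  have lc: locally_confined
    unfolding locally_confined_def
  proof (intro allI impI)
    fix t r :: real
    obtain C where C: "C \<ge> 0" "confined C (\<lambda>s. {z. exp (speed * s) * weight z \<le> exp (speed * t) * (1 + r^2)})"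
      using confined by blast
    have "exp (speed * t) * weight z \<le> exp (speed * t) * (1 + r^2)" if "norm z \<le> r" for z
      using that by (intro mult_left_mono) (auto simp: weight_def dot_square_norm intro!: power_mono)
    with C show "\<exists>C\<ge>0. \<exists>V. confined C V \<and> (\<forall>z. norm z \<le> r \<longrightarrow> z \<in> V t)"
      by (intro exI[of _ C] conjI exI[of _ "\<lambda>s. {z. exp (speed * s) * weight z \<le> exp (speed * t) * (1 + r^2)}"]) auto
  qed
  have far: "\<bar>Pt t f z\<bar> \<le> e"
    if f: "f \<in> C_0" and small: "\<And>x. weight x > K \<Longrightarrow> \<bar>f x\<bar> \<le> e" and e: "e \<ge> 0" and t: "t \<ge> 0"
      and z: "weight z > exp (speed * t) * K" for f K e t z
  proof (rule Pt_le_of_trunc_le[OF lc f t])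
    fix n
    show "\<bar>trunc f n z t\<bar> \<le> e"
    proof (rule trunc_invariant_bound[where V="\<lambda>t. {z. weight z > exp (speed * t) * K}", OF _ _ e t])
      fix t z s x assume s: "0 \<le> s" "s \<le> t" and "z \<in> {z. weight z > exp (speed * t) * K}" and x: "x \<in> space \<Xi>"
      then have "exp (speed * t) * K < weight z" by simp
      also have "\<dots> \<le> exp (speed * s) * weight (\<phi> s z)" by (rule weight_flow(2)[OF s(1)])
      also have "exp (speed * t) = exp (speed * s) * exp (speed * (t - s))"
        by (simp add: exp_add[symmetric] algebra_simps)
      finally show "R x (\<phi> s z) \<in> {z. weight z > exp (speed * (t - s)) * K}"
        by (simp add: Rw[OF x] mult.assoc)
    next
      fix t z assume t: "0 \<le> t" and "z \<in> {z. weight z > exp (speed * t) * K}"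
      then have "exp (speed * t) * K < weight z" by simp
      also have "weight z \<le> exp (speed * t) * weight (\<phi> t z)" by (rule weight_flow(2)[OF t])
      finally have "exp (speed * t) * K < exp (speed * t) * weight (\<phi> t z)" .
      then show "\<bar>f (\<phi> t z)\<bar> \<le> e" by (intro small) simp
    qed (use z in simp)
  qed
  show feller: "Pt t f \<in> C_0" if t: "t \<ge> 0" and f: "f \<in> C_0" for t f
    unfolding C_0_iff
  proof (intro conjI allI impI Pt_continuous[OF lc f t])
    fix e :: real assume e: "e > 0"
    obtain r where r: "r > 0" "\<And>x. norm x > r \<Longrightarrow> \<bar>f x\<bar> \<le> e" using C_0_small[OF f e] by blast
    have "\<bar>Pt t f z\<bar> \<le> e" if "norm z > exp (speed * t) * (1 + r^2)" for z
    proof (rule far[OF f _ _ t])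
      show "\<bar>f x\<bar> \<le> e" if "weight x > 1 + r^2" for x
        using that r(1) by (intro r(2)) (simp add: weight_def dot_square_norm power_less_imp_less_base)
      show "weight z > exp (speed * t) * (1 + r^2)" using that norm_le_weight[of z] by simp
    qed (use e in simp)
    then show "\<exists>r. \<forall>z. norm z > r \<longrightarrow> \<bar>Pt t f z\<bar> \<le> e" by blast
  qed
  interpret J: radial_jump_transport g \<phi> L jump_avg
  proof -
    interpret jump_transport g \<phi> L jump_avg by (rule jump_transportI[OF avg])
    show "radial_jump_transport g \<phi> L jump_avg"
    proof
      fix F w x assume "F \<in> (C_0 :: ('a \<Rightarrow> real) set)" and w: "\<And>x y. norm x = norm (y::'a) \<Longrightarrow> w x = (w y :: real)"
      have "jump_avg (\<lambda>x. w x * F x) x = (\<integral>s. w x * F (R s x) \<partial>\<Xi>)"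
        unfolding jump_avg_def by (intro Bochner_Integration.integral_cong) (auto simp: w[OF R])
      then show "jump_avg (\<lambda>x. w x * F x) x = w x * jump_avg F x" by (simp add: jump_avg_def)
    qed
  qed
  have gen: "generates Pt F (J.generator lam F)" if F: "F \<in> C_c_infinity" for F
  proof -
    have F0: "F \<in> C_0" by (rule C_c_infinity_C_0[OF F])
    obtain r where r: "r > 0" "\<And>x. norm x > r \<Longrightarrow> F x = 0" "\<And>x. norm x > r \<Longrightarrow> transport F x = 0"
      using transport_support[OF F] by blast
    have avg0: "jump_avg F x = 0" if "norm x > r" for x
      using jump_avg_abs_le[of F x 0] r(2) R that by simp
    define K where "K = 1 + r^2"
    have big: "norm x > r" if "weight x > K" for x
      using that r(1) by (simp add: K_def weight_def dot_square_norm power_less_imp_less_base)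
    \<comment> \<open>The factor exp (speed * 2) leaves room for t \<le> 1: outside of the confined set the weight
      exceeds exp (speed * t) * K, so the process cannot reach the support of F by time t.\<close>
    obtain C where C: "C \<ge> 0" "confined C (\<lambda>t. {z. exp (speed * t) * weight z \<le> exp (speed * 2) * K})"
      using confined by blast
    show ?thesis
    proof (rule generates_of_estimate[OF F _ C(2,1)])
      show "(\<lambda>z. lam z * jump_avg F z) \<in> C_0"
      proof (rule C_0I_compact_support)
        show "continuous_on UNIV (\<lambda>z. lam z * jump_avg F z)"
          by (intro continuous_intros lam_continuous C_0_continuous avg F0)
        show "lam z * jump_avg F z = 0" if "norm z > r" for z using avg0[OF that] by simp
      qed
      show "J.generator lam F \<in> C_0" by (rule J.generator_C_0[OF lam_continuous F])
      fix t z assume t: "0 < t" "t \<le> 1" and "z \<notin> {z. exp (speed * t) * weight z \<le> exp (speed * 2) * K}"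
      then have "exp (speed * 2) * K < exp (speed * t) * weight z" by simp
      moreover have "exp (speed * t) * (exp (speed * t) * K) \<le> exp (speed * 2) * K"
      proof -
        have "exp (speed * t) * exp (speed * t) \<le> exp (speed * 2)"
          using t speed_nonneg mult_left_mono[of "t + t" 2 speed] by (simp add: exp_add[symmetric] algebra_simps)
        then show ?thesis by (simp add: mult.assoc[symmetric] K_def mult_right_mono)
      qed
      ultimately have "exp (speed * t) * (exp (speed * t) * K) < exp (speed * t) * weight z" by linarith
      then have w: "exp (speed * t) * K < weight z" by simp
      have "1 * K \<le> exp (speed * t) * K" using t speed_nonneg by (intro mult_right_mono) (auto simp: K_def)
      with w have z: "norm z > r" by (intro big) simp
      have "\<bar>Pt t F z\<bar> \<le> 0" by (rule far[OF F0 _ _ _ w]) (use big r t in auto)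
      then show "Pt t F z = 0 \<and> F z = 0 \<and> J.generator lam F z = 0"
        using r(2,3)[OF z] avg0[OF z] by (simp add: J.generator_def)
    qed (simp add: J.generator_def)
  qed
  obtain \<beta> where \<beta>: "\<beta> > 0" "dense_range (\<lambda>F x. \<beta> * F x - J.generator lam F x)"
    using J.unbounded_rate_dense_range[OF lam_continuous lam_nonneg] by blast
  show "is_core Pt C_c_infinity" by (rule is_core_of_generates[OF gen \<beta>])
qed

end

theorem theorem5p4:
  fixes g :: "real ^ 'd \<Rightarrow> real ^ 'd"
    and \<phi> :: "real \<Rightarrow> real ^ 'd \<Rightarrow> real ^ 'd"
    and lam :: "real ^ 'd \<Rightarrow> real"
    and \<Xi> :: "'s measure"
    and R :: "'s \<Rightarrow> real ^ 'd \<Rightarrow> real ^ 'd"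
    and W :: "real ^ 'd \<Rightarrow> real \<Rightarrow> ennreal"
    and M :: "'w measure"
    and U :: "nat \<Rightarrow> 'w \<Rightarrow> real"
    and \<xi> :: "nat \<Rightarrow> 'w \<Rightarrow> 's"
  assumes pdmp: "pdmp g \<phi> lam \<Xi> R W M U \<xi>"
    and g_lipschitz: "\<exists>L>0. L-lipschitz_on UNIV g"
    and R_C1: "\<And>s. s \<in> space \<Xi> \<Longrightarrow> C_k 1 (R s)"
    and R_contract: "\<And>s. s \<in> space \<Xi> \<Longrightarrow> 1-lipschitz_on UNIV (R s)"
    and growth:
      "(bounded (range lam) \<and>
        (\<forall>t>0. filterlim (\<lambda>z. INF s\<in>{0..t}. norm (\<phi> s z)) at_top at_infinity) \<and>
        (\<forall>s\<in>space \<Xi>. filterlim (\<lambda>z. norm (R s z)) at_top at_infinity))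
       \<or>
       ((\<forall>s\<in>space \<Xi>. \<forall>z. norm (R s z) = norm z) \<and>
        (\<forall>t>0. filterlim
           (\<lambda>z. Inf {norm (flow_jumps \<phi> R ts xs k z) | k ts xs.
                  (\<forall>i\<le>k. 0 \<le> ts i) \<and> (\<Sum>i\<le>k. ts i) = t \<and> (\<forall>i\<in>{1..k}. xs i \<in> space \<Xi>)})
           at_top at_infinity))"
  shows "(\<forall>t\<ge>0. \<forall>f\<in>C_0. pdmp_semigroup \<phi> R W M U \<xi> t f \<in> C_0) \<and>
         is_core (pdmp_semigroup \<phi> R W M U \<xi>) C_c_infinity"
proof -
  obtain L where L: "L-lipschitz_on UNIV g" using g_lipschitz by blast
  interpret lipschitz_pdmp g \<phi> lam \<Xi> R W M U \<xi> L
  proof (intro lipschitz_pdmp.intro lipschitz_pdmp_axioms.intro lipschitz_flow.intro pdmp L)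
    show "is_flow g \<phi>" by (rule pdmp.flow[OF pdmp])
    show "continuous_on UNIV (R s)" if "s \<in> space \<Xi>" for s
      by (rule lipschitz_on_continuous_on[OF R_contract[OF that]])
  qed
  from growth show ?thesis
  proof
    assume *: "bounded (range lam) \<and>
        (\<forall>t>0. filterlim (\<lambda>z. INF s\<in>{0..t}. norm (\<phi> s z)) at_top at_infinity) \<and>
        (\<forall>s\<in>space \<Xi>. filterlim (\<lambda>z. norm (R s z)) at_top at_infinity)"
    then obtain C where "\<And>z. \<bar>lam z\<bar> \<le> C" by (auto simp: bounded_iff)
    then have "lam z \<le> C" for z by (rule abs_le_D1)
    with * show ?thesis using feller_core_bounded_intensity[of C] by blast
  next
    assume "(\<forall>s\<in>space \<Xi>. \<forall>z. norm (R s z) = norm z) \<and>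
        (\<forall>t>0. filterlim
           (\<lambda>z. Inf {norm (flow_jumps \<phi> R ts xs k z) | k ts xs.
                  (\<forall>i\<le>k. 0 \<le> ts i) \<and> (\<Sum>i\<le>k. ts i) = t \<and> (\<forall>i\<in>{1..k}. xs i \<in> space \<Xi>)})
           at_top at_infinity)"
    then show ?thesis using feller_core_isometric_jumps by blast
  qed
qed

end
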